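(* Let $\mathbb{K}$ be an algebraically closed field of characteristic zero and let $X$ be a rigid affine variety over $\mathbb{K}$. Then there is a subtorus $\mathbb{T}$ in $\mathrm{Aut}(X)$ that contains every other subtorus of $\mathrm{Aut}(X)$. In particular, $\mathbb{T}$ is a normal subgroup of $\mathrm{Aut}(X)$.
   Context: $\mathrm{Aut}(X)$ is the (abstract) group of all algebraic automorphisms of the variety $X$. A subgroup $G\subseteq\mathrm{Aut}(X)$ is called algebraic if $G$ admits a structure of an algebraic group such that the action $G\times X\to X$ is a morphism of algebraic varieties. A subtorus of $\mathrm{Aut}(X)$ is an algebraic subgroup isomorphic, as an algebraic group, to a direct product of finitely many copies of $\mathbb{K}^{\times}$. An irreducible affine variety $X$ is called rigid if it admits no nontrivial regular action of the additive group $\mathbb{G}_a=(\mathbb{K},+)$; equivalently, the algebra of regular functions $\mathbb{K}[X]$ admits no nonzero locally nilpotent derivation (a derivation $D$ of $A$ is locally nilpotent if for every $a\in A$ there is $m>0$ with $D^m(a)=0$). *)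

theory Defs
  imports
    "HOL-Computational_Algebra.Polynomial"
    "HOL-Algebra.Group_Action"
    "Jordan_Normal_Form.Matrix"
begin

text \<open>
  Everything is stated over closed subsets of \<open>K\<^sup>n = carrier_vec n\<close>, where the field \<open>K\<close> is the
  element type and is meant to be algebraically closed. \<open>K\<^sup>m \<times> K\<^sup>n\<close> is identified with \<open>K\<^sup>m\<^sup>+\<^sup>n\<close>
  by concatenation of vectors.
\<close>

section \<open>Affine varieties and morphisms\<close>

inductive_set polynomial_funs :: "nat \<Rightarrow> ('k::field vec \<Rightarrow> 'k) set" for n :: nat where
  const: "(\<lambda>_. c) \<in> polynomial_funs n"
| coord: "i < n \<Longrightarrow> (\<lambda>x. x $ i) \<in> polynomial_funs n"
| add: "p \<in> polynomial_funs n \<Longrightarrow> q \<in> polynomial_funs n \<Longrightarrow> (\<lambda>x. p x + q x) \<in> polynomial_funs n"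
| mult: "p \<in> polynomial_funs n \<Longrightarrow> q \<in> polynomial_funs n \<Longrightarrow> (\<lambda>x. p x * q x) \<in> polynomial_funs n"

definition zariski_closed :: "nat \<Rightarrow> 'k::field vec set \<Rightarrow> bool" where
  "zariski_closed n X \<longleftrightarrow>
     (\<exists>P \<subseteq> polynomial_funs n. X = {x \<in> carrier_vec n. \<forall>p\<in>P. p x = 0})"

definition irreducible_affine_variety :: "nat \<Rightarrow> 'k::field vec set \<Rightarrow> bool" where
  "irreducible_affine_variety n X \<longleftrightarrow>
     zariski_closed n X \<and> X \<noteq> {} \<and>
     (\<forall>A B. zariski_closed n A \<longrightarrow> zariski_closed n B \<longrightarrow> X = A \<union> B \<longrightarrow> X = A \<or> X = B)"

definition regular_fun :: "nat \<Rightarrow> 'k::field vec set \<Rightarrow> ('k vec \<Rightarrow> 'k) \<Rightarrow> bool" where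
  "regular_fun n X f \<longleftrightarrow> (\<exists>p \<in> polynomial_funs n. \<forall>x\<in>X. f x = p x)"

definition morphism ::
  "nat \<Rightarrow> 'k::field vec set \<Rightarrow> nat \<Rightarrow> 'k vec set \<Rightarrow> ('k vec \<Rightarrow> 'k vec) \<Rightarrow> bool" where
  "morphism n X m Y f \<longleftrightarrow> f \<in> X \<rightarrow> Y \<and> (\<forall>i<m. regular_fun n X (\<lambda>x. f x $ i))"

definition product_variety :: "'k vec set \<Rightarrow> 'k vec set \<Rightarrow> 'k vec set" where
  "product_variety X Y = {x @\<^sub>v y | x y. x \<in> X \<and> y \<in> Y}"

text \<open>As in \<^const>\<open>BijGroup\<close>, maps are taken to be extensional on \<open>X\<close>, so that equality in the
  group is equality on \<open>X\<close>.\<close>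

definition Aut :: "nat \<Rightarrow> 'k::field vec set \<Rightarrow> ('k vec \<Rightarrow> 'k vec) monoid" where
  "Aut n X = (BijGroup X)\<lparr>carrier :=
     {f \<in> Bij X. morphism n X n X f \<and> morphism n X n X (inv_into X f)}\<rparr>"

section \<open>Algebraic groups and regular actions\<close>

definition affine_algebraic_group :: "nat \<Rightarrow> 'k::field vec monoid \<Rightarrow> bool" where
  "affine_algebraic_group m G \<longleftrightarrow>
     group G \<and> zariski_closed m (carrier G) \<and>
     morphism (m + m) (product_variety (carrier G) (carrier G)) m (carrier G)
       (\<lambda>v. vec_first v m \<otimes>\<^bsub>G\<^esub> vec_last v m) \<and>
     morphism m (carrier G) m (carrier G) (\<lambda>g. inv\<^bsub>G\<^esub> g)"

definition algebraic_group_iso ::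
  "nat \<Rightarrow> 'k::field vec monoid \<Rightarrow> nat \<Rightarrow> 'k vec monoid \<Rightarrow> ('k vec \<Rightarrow> 'k vec) \<Rightarrow> bool" where
  "algebraic_group_iso m G l H h \<longleftrightarrow>
     h \<in> iso G H \<and>
     morphism m (carrier G) l (carrier H) h \<and>
     morphism l (carrier H) m (carrier G) (inv_into (carrier G) h)"

definition regular_action ::
  "nat \<Rightarrow> 'k::field vec monoid \<Rightarrow> nat \<Rightarrow> 'k vec set \<Rightarrow> ('k vec \<Rightarrow> 'k vec \<Rightarrow> 'k vec) \<Rightarrow> bool" where
  "regular_action m G n X \<phi> \<longleftrightarrow>
     group_action G X \<phi> \<and>
     morphism (m + n) (product_variety (carrier G) X) n X (\<lambda>v. \<phi> (vec_first v m) (vec_last v n))"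

abbreviation additive_group :: "'k::field vec monoid" where
  "additive_group \<equiv> monoid_vec TYPE('k) 1"

definition rigid :: "nat \<Rightarrow> 'k::field vec set \<Rightarrow> bool" where
  "rigid n X \<longleftrightarrow>
     (\<forall>\<phi>. regular_action 1 additive_group n X \<phi> \<longrightarrow>
        (\<forall>t \<in> carrier additive_group. \<forall>x\<in>X. \<phi> t x = x))"

section \<open>Subtori of the automorphism group\<close>

text \<open>The torus \<open>(K\<^sup>\<times>)\<^sup>r\<close>, with \<open>t\<close> represented by \<open>(t\<^sub>1, \<dots>, t\<^sub>r, t\<^sub>1\<^sup>-\<^sup>1, \<dots>, t\<^sub>r\<^sup>-\<^sup>1)\<close> so that it is
  closed in \<open>K\<^sup>r\<^sup>+\<^sup>r\<close>. The case \<open>r = 0\<close>, the trivial group, is included.\<close>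

definition torus :: "nat \<Rightarrow> 'k::field vec monoid" where
  "torus r = \<lparr>carrier = {v \<in> carrier_vec (r + r). \<forall>i<r. v $ i * v $ (r + i) = 1},
     mult = (\<lambda>v w. vec (r + r) (\<lambda>i. v $ i * w $ i)),
     one = vec (r + r) (\<lambda>_. 1)\<rparr>"

text \<open>An algebraic group structure on a subgroup \<open>S\<close> of the automorphism group is presented as an
  algebraic group \<open>G\<close> with a group isomorphism \<open>\<psi>\<close> onto \<open>S\<close>, along which it is transported.
  A group admitting a structure isomorphic to a torus is affine in that structure, so only affine
  \<open>G\<close> are needed.\<close>

definition algebraic_structure ::
  "nat \<Rightarrow> 'k::field vec set \<Rightarrow> ('k vec \<Rightarrow> 'k vec) set \<Rightarrow>
   nat \<Rightarrow> 'k vec monoid \<Rightarrow> ('k vec \<Rightarrow> 'k vec \<Rightarrow> 'k vec) \<Rightarrow> bool" where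
  "algebraic_structure n X S m G \<psi> \<longleftrightarrow>
     affine_algebraic_group m G \<and>
     \<psi> \<in> iso G ((Aut n X)\<lparr>carrier := S\<rparr>) \<and>
     regular_action m G n X \<psi>"

definition subtorus :: "nat \<Rightarrow> 'k::field vec set \<Rightarrow> ('k vec \<Rightarrow> 'k vec) set \<Rightarrow> bool" where
  "subtorus n X S \<longleftrightarrow>
     subgroup S (Aut n X) \<and>
     (\<exists>m G \<psi>. algebraic_structure n X S m G \<psi> \<and>
        (\<exists>r h. algebraic_group_iso m G (r + r) (torus r) h))"

end

theory Submission
  imports Defs "HOL-Library.Function_Algebras"
begin

text \<open>
  Let \<open>A\<close> be the algebra of regular functions on \<open>X\<close>. A regular action of \<open>K\<^sup>\<times>\<close> splits \<open>A\<close> into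
  weight spaces \<open>A\<^sub>i\<close>, on which \<open>t\<close> acts as \<open>t\<^sup>i\<close>, and its derivative at \<open>t = 1\<close> is the derivation
  that multiplies \<open>A\<^sub>i\<close> by \<open>i\<close>.

  The heart of the matter is that on a rigid variety any two such actions \<open>a\<close> and \<open>u\<close> commute
  (\<open>onepar_commute\<close>). Decompose the derivation \<open>D\<close> of \<open>u\<close> into components that are homogeneous
  for the grading by \<open>a\<close>; as \<open>A\<close> is finitely generated, only finitely many are nonzero, and each
  is a derivation. Suppose that the highest degree \<open>m\<close> is positive. The iterates \<open>D\<^sup>k f\<close> stay in the
  span of the finitely many \<open>u\<close>-components of \<open>f\<close>, so their \<open>a\<close>-degrees are bounded; but the
  \<open>k\<close>-th power of the top component raises degrees by \<open>k m\<close>, and it computes the leading part of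
  \<open>D\<^sup>k f\<close>. Hence the top component is locally nilpotent
  (\<open>top_component_locally_nilpotent\<close>). A locally nilpotent derivation integrates to the action
  \<open>exp (t D)\<close> of the additive group, so on a rigid variety it vanishes (\<open>rigid_imp_zero\<close>), a
  contradiction. The same argument for \<open>t \<mapsto> a (t\<^sup>-\<^sup>1)\<close> excludes negative degrees. So \<open>D\<close> preserves the
  weight spaces of \<open>a\<close>, hence commutes with \<open>a\<close>; in characteristic zero the eigenspaces of \<open>D\<close> are
  the weight spaces of \<open>u\<close>, so \<open>a\<close> preserves these and commutes with \<open>u\<close>.

  The maximal torus is then found by maximising the rank. A \<^emph>\<open>frame\<close> of rank \<open>r\<close> is an action of
  \<open>(K\<^sup>\<times>)\<^sup>r\<close> on \<open>X\<close> whose weights on \<open>A\<close> generate \<open>\<int>\<^sup>r\<close>. Such an action is faithful, and its image is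
  a subtorus (\<open>frame_subtorus\<close>). Its rank is at most \<open>n\<close> (\<open>frame_rank_le\<close>): products of weight
  functions produce about \<open>N\<^sup>r\<close> distinct weights in degree \<open>O(N)\<close>, where there is room for only
  \<open>O(N\<^sup>n)\<close> linearly independent functions. Given a frame and a one-parameter subgroup \<open>a\<close>, the two
  commute and combine to an action of \<open>(K\<^sup>\<times>)\<^sup>r\<^sup>+\<^sup>1\<close>. If the weight for \<open>a\<close> is an integral linear
  function of the weights for the frame, then \<open>a\<close> takes its values in the frame; otherwise the
  weights of the combined action form a group of rank \<open>r + 1\<close>, and a change of coordinates turns it
  into a frame of rank \<open>r + 1\<close> (\<open>frame_extend_or_contain\<close>). So a frame of maximal rank contains all
  one-parameter subgroups, and with them all subtori, which they generate. Conjugation by an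
  automorphism turns one-parameter subgroups into one-parameter subgroups, whence normality.
\<close>

section \<open>Independence of eigenfunctions\<close>

lemma sum_fun_apply: "(\<Sum>i\<in>I. f i) x = (\<Sum>i\<in>I. f i x)"
  by (induction I rule: infinite_finite_induct) auto

text \<open>The pointwise rules are applied on demand only: as simplification rules they would also
  unfold the algebra operations of functions that occur as arguments.\<close>

lemmas fun_apply = plus_fun_apply times_fun_apply zero_fun_apply sum_fun_apply

declare plus_fun_apply [simp del] times_fun_apply [simp del] zero_fun_apply [simp del]

text \<open>Functions with distinct eigenvalue systems under a family of maps \<open>a g\<close> are linearly independent.
For characters of a group this is Dedekind's lemma, with the same proof: apply one map and subtract
\<open>chi j g\<close> times the relation to eliminate the \<open>j\<close>-th term.\<close>

lemma eigenfunctions_independent: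
  fixes f :: "'i \<Rightarrow> 'y \<Rightarrow> 'k::field" and chi :: "'i \<Rightarrow> 'g \<Rightarrow> 'k"
  assumes "finite F"
    and a: "\<And>g y. g \<in> G \<Longrightarrow> y \<in> Y \<Longrightarrow> a g y \<in> Y"
    and "\<And>i g y. i \<in> F \<Longrightarrow> g \<in> G \<Longrightarrow> y \<in> Y \<Longrightarrow> f i (a g y) = chi i g * f i y"
    and "\<And>i j. i \<in> F \<Longrightarrow> j \<in> F \<Longrightarrow> i \<noteq> j \<Longrightarrow> \<exists>g\<in>G. chi i g \<noteq> chi j g"
    and "\<And>y. y \<in> Y \<Longrightarrow> (\<Sum>i\<in>F. f i y) = 0"
    and "i \<in> F" "y \<in> Y"
  shows "f i y = 0"
  using assms(1,3-)
proof (induction F arbitrary: f i y rule: finite_induct)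
  case empty
  then show ?case by simp
next
  case (insert j F)
  have F0: "f i y = 0" if i: "i \<in> F" and y: "y \<in> Y" for i y
  proof -
    obtain g where g: "g \<in> G" "chi i g \<noteq> chi j g"
      using insert.prems(2)[of i j] i insert.hyps by blast
    define f' where "f' = (\<lambda>i y. (chi i g - chi j g) * f i y)"
    have "f' i y = 0"
    proof (rule insert.IH)
      show "\<And>i h y. i \<in> F \<Longrightarrow> h \<in> G \<Longrightarrow> y \<in> Y \<Longrightarrow> f' i (a h y) = chi i h * f' i y"
        using insert.prems(1) by (simp add: f'_def)
      show "\<And>i j. i \<in> F \<Longrightarrow> j \<in> F \<Longrightarrow> i \<noteq> j \<Longrightarrow> \<exists>g\<in>G. chi i g \<noteq> chi j g"
        using insert.prems(2) by blast
      show "(\<Sum>i\<in>F. f' i y) = 0" if y: "y \<in> Y" for y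
      proof -
        have "(\<Sum>i\<in>F. f' i y) = (\<Sum>i\<in>insert j F. f' i y)"
          using insert.hyps by (simp add: f'_def)
        also have "\<dots> = (\<Sum>i\<in>insert j F. f i (a g y)) - chi j g * (\<Sum>i\<in>insert j F. f i y)"
          unfolding sum_distrib_left sum_subtractf[symmetric] f'_def
          by (rule sum.cong[OF refl]) (use insert.prems(1) g(1) y in \<open>simp add: left_diff_distrib\<close>)
        also have "\<dots> = 0"
          using insert.prems(3)[OF y] insert.prems(3)[OF a[OF g(1) y]] by (metis diff_0_right mult_zero_right)
        finally show ?thesis .
      qed
      show "i \<in> F" "y \<in> Y" by fact+
    qed
    then show ?thesis using g by (simp add: f'_def)
  qed
  show ?case
  proof (cases "i = j")
    case False
    then show ?thesis using F0 insert.prems by blast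
  next
    case True
    have "(\<Sum>i\<in>F. f i y) = 0" using F0 insert.prems(5) by simp
    then show ?thesis using insert.prems(3)[OF insert.prems(5)] insert.hyps True by simp
  qed
qed

text \<open>In characteristic zero the single element \<open>2\<close> distinguishes all integral weights.\<close>

lemma two_powi_inject:
  assumes "(2::'k::field_char_0) powi i = 2 powi j" shows "i = j"
proof -
  have *: "m = 0" if "(2::'k) ^ m = 1" for m :: nat
  proof -
    have "of_nat (2 ^ m) = (of_nat 1 :: 'k)" using that by simp
    then have "(2::nat) ^ m = 1" by (simp only: of_nat_eq_iff)
    then show ?thesis by simp
  qed
  have 1: "(2::'k) powi (i - j) = 1" using assms by (simp add: power_int_diff)
  show ?thesis
  proof (cases "i - j \<ge> 0")
    case True
    then show ?thesis using 1 *[of "nat (i - j)"] by (simp add: power_int_nonneg_exp)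
  next
    case False
    have "(2::'k) powi (j - i) = 1" using 1 power_int_minus[of "2::'k" "i - j"] by simp
    then show ?thesis using *[of "nat (j - i)"] False by (simp add: power_int_nonneg_exp)
  qed
qed

section \<open>Laurent polynomials\<close>

definition laurent :: "(int \<Rightarrow> 'k::field) \<Rightarrow> ('k \<Rightarrow> 'k) \<Rightarrow> bool" where
  "laurent c \<phi> \<longleftrightarrow> finite {i. c i \<noteq> 0} \<and> (\<forall>t. t \<noteq> 0 \<longrightarrow> \<phi> t = (\<Sum>i | c i \<noteq> 0. c i * t powi i))"

text \<open>Outside Laurent polynomials the value of \<open>lcoeff\<close> is arbitrary. The value of a function at \<open>0\<close>
is ignored throughout.\<close>

definition lcoeff :: "('k::field \<Rightarrow> 'k) \<Rightarrow> int \<Rightarrow> 'k" where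
  "lcoeff \<phi> = (SOME c. laurent c \<phi>)"

text \<open>The derivative at \<open>t = 1\<close>.\<close>

definition lderiv :: "('k::field \<Rightarrow> 'k) \<Rightarrow> 'k" where
  "lderiv \<phi> = (\<Sum>i | lcoeff \<phi> i \<noteq> 0. of_int i * lcoeff \<phi> i)"

lemma laurent_sum_independent:
  fixes c :: "int \<Rightarrow> 'k::field_char_0"
  assumes "finite F" "\<And>t. t \<noteq> 0 \<Longrightarrow> (\<Sum>i\<in>F. c i * t powi i) = 0" "i \<in> F"
  shows "c i = 0"
proof -
  have "c i * (1::'k) powi i = 0"
  proof (rule eigenfunctions_independent[where F = F and f = "\<lambda>i t. c i * t powi i" and G = "- {0::'k}"
        and Y = "- {0::'k}" and a = "\<lambda>s t. s * t" and chi = "\<lambda>i t. t powi i"])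
    fix i j :: int assume "i \<noteq> j"
    then have "(2::'k) powi i \<noteq> 2 powi j" using two_powi_inject by blast
    then show "\<exists>g\<in>- {0::'k}. g powi i \<noteq> g powi j" by (intro bexI[of _ 2]) auto
  qed (use assms in \<open>auto simp: power_int_mult_distrib\<close>)
  then show ?thesis by simp
qed

lemma laurent_unique:
  fixes c d :: "int \<Rightarrow> 'k::field_char_0"
  assumes "laurent c \<phi>" "laurent d \<phi>"
  shows "c = d"
proof
  fix i
  define F where "F = insert i ({i. c i \<noteq> 0} \<union> {i. d i \<noteq> 0})"
  have F: "finite F" using assms by (simp add: F_def laurent_def)
  have "c i - d i = 0"
  proof (rule laurent_sum_independent[OF F])
    fix t :: 'k assume t: "t \<noteq> 0"
    have "(\<Sum>i\<in>F. c i * t powi i) = \<phi> t"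
      unfolding assms(1)[unfolded laurent_def, THEN conjunct2, rule_format, OF t]
      by (rule sum.mono_neutral_right[OF F]) (auto simp: F_def)
    moreover have "(\<Sum>i\<in>F. d i * t powi i) = \<phi> t"
      unfolding assms(2)[unfolded laurent_def, THEN conjunct2, rule_format, OF t]
      by (rule sum.mono_neutral_right[OF F]) (auto simp: F_def)
    ultimately show "(\<Sum>i\<in>F. (c i - d i) * t powi i) = 0"
      by (simp add: left_diff_distrib sum_subtractf)
  qed (simp add: F_def)
  then show "c i = d i" by simp
qed

lemma lcoeff_eqI:
  fixes c :: "int \<Rightarrow> 'k::field_char_0"
  assumes "laurent c \<phi>" shows "lcoeff \<phi> = c"
  unfolding lcoeff_def using assms laurent_unique by (metis someI)

lemma fibre_sum_support: "{i. (\<Sum>j | j \<in> J \<and> d j = i. c j) \<noteq> 0} \<subseteq> d ` J"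
proof
  fix i assume "i \<in> {i. (\<Sum>j | j \<in> J \<and> d j = i. c j) \<noteq> 0}"
  then have "{j. j \<in> J \<and> d j = i} \<noteq> {}" by (metis (mono_tags, lifting) mem_Collect_eq sum.empty)
  then show "i \<in> d ` J" by blast
qed

text \<open>Exponents in a family may repeat. This is the form in which Laurent expansions arise: from sums of
weight functions, and from products of such sums.\<close>

lemma laurent_family:
  fixes c :: "'j \<Rightarrow> 'k::field_char_0"
  assumes J: "finite J" and eq: "\<And>t. t \<noteq> 0 \<Longrightarrow> \<phi> t = (\<Sum>j\<in>J. c j * t powi d j)"
  shows "laurent (\<lambda>i. \<Sum>j | j \<in> J \<and> d j = i. c j) \<phi>"
proof -
  let ?c = "\<lambda>i. \<Sum>j | j \<in> J \<and> d j = i. c j"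
  note sub = fibre_sum_support[of c J d]
  show ?thesis
    unfolding laurent_def
  proof (intro conjI allI impI)
    show "finite {i. ?c i \<noteq> 0}" using sub J finite_subset by blast
    fix t :: 'k assume t: "t \<noteq> 0"
    have "(\<Sum>i | ?c i \<noteq> 0. ?c i * t powi i) = (\<Sum>i\<in>d ` J. ?c i * t powi i)"
      by (rule sum.mono_neutral_left) (use J sub in auto)
    also have "\<dots> = (\<Sum>i\<in>d ` J. \<Sum>j | j \<in> J \<and> d j = i. c j * t powi d j)"
      unfolding sum_distrib_right by (intro sum.cong) auto
    also have "\<dots> = (\<Sum>j\<in>J. c j * t powi d j)"
      using sum.image_gen[OF J, of "\<lambda>j. c j * t powi d j" d] by simp
    finally show "\<phi> t = (\<Sum>i | ?c i \<noteq> 0. ?c i * t powi i)" using eq[OF t] by simp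
  qed
qed

lemmas lcoeff_family = laurent_family[THEN lcoeff_eqI]

lemma lderiv_family:
  fixes c :: "'j \<Rightarrow> 'k::field_char_0"
  assumes J: "finite J" and eq: "\<And>t. t \<noteq> 0 \<Longrightarrow> \<phi> t = (\<Sum>j\<in>J. c j * t powi d j)"
  shows "lderiv \<phi> = (\<Sum>j\<in>J. of_int (d j) * c j)"
proof -
  let ?c = "\<lambda>i. \<Sum>j | j \<in> J \<and> d j = i. c j"
  have lc: "lcoeff \<phi> = ?c" by (rule lcoeff_family[OF J eq])
  note sub = fibre_sum_support[of c J d]
  have "lderiv \<phi> = (\<Sum>i\<in>d ` J. of_int i * ?c i)"
    unfolding lderiv_def lc by (rule sum.mono_neutral_left) (use J sub in auto)
  also have "\<dots> = (\<Sum>i\<in>d ` J. \<Sum>j | j \<in> J \<and> d j = i. of_int (d j) * c j)"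
    unfolding sum_distrib_left by (intro sum.cong) auto
  also have "\<dots> = (\<Sum>j\<in>J. of_int (d j) * c j)"
    using sum.image_gen[OF J, of "\<lambda>j. of_int (d j) * c j" d] by simp
  finally show ?thesis .
qed

lemma laurentD:
  assumes "laurent c \<phi>" "finite F" "\<And>i. i \<notin> F \<Longrightarrow> c i = 0" "t \<noteq> 0"
  shows "\<phi> t = (\<Sum>i\<in>F. c i * t powi i)"
proof -
  have "\<phi> t = (\<Sum>i | c i \<noteq> 0. c i * t powi i)" using assms by (simp add: laurent_def)
  also have "\<dots> = (\<Sum>i\<in>F. c i * t powi i)"
    by (rule sum.mono_neutral_left) (use assms in auto)
  finally show ?thesis .
qed

lemma laurentI:
  fixes c :: "int \<Rightarrow> 'k::field_char_0"
  assumes "finite F" "\<And>i. i \<notin> F \<Longrightarrow> c i = 0" "\<And>t. t \<noteq> 0 \<Longrightarrow> \<phi> t = (\<Sum>i\<in>F. c i * t powi i)"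
  shows "laurent c \<phi>"
  unfolding laurent_def
proof (intro conjI allI impI)
  have "{i. c i \<noteq> 0} \<subseteq> F" using assms(2) by blast
  then show "finite {i. c i \<noteq> 0}" using assms(1) finite_subset by blast
  fix t :: 'k assume t: "t \<noteq> 0"
  have "(\<Sum>i | c i \<noteq> 0. c i * t powi i) = (\<Sum>i\<in>F. c i * t powi i)"
    by (rule sum.mono_neutral_left) (use assms in auto)
  then show "\<phi> t = (\<Sum>i | c i \<noteq> 0. c i * t powi i)" using assms(3)[OF t] by simp
qed

lemma laurent_cong: "laurent c \<phi> \<Longrightarrow> (\<And>t. t \<noteq> 0 \<Longrightarrow> \<phi> t = \<psi> t) \<Longrightarrow> laurent c \<psi>"
  by (simp add: laurent_def)

lemma laurent_finite: "laurent c \<phi> \<Longrightarrow> finite {i. c i \<noteq> 0}"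
  by (simp add: laurent_def)

lemma laurent_add:
  fixes c d :: "int \<Rightarrow> 'k::field_char_0"
  assumes "laurent c \<phi>" "laurent d \<psi>"
  shows "laurent (\<lambda>i. c i + d i) (\<lambda>t. \<phi> t + \<psi> t)"
proof -
  let ?F = "{i. c i \<noteq> 0} \<union> {i. d i \<noteq> 0}"
  have F: "finite ?F" using assms by (simp add: laurent_def)
  show ?thesis
    by (rule laurentI[OF F])
      (use laurentD[OF assms(1) F] laurentD[OF assms(2) F] in \<open>auto simp: distrib_right sum.distrib\<close>)
qed

lemma laurent_scale:
  fixes c :: "int \<Rightarrow> 'k::field_char_0"
  assumes "laurent c \<phi>"
  shows "laurent (\<lambda>i. a * c i) (\<lambda>t. a * \<phi> t)"
  using laurentI[OF laurent_finite[OF assms], of "\<lambda>i. a * c i" "\<lambda>t. a * \<phi> t"] assms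
  by (auto simp: laurent_def sum_distrib_left mult.assoc)

lemma lderiv_add:
  fixes c d :: "int \<Rightarrow> 'k::field_char_0"
  assumes "laurent c \<phi>" "laurent d \<psi>"
  shows "lderiv (\<lambda>t. \<phi> t + \<psi> t) = lderiv \<phi> + lderiv \<psi>"
proof -
  let ?F = "{i. c i \<noteq> 0} \<union> {i. d i \<noteq> 0}"
  have F: "finite ?F" using assms by (simp add: laurent_def)
  have 1: "\<And>t. t \<noteq> 0 \<Longrightarrow> \<phi> t = (\<Sum>i\<in>?F. c i * t powi i)" by (rule laurentD[OF assms(1) F]) auto
  have 2: "\<And>t. t \<noteq> 0 \<Longrightarrow> \<psi> t = (\<Sum>i\<in>?F. d i * t powi i)" by (rule laurentD[OF assms(2) F]) auto
  have 3: "\<And>t. t \<noteq> 0 \<Longrightarrow> \<phi> t + \<psi> t = (\<Sum>i\<in>?F. (c i + d i) * t powi i)"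
    using 1 2 by (simp add: distrib_right sum.distrib)
  show ?thesis
    using lderiv_family[where c = c and d = "\<lambda>i. i", OF F 1] lderiv_family[where c = d and d = "\<lambda>i. i", OF F 2]
      lderiv_family[where c = "\<lambda>i. c i + d i" and d = "\<lambda>i. i", OF F 3]
    by (simp add: distrib_left sum.distrib)
qed

lemma lderiv_mult:
  fixes c d :: "int \<Rightarrow> 'k::field_char_0"
  assumes "laurent c \<phi>" "laurent d \<psi>"
  shows "lderiv (\<lambda>t. \<phi> t * \<psi> t) = lderiv \<phi> * \<psi> 1 + \<phi> 1 * lderiv \<psi>"
proof -
  let ?C = "{i. c i \<noteq> 0}" and ?D = "{i. d i \<noteq> 0}"
  have C: "finite ?C" and D: "finite ?D" using assms by (simp_all add: laurent_def)
  have 1: "\<And>t. t \<noteq> 0 \<Longrightarrow> \<phi> t = (\<Sum>i\<in>?C. c i * t powi i)" by (rule laurentD[OF assms(1) C]) auto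
  have 2: "\<And>t. t \<noteq> 0 \<Longrightarrow> \<psi> t = (\<Sum>i\<in>?D. d i * t powi i)" by (rule laurentD[OF assms(2) D]) auto
  have "\<phi> t * \<psi> t = (\<Sum>p\<in>?C \<times> ?D. c (fst p) * d (snd p) * t powi (fst p + snd p))" if "t \<noteq> 0" for t
    unfolding 1[OF that] 2[OF that] sum_product sum.cartesian_product
    by (rule sum.cong[OF refl]) (auto simp: power_int_add that)
  then have "lderiv (\<lambda>t. \<phi> t * \<psi> t) = (\<Sum>p\<in>?C \<times> ?D. of_int (fst p + snd p) * (c (fst p) * d (snd p)))"
    by (intro lderiv_family) (use C D in auto)
  also have "\<dots> = (\<Sum>i\<in>?C. of_int i * c i) * (\<Sum>i\<in>?D. d i) + (\<Sum>i\<in>?C. c i) * (\<Sum>i\<in>?D. of_int i * d i)"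
    unfolding sum_product sum.cartesian_product sum.distrib[symmetric]
    by (rule sum.cong[OF refl]) (auto simp: algebra_simps)
  finally show ?thesis
    using 1[of 1] 2[of 1] lderiv_family[where c = c and d = "\<lambda>i. i", OF C 1]
      lderiv_family[where c = d and d = "\<lambda>i. i", OF D 2]
    by simp
qed

section \<open>Polynomial functions\<close>

text \<open>Substitution into a polynomial, for a class \<open>C\<close> of functions on any domain that is closed under the
ring operations. It serves for regular functions and for functions that are Laurent polynomial in a
parameter.\<close>

lemma polynomial_funs_subst:
  assumes "p \<in> polynomial_funs N"
    and "\<And>c. (\<lambda>_. c) \<in> C"
    and "\<And>u v. u \<in> C \<Longrightarrow> v \<in> C \<Longrightarrow> (\<lambda>z. u z + v z) \<in> C"
    and "\<And>u v. u \<in> C \<Longrightarrow> v \<in> C \<Longrightarrow> (\<lambda>z. u z * v z) \<in> C"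
    and "\<And>i. i < N \<Longrightarrow> (\<lambda>z. g z $ i) \<in> C"
  shows "(\<lambda>z. p (g z)) \<in> C"
  using assms(1) by induction (use assms(2-) in auto)

lemma regular_fun_const: "regular_fun n X (\<lambda>_. c)"
  unfolding regular_fun_def by (rule bexI[OF _ polynomial_funs.const[of c]]) simp

lemma regular_fun_coord: "i < n \<Longrightarrow> regular_fun n X (\<lambda>x. x $ i)"
  unfolding regular_fun_def by (rule bexI[OF _ polynomial_funs.coord]) auto

lemma regular_fun_add:
  "regular_fun n X f \<Longrightarrow> regular_fun n X g \<Longrightarrow> regular_fun n X (\<lambda>x. f x + g x)"
proof -
  assume "regular_fun n X f" "regular_fun n X g"
  then obtain p q where "p \<in> polynomial_funs n" "q \<in> polynomial_funs n" "\<forall>x\<in>X. f x = p x" "\<forall>x\<in>X. g x = q x"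
    unfolding regular_fun_def by blast
  then show ?thesis
    unfolding regular_fun_def by (intro bexI[of _ "\<lambda>x. p x + q x"] polynomial_funs.add) auto
qed

lemma regular_fun_mult:
  "regular_fun n X f \<Longrightarrow> regular_fun n X g \<Longrightarrow> regular_fun n X (\<lambda>x. f x * g x)"
proof -
  assume "regular_fun n X f" "regular_fun n X g"
  then obtain p q where "p \<in> polynomial_funs n" "q \<in> polynomial_funs n" "\<forall>x\<in>X. f x = p x" "\<forall>x\<in>X. g x = q x"
    unfolding regular_fun_def by blast
  then show ?thesis
    unfolding regular_fun_def by (intro bexI[of _ "\<lambda>x. p x * q x"] polynomial_funs.mult) auto
qed

lemma regular_fun_cong:
  "regular_fun n X f \<Longrightarrow> (\<And>x. x \<in> X \<Longrightarrow> f x = g x) \<Longrightarrow> regular_fun n X g"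
  unfolding regular_fun_def by metis

lemma regular_fun_power: "regular_fun n X f \<Longrightarrow> regular_fun n X (\<lambda>x. f x ^ k)"
  by (induction k) (auto intro: regular_fun_const regular_fun_mult)

lemma regular_fun_sum:
  "(\<And>i. i \<in> I \<Longrightarrow> regular_fun n X (f i)) \<Longrightarrow> regular_fun n X (\<lambda>x. \<Sum>i\<in>I. f i x)"
  by (induction I rule: infinite_finite_induct) (auto intro: regular_fun_const regular_fun_add)

lemma regular_fun_prod:
  "(\<And>i. i \<in> I \<Longrightarrow> regular_fun n X (f i)) \<Longrightarrow> regular_fun n X (\<lambda>x. \<Prod>i\<in>I. f i x)"
  by (induction I rule: infinite_finite_induct) (auto intro: regular_fun_const regular_fun_mult)

lemma regular_fun_comp:
  assumes "regular_fun m Y f" "\<And>x. x \<in> X \<Longrightarrow> g x \<in> Y" "\<And>i. i < m \<Longrightarrow> regular_fun n X (\<lambda>x. g x $ i)"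
  shows "regular_fun n X (\<lambda>x. f (g x))"
proof -
  obtain p where p: "p \<in> polynomial_funs m" "\<And>y. y \<in> Y \<Longrightarrow> f y = p y"
    using assms(1) by (auto simp: regular_fun_def)
  have "(\<lambda>x. p (g x)) \<in> Collect (regular_fun n X)"
    by (rule polynomial_funs_subst[OF p(1)])
      (use assms(3) in \<open>auto intro: regular_fun_const regular_fun_add regular_fun_mult\<close>)
  then show ?thesis by (auto intro: regular_fun_cong simp: p(2) assms(2))
qed

lemma vec_first_last_append_vec:
  assumes "v \<in> carrier_vec m" "x \<in> carrier_vec n"
  shows "vec_first (v @\<^sub>v x) m = v" "vec_last (v @\<^sub>v x) n = x"
  using assms by (auto simp: vec_first_def vec_last_def)

section \<open>The coordinate algebra\<close>

locale affine_variety =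
  fixes n :: nat and X :: "'k::{alg_closed_field, field_char_0} vec set"
  assumes irreducible: "irreducible_affine_variety n X"
begin

text \<open>A regular function is represented by its extension by zero outside \<open>X\<close>, so that equality of
functions is equality on \<open>X\<close>. The unit of the algebra \<open>A\<close> is then \<open>cut (\<lambda>_. 1)\<close>, not the constant
function \<open>1\<close>.\<close>

definition cut :: "('k vec \<Rightarrow> 'k) \<Rightarrow> 'k vec \<Rightarrow> 'k" where
  "cut f = (\<lambda>x. if x \<in> X then f x else 0)"

definition A :: "('k vec \<Rightarrow> 'k) set" where
  "A = {f. regular_fun n X f \<and> (\<forall>x. x \<notin> X \<longrightarrow> f x = 0)}"

definition crd :: "nat \<Rightarrow> 'k vec \<Rightarrow> 'k" where "crd i = cut (\<lambda>x. x $ i)"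

lemma X_carrier: "x \<in> X \<Longrightarrow> x \<in> carrier_vec n"
  using irreducible by (auto simp: irreducible_affine_variety_def zariski_closed_def)

lemma X_closed: "zariski_closed n X" and X_nonempty: "X \<noteq> {}"
  using irreducible by (auto simp: irreducible_affine_variety_def)

lemma cut_apply [simp]: "x \<in> X \<Longrightarrow> cut f x = f x" "x \<notin> X \<Longrightarrow> cut f x = 0"
  by (auto simp: cut_def)

lemma A_outside: "f \<in> A \<Longrightarrow> x \<notin> X \<Longrightarrow> f x = 0"
  and A_regular: "f \<in> A \<Longrightarrow> regular_fun n X f"
  by (auto simp: A_def)

lemma A_eqI:
  assumes "f \<in> A" "g \<in> A" "\<And>x. x \<in> X \<Longrightarrow> f x = g x" shows "f = g"
  using assms by (metis A_outside ext)

lemma cut_A: "regular_fun n X f \<Longrightarrow> cut f \<in> A"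
  unfolding A_def by (auto intro: regular_fun_cong)

lemma crd_A: "i < n \<Longrightarrow> crd i \<in> A"
  unfolding crd_def by (intro cut_A regular_fun_coord)

lemma crd_apply [simp]: "x \<in> X \<Longrightarrow> crd i x = x $ i"
  by (simp add: crd_def)

lemma A_zero [simp]: "0 \<in> A"
  by (auto simp: A_def zero_fun_def regular_fun_const)

lemma A_const: "cut (\<lambda>_. c) \<in> A"
  by (intro cut_A regular_fun_const)

lemma A_add: "f \<in> A \<Longrightarrow> g \<in> A \<Longrightarrow> f + g \<in> A"
  by (auto simp: A_def plus_fun_def regular_fun_add)

lemma A_mult: "f \<in> A \<Longrightarrow> g \<in> A \<Longrightarrow> f * g \<in> A"
  by (auto simp: A_def times_fun_def regular_fun_mult)

lemma A_scale: "f \<in> A \<Longrightarrow> (\<lambda>x. c * f x) \<in> A"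
  by (auto simp: A_def intro!: regular_fun_mult regular_fun_const)

lemma A_sum: "(\<And>i. i \<in> I \<Longrightarrow> f i \<in> A) \<Longrightarrow> (\<Sum>i\<in>I. f i) \<in> A"
  by (induction I rule: infinite_finite_induct) (auto intro: A_add)

lemma A_induct [consumes 1, case_names const coord add mult]:
  assumes "f \<in> A"
    and "\<And>c. P (cut (\<lambda>_. c))" "\<And>i. i < n \<Longrightarrow> P (crd i)"
    and "\<And>f g. f \<in> A \<Longrightarrow> g \<in> A \<Longrightarrow> P f \<Longrightarrow> P g \<Longrightarrow> P (f + g)"
    and "\<And>f g. f \<in> A \<Longrightarrow> g \<in> A \<Longrightarrow> P f \<Longrightarrow> P g \<Longrightarrow> P (f * g)"
  shows "P f"
proof -
  obtain p where p: "p \<in> polynomial_funs n" "\<And>x. x \<in> X \<Longrightarrow> f x = p x"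
    using assms(1) by (auto simp: A_def regular_fun_def)
  have f: "f = cut p" using p(2) A_outside[OF assms(1)] by (auto simp: cut_def)
  have "cut p \<in> A \<and> P (cut p)"
    using p(1)
  proof induction
    case (const c) then show ?case using assms(2) A_const by blast
  next
    case (coord i) then show ?case using assms(3) crd_A by (simp add: crd_def)
  next
    case (add p q)
    have "cut (\<lambda>x. p x + q x) = cut p + cut q" by (auto simp: cut_def fun_apply)
    then show ?case using add A_add assms(4) by metis
  next
    case (mult p q)
    have "cut (\<lambda>x. p x * q x) = cut p * cut q" by (auto simp: cut_def fun_apply)
    then show ?case using mult A_mult assms(5) by metis
  qed
  then show ?thesis by (simp add: f)
qed

lemma A_separates:
  assumes "y \<in> X" "z \<in> X" "\<And>f. f \<in> A \<Longrightarrow> f y = f z" shows "y = z"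
proof (rule eq_vecI)
  have "dim_vec y = n" "dim_vec z = n" using X_carrier assms by auto
  then show "dim_vec y = dim_vec z"
    "\<And>i. i < dim_vec z \<Longrightarrow> y $ i = z $ i" using assms(3)[OF crd_A] assms(1,2) by auto
qed

lemma zariski_closed_zeros:
  assumes "f \<in> A" shows "zariski_closed n {x \<in> X. f x = 0}"
proof -
  obtain P where P: "P \<subseteq> polynomial_funs n" "X = {x \<in> carrier_vec n. \<forall>p\<in>P. p x = 0}"
    using X_closed by (auto simp: zariski_closed_def)
  obtain p where p: "p \<in> polynomial_funs n" "\<And>x. x \<in> X \<Longrightarrow> f x = p x"
    using assms by (auto simp: A_def regular_fun_def)
  have "{x \<in> X. f x = 0} = {x \<in> carrier_vec n. \<forall>q\<in>insert p P. q x = 0}"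
    using p(2) P(2) by auto
  moreover have "insert p P \<subseteq> polynomial_funs n" using P p by auto
  ultimately show ?thesis unfolding zariski_closed_def by blast
qed

text \<open>If \<open>f * g = 0\<close>, then \<open>X\<close> is the union of the zero sets of \<open>f\<close> and \<open>g\<close>, and irreducibility applies.\<close>

lemma A_domain:
  assumes "f \<in> A" "g \<in> A" "f * g = 0" shows "f = 0 \<or> g = 0"
proof -
  have "f x * g x = 0" for x using fun_cong[OF assms(3), of x] by (simp add: fun_apply)
  then have "X = {x \<in> X. f x = 0} \<union> {x \<in> X. g x = 0}" by auto
  then have "X = {x \<in> X. f x = 0} \<or> X = {x \<in> X. g x = 0}"
    using irreducible zariski_closed_zeros[OF assms(1)] zariski_closed_zeros[OF assms(2)]
    unfolding irreducible_affine_variety_def by blast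
  then show ?thesis
  proof
    assume "X = {x \<in> X. f x = 0}"
    then have "f = 0" by (intro A_eqI assms A_zero) (auto simp: fun_apply)
    then show ?thesis ..
  next
    assume "X = {x \<in> X. g x = 0}"
    then have "g = 0" by (intro A_eqI assms A_zero) (auto simp: fun_apply)
    then show ?thesis ..
  qed
qed

lemma product_variety_parts:
  assumes "v \<in> product_variety Y X" "Y \<subseteq> carrier_vec m"
  shows "vec_first v m \<in> Y \<and> vec_last v n \<in> X"
proof -
  obtain y x where "v = y @\<^sub>v x" "y \<in> Y" "x \<in> X" using assms(1) by (auto simp: product_variety_def)
  then show ?thesis using assms(2) X_carrier vec_first_last_append_vec[of y m x n] by auto
qed

lemma regular_fun_vec_last:
  assumes "g \<in> A" and Y: "Y \<subseteq> carrier_vec m"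
  shows "regular_fun (m + n) (product_variety Y X) (\<lambda>v. g (vec_last v n))"
proof (rule regular_fun_comp[OF A_regular[OF assms(1)]])
  fix v assume "v \<in> product_variety Y X"
  then show "vec_last v n \<in> X" using product_variety_parts[OF _ Y] by blast
next
  fix i assume i: "i < n"
  have "v $ (m + i) = vec_last v n $ i" if "v \<in> product_variety Y X" for v
  proof -
    have "dim_vec v = m + n" using that Y X_carrier by (auto simp: product_variety_def)
    then show ?thesis using i by (simp add: vec_last_def)
  qed
  then show "regular_fun (m + n) (product_variety Y X) (\<lambda>v. vec_last v n $ i)"
    by (intro regular_fun_cong[OF regular_fun_coord[of "m + i"]]) (use i in auto)
qed

end

section \<open>Rigidity kills locally nilpotent derivations\<close>

lemma poly_eqI_pderiv:
  fixes p q :: "'k::field_char_0 poly"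
  assumes "pderiv p = pderiv q" "coeff p 0 = coeff q 0"
  shows "p = q"
proof (rule poly_eqI)
  fix k
  show "coeff p k = coeff q k"
  proof (cases k)
    case (Suc m)
    have "coeff (pderiv p) m = coeff (pderiv q) m" using assms by simp
    then have "of_nat (Suc m) * coeff p (Suc m) = of_nat (Suc m) * coeff q (Suc m)"
      by (simp only: coeff_pderiv)
    then show ?thesis unfolding Suc by (simp only: mult_cancel_left of_nat_eq_0_iff) simp
  qed (use assms in simp)
qed

context affine_variety
begin

definition derivation :: "(('k vec \<Rightarrow> 'k) \<Rightarrow> ('k vec \<Rightarrow> 'k)) \<Rightarrow> bool" where
  "derivation D \<longleftrightarrow> (\<forall>f\<in>A. D f \<in> A) \<and> (\<forall>f\<in>A. \<forall>g\<in>A. D (f + g) = D f + D g) \<and>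
     (\<forall>f\<in>A. \<forall>g\<in>A. D (f * g) = D f * g + f * D g) \<and> (\<forall>c. D (cut (\<lambda>_. c)) = 0)"

lemma
  assumes "derivation D"
  shows derivation_A: "f \<in> A \<Longrightarrow> D f \<in> A"
    and derivation_add: "f \<in> A \<Longrightarrow> g \<in> A \<Longrightarrow> D (f + g) = D f + D g"
    and derivation_mult: "f \<in> A \<Longrightarrow> g \<in> A \<Longrightarrow> D (f * g) = D f * g + f * D g"
    and derivation_const: "D (cut (\<lambda>_. c)) = 0"
  using assms by (auto simp: derivation_def)

lemma cut_zero: "cut (\<lambda>_. 0) = 0"
  by (auto simp: cut_def fun_apply)

lemma derivation_zero: "derivation D \<Longrightarrow> D 0 = 0"
  using derivation_const[of D 0] by (simp add: cut_zero)

lemma derivation_scale: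
  assumes D: "derivation D" and f: "f \<in> A" shows "D (\<lambda>x. c * f x) = (\<lambda>x. c * D f x)"
proof -
  have *: "(\<lambda>x. c * g x) = cut (\<lambda>_. c) * g" if "g \<in> A" for g
    by (rule ext) (use A_outside[OF that] in \<open>auto simp: cut_def fun_apply\<close>)
  show ?thesis
    using derivation_mult[OF D A_const f, of c] derivation_const[OF D, of c] *[OF f] *[OF derivation_A[OF D f]]
    by simp
qed

lemma derivation_sum:
  assumes D: "derivation D" and f: "\<And>i. i \<in> I \<Longrightarrow> f i \<in> A"
  shows "D (\<Sum>i\<in>I. f i) = (\<Sum>i\<in>I. D (f i))"
  using f by (induction I rule: infinite_finite_induct)
    (auto simp: derivation_zero[OF D] derivation_add[OF D] A_sum)

lemma funpow_derivation_A: "derivation D \<Longrightarrow> f \<in> A \<Longrightarrow> (D ^^ k) f \<in> A"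
  by (induction k) (auto intro: derivation_A)

lemma funpow_derivation_sum:
  assumes D: "derivation D" and f: "\<And>i. i \<in> I \<Longrightarrow> f i \<in> A"
  shows "(D ^^ k) (\<Sum>i\<in>I. f i) = (\<Sum>i\<in>I. (D ^^ k) (f i))"
  by (induction k) (auto simp: derivation_sum[OF D] funpow_derivation_A[OF D f])

lemma funpow_derivation_zero: "derivation D \<Longrightarrow> (D ^^ k) 0 = 0"
  by (induction k) (auto simp: derivation_zero)

lemma derivation_eq_0I:
  assumes D: "derivation D" and "\<And>i. i < n \<Longrightarrow> D (crd i) = 0" and f: "f \<in> A"
  shows "D f = 0"
  using f by (induction rule: A_induct)
    (auto simp: derivation_const[OF D] assms(2) derivation_add[OF D] derivation_mult[OF D])

definition locally_nilpotent :: "(('k vec \<Rightarrow> 'k) \<Rightarrow> ('k vec \<Rightarrow> 'k)) \<Rightarrow> bool" where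
  "locally_nilpotent D \<longleftrightarrow> derivation D \<and> (\<forall>f\<in>A. \<exists>k. (D ^^ k) f = 0)"

text \<open>The polynomial \<open>exp (t D) f (x)\<close> in \<open>t\<close>, for locally nilpotent \<open>D\<close>.\<close>

definition taylor :: "(('k vec \<Rightarrow> 'k) \<Rightarrow> ('k vec \<Rightarrow> 'k)) \<Rightarrow> ('k vec \<Rightarrow> 'k) \<Rightarrow> 'k vec \<Rightarrow> 'k poly" where
  "taylor D f x = Abs_poly (\<lambda>k. (D ^^ k) f x / fact k)"

text \<open>The integral curve of \<open>D\<close> through \<open>x\<close>, coordinate by coordinate.\<close>

definition flow :: "(('k vec \<Rightarrow> 'k) \<Rightarrow> ('k vec \<Rightarrow> 'k)) \<Rightarrow> 'k \<Rightarrow> 'k vec \<Rightarrow> 'k vec" where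
  "flow D t x = vec n (\<lambda>i. poly (taylor D (crd i) x) t)"

end

locale locally_nilpotent_derivation = affine_variety +
  fixes D
  assumes lnd: "locally_nilpotent D"
begin

lemma D: "derivation D" and nilpotent: "f \<in> A \<Longrightarrow> \<exists>k. (D ^^ k) f = 0"
  using lnd by (auto simp: locally_nilpotent_def)

lemma funpow_zero_mono:
  assumes "(D ^^ k) f = 0" "k \<le> l" shows "(D ^^ l) f = 0"
proof -
  have "(D ^^ l) f = (D ^^ (l - k)) ((D ^^ k) f)"
    using assms(2) by (metis comp_apply funpow_add le_add_diff_inverse2)
  then show ?thesis using assms(1) funpow_derivation_zero[OF D] by simp
qed

lemma coeff_taylor: "f \<in> A \<Longrightarrow> coeff (taylor D f x) k = (D ^^ k) f x / fact k"
proof -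
  assume f: "f \<in> A"
  obtain N where "(D ^^ N) f = 0" using nilpotent[OF f] by blast
  then have "(D ^^ i) f x / fact i = 0" if "i > N" for i
    using funpow_zero_mono[of N f i] that by (simp add: fun_apply)
  then show ?thesis unfolding taylor_def by (subst coeff_Abs_poly[of N]) auto
qed

lemma pderiv_taylor:
  assumes f: "f \<in> A" shows "pderiv (taylor D f x) = taylor D (D f) x"
proof (rule poly_eqI)
  fix k
  have "(D ^^ Suc k) f = (D ^^ k) (D f)" by (simp add: funpow_swap1)
  then show "coeff (pderiv (taylor D f x)) k = coeff (taylor D (D f) x) k"
    unfolding coeff_pderiv coeff_taylor[OF f] coeff_taylor[OF derivation_A[OF D f]]
    by (simp add: field_simps del: funpow.simps of_nat_Suc)
qed

lemma coeff_taylor_0: "f \<in> A \<Longrightarrow> coeff (taylor D f x) 0 = f x"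
  by (simp add: coeff_taylor)

lemma taylor_add:
  assumes "f \<in> A" "g \<in> A" shows "taylor D (f + g) x = taylor D f x + taylor D g x"
proof (rule poly_eqI)
  fix k
  have "(D ^^ k) (f + g) = (D ^^ k) f + (D ^^ k) g"
    by (induction k) (auto simp: derivation_add[OF D] funpow_derivation_A[OF D] assms)
  then show "coeff (taylor D (f + g) x) k = coeff (taylor D f x + taylor D g x) k"
    using assms by (simp add: coeff_taylor A_add add_divide_distrib fun_apply)
qed

lemma taylor_zero: "taylor D 0 x = 0"
  by (rule poly_eqI) (simp add: coeff_taylor funpow_derivation_zero[OF D] fun_apply)

lemma taylor_const:
  assumes "x \<in> X" shows "taylor D (cut (\<lambda>_. c)) x = [:c:]"
proof (rule poly_eqI_pderiv)
  show "pderiv (taylor D (cut (\<lambda>_. c)) x) = pderiv [:c:]"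
    by (simp add: pderiv_taylor A_const derivation_const[OF D] taylor_zero pderiv_pCons)
qed (use assms in \<open>simp add: coeff_taylor_0 A_const\<close>)

text \<open>Both sides have the same value at \<open>t = 0\<close>, and by the Leibniz rule their derivatives agree if the
claim holds for \<open>(D f, g)\<close> and \<open>(f, D g)\<close>. As \<open>D\<close> is locally nilpotent, induction on the sum of
the nilpotency orders replaces the binomial formula for \<open>D\<^sup>k (f g)\<close>.\<close>

lemma taylor_mult:
  assumes "f \<in> A" "g \<in> A" shows "taylor D (f * g) x = taylor D f x * taylor D g x"
proof -
  have "taylor D (f * g) x = taylor D f x * taylor D g x"
    if "f \<in> A" "g \<in> A" "(D ^^ a) f = 0" "(D ^^ b) g = 0" "a + b = N" for a b N f g
    using that
  proof (induction N arbitrary: a b f g)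
    case 0
    then show ?case by (simp add: taylor_zero)
  next
    case (Suc N)
    note f = Suc.prems(1) and g = Suc.prems(2)
    note Df = derivation_A[OF D f] and Dg = derivation_A[OF D g]
    have l: "taylor D (D f * g) x = taylor D (D f) x * taylor D g x"
    proof (cases a)
      case 0
      then show ?thesis using Suc.prems derivation_zero[OF D] by (simp add: taylor_zero)
    next
      case (Suc a')
      then show ?thesis
        using Suc.IH[of "D f" g a' b] Suc.prems Df by (simp add: funpow_swap1)
    qed
    have r: "taylor D (f * D g) x = taylor D f x * taylor D (D g) x"
    proof (cases b)
      case 0
      then show ?thesis using Suc.prems derivation_zero[OF D] by (simp add: taylor_zero)
    next
      case (Suc b')
      then show ?thesis
        using Suc.IH[of f "D g" a b'] Suc.prems Dg by (simp add: funpow_swap1)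
    qed
    show ?case
    proof (rule poly_eqI_pderiv)
      show "pderiv (taylor D (f * g) x) = pderiv (taylor D f x * taylor D g x)"
        unfolding pderiv_taylor[OF A_mult[OF f g]] derivation_mult[OF D f g]
          taylor_add[OF A_mult[OF Df g] A_mult[OF f Dg]] pderiv_mult pderiv_taylor[OF f] pderiv_taylor[OF g]
        unfolding l r by (simp only: mult.commute add.commute)
      show "coeff (taylor D (f * g) x) 0 = coeff (taylor D f x * taylor D g x) 0"
        by (simp add: coeff_taylor_0 A_mult f g coeff_mult fun_apply)
    qed
  qed
  then show ?thesis using assms nilpotent by blast
qed

text \<open>Since \<open>exp (t D)\<close> is a ring homomorphism, moving the point along the flow is the same as moving the
function. For the equations of \<open>X\<close> this says that the flow stays in \<open>X\<close>.\<close>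

lemma polynomial_flow:
  assumes "p \<in> polynomial_funs n" and x: "x \<in> X"
  shows "cut p \<in> A \<and> p (flow D t x) = poly (taylor D (cut p) x) t"
  using assms(1)
proof induction
  case (const c)
  then show ?case using x by (simp add: A_const taylor_const)
next
  case (coord i)
  then show ?case using crd_A[of i] by (simp add: flow_def crd_def)
next
  case (add p q)
  have "cut (\<lambda>x. p x + q x) = cut p + cut q" by (auto simp: cut_def fun_apply)
  then show ?case using add by (simp add: A_add taylor_add)
next
  case (mult p q)
  have "cut (\<lambda>x. p x * q x) = cut p * cut q" by (auto simp: cut_def fun_apply)
  then show ?case using mult by (simp add: A_mult taylor_mult)
qed

lemma flow_X: assumes x: "x \<in> X" shows "flow D t x \<in> X"
proof -
  obtain P where P: "P \<subseteq> polynomial_funs n" "X = {x \<in> carrier_vec n. \<forall>p\<in>P. p x = 0}"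
    using X_closed by (auto simp: zariski_closed_def)
  have "p (flow D t x) = 0" if p: "p \<in> P" for p
  proof -
    have "p x = 0" if "x \<in> X" for x using that p P(2) by blast
    then have "cut p = 0" by (auto simp: cut_def fun_apply)
    then show ?thesis using polynomial_flow[OF _ x, of p t] p P(1) by (auto simp: taylor_zero)
  qed
  moreover have "flow D t x \<in> carrier_vec n" by (simp add: flow_def)
  ultimately show ?thesis using P(2) by blast
qed

lemma A_flow:
  assumes f: "f \<in> A" and x: "x \<in> X" shows "f (flow D t x) = poly (taylor D f x) t"
proof -
  obtain p where p: "p \<in> polynomial_funs n" "\<And>x. x \<in> X \<Longrightarrow> f x = p x"
    using f by (auto simp: A_def regular_fun_def)
  have "f = cut p" using p(2) A_outside[OF f] by (auto simp: cut_def fun_apply)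
  then show ?thesis using polynomial_flow[OF p(1) x] p(2)[OF flow_X[OF x]] by simp
qed

text \<open>The group law of the flow, in the form \<open>exp (s D) f\<close> at \<open>exp (t D) x\<close> equals
\<open>exp ((s + t) D) f\<close> at \<open>x\<close>; again by differentiating in \<open>s\<close> and induction on the nilpotency order.\<close>

lemma taylor_flow:
  assumes f: "f \<in> A" and x: "x \<in> X"
  shows "taylor D f (flow D t x) = pcompose (taylor D f x) [:t, 1:]"
proof -
  have "taylor D f (flow D t x) = pcompose (taylor D f x) [:t, 1:]"
    if "f \<in> A" "(D ^^ a) f = 0" for a f
    using that
  proof (induction a arbitrary: f)
    case 0
    then show ?case by (simp add: taylor_zero)
  next
    case (Suc a)
    note f = Suc.prems(1)
    have IH: "taylor D (D f) (flow D t x) = pcompose (taylor D (D f) x) [:t, 1:]"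
      using Suc derivation_A[OF D f] by (simp add: funpow_swap1)
    show ?case
    proof (rule poly_eqI_pderiv)
      show "pderiv (taylor D f (flow D t x)) = pderiv (pcompose (taylor D f x) [:t, 1:])"
        by (simp add: pderiv_taylor f IH pderiv_pcompose pderiv_pCons)
      have "coeff (pcompose (taylor D f x) [:t, 1:]) 0 = poly (taylor D f x) t"
        by (simp add: poly_0_coeff_0[symmetric] poly_pcompose)
      then show "coeff (taylor D f (flow D t x)) 0 = coeff (pcompose (taylor D f x) [:t, 1:]) 0"
        using A_flow[OF f x] by (simp add: coeff_taylor_0 f)
    qed
  qed
  then show ?thesis using f nilpotent by blast
qed

lemma flow_add: assumes x: "x \<in> X" shows "flow D s (flow D t x) = flow D (s + t) x"
  by (rule eq_vecI)
    (auto simp: flow_def[of D s] flow_def[of D "s + t"] taylor_flow[OF crd_A x] poly_pcompose add.commute)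

lemma flow_0: assumes x: "x \<in> X" shows "flow D 0 x = x"
  using X_carrier[OF x]
  by (intro eq_vecI) (auto simp: flow_def poly_0_coeff_0 coeff_taylor_0 crd_A x)

lemma flow_Bij: "restrict (flow D t) X \<in> Bij X"
  unfolding Bij_def
proof (intro IntI CollectI)
  show "bij_betw (restrict (flow D t) X) X X"
    by (rule bij_betw_byWitness[where f' = "flow D (- t)"]) (auto simp: flow_X flow_add flow_0)
qed simp

lemma flow_action: "regular_action 1 additive_group n X (\<lambda>v. restrict (flow D (v $ 0)) X)"
  unfolding regular_action_def
proof
  let ?phi = "\<lambda>v::'a vec. restrict (flow D (v $ 0)) X"
  have G: "group (additive_group :: 'a vec monoid)"
    using comm_group_vec[of 1] comm_group_def by blast
  have "?phi \<in> hom additive_group (BijGroup X)"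
  proof (rule homI)
    fix v :: "'a vec" assume "v \<in> carrier additive_group"
    show "?phi v \<in> carrier (BijGroup X)" by (simp add: BijGroup_def flow_Bij)
  next
    fix v w :: "'a vec" assume vw: "v \<in> carrier additive_group" "w \<in> carrier additive_group"
    have "?phi (v + w) = compose X (?phi v) (?phi w)"
      using vw by (auto simp: compose_def flow_X flow_add monoid_vec_simps)
    then show "?phi (v \<otimes>\<^bsub>additive_group\<^esub> w) = ?phi v \<otimes>\<^bsub>BijGroup X\<^esub> ?phi w"
      by (simp add: BijGroup_def flow_Bij monoid_vec_simps)
  qed
  then show "group_action additive_group X ?phi"
    by (intro group_action.intro group_hom.intro group_hom_axioms.intro G group_BijGroup)
  let ?Y = "product_variety (carrier additive_group) X"
  have Y: "vec_last v n \<in> X" if "v \<in> ?Y" for v :: "'a vec"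
    using that X_carrier by (auto simp: product_variety_def monoid_vec_simps vec_first_last_append_vec)
  have first: "vec_first v 1 $ 0 = v $ 0" for v :: "'a vec"
    by (simp add: vec_first_def)
  have reg: "regular_fun (1 + n) ?Y (\<lambda>v. poly (taylor D f (vec_last v n)) (v $ 0))" if f: "f \<in> A" for f
  proof -
    obtain N where N: "(D ^^ N) f = 0" using nilpotent[OF f] by blast
    have "poly (taylor D f y) t = (\<Sum>k<N. (D ^^ k) f y / fact k * t ^ k)" for y t
    proof -
      have "degree (taylor D f y) \<le> N"
        by (rule degree_le) (auto simp: coeff_taylor f funpow_zero_mono[OF N] fun_apply)
      then have "poly (taylor D f y) t = (\<Sum>k\<le>N. coeff (taylor D f y) k * t ^ k)"
        unfolding poly_altdef by (intro sum.mono_neutral_left) (auto simp: coeff_eq_0)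
      also have "\<dots> = (\<Sum>k<N. coeff (taylor D f y) k * t ^ k)"
        by (intro sum.mono_neutral_right) (auto simp: coeff_taylor f funpow_zero_mono[OF N] fun_apply)
      finally show ?thesis by (simp add: coeff_taylor f)
    qed
    moreover have "regular_fun (1 + n) ?Y (\<lambda>v. \<Sum>k<N. (inverse (fact k) * (D ^^ k) f (vec_last v n)) * (v $ 0) ^ k)"
      by (intro regular_fun_sum regular_fun_mult regular_fun_power regular_fun_const regular_fun_vec_last
          funpow_derivation_A[OF D] f regular_fun_coord) (auto simp: monoid_vec_simps)
    ultimately show ?thesis by (simp add: divide_inverse mult.commute)
  qed
  have "regular_fun (1 + n) ?Y (\<lambda>v. ?phi (vec_first v 1) (vec_last v n) $ i)" if i: "i < n" for i
    by (rule regular_fun_cong[OF reg[OF crd_A[OF i]]]) (use Y i first in \<open>simp add: flow_def\<close>)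
  then show "morphism (1 + n) ?Y n X (\<lambda>v. ?phi (vec_first v 1) (vec_last v n))"
    unfolding morphism_def using Y flow_X by auto
qed

text \<open>The flow is a regular action of the additive group, so rigidity makes all Taylor polynomials of
coordinates constant; their linear coefficients are the values of \<open>D\<close> on the coordinates.\<close>

lemma rigid_imp_zero:
  assumes rigid: "rigid n X" and f: "f \<in> A" shows "D f = 0"
proof (rule derivation_eq_0I[OF D _ f])
  fix i assume i: "i < n"
  show "D (crd i) = 0"
  proof (rule A_eqI[OF derivation_A[OF D crd_A[OF i]] A_zero])
    fix x assume x: "x \<in> X"
    have "poly (taylor D (crd i) x) t = poly [:x $ i:] t" for t
    proof -
      have "restrict (flow D (vec 1 (\<lambda>_. t) $ 0)) X x = x"
        using rigid[unfolded rigid_def, rule_format, OF flow_action _ x, of "vec 1 (\<lambda>_. t)"]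
        by (simp only: monoid_vec_simps vec_carrier)
      then have "flow D t x $ i = x $ i" using x by simp
      then show ?thesis using i by (simp add: flow_def)
    qed
    then have "taylor D (crd i) x = [:x $ i:]" by (metis poly_eq_poly_eq_iff ext)
    then have "coeff (taylor D (crd i) x) 1 = 0" by simp
    then show "D (crd i) x = 0 x" by (simp add: coeff_taylor crd_A[OF i] fun_apply)
  qed
qed

end

section \<open>One-parameter families and their weight spaces\<close>

lemma laurent_sum:
  fixes c :: "'i \<Rightarrow> int \<Rightarrow> 'k::field_char_0"
  assumes "\<And>i. i \<in> I \<Longrightarrow> laurent (c i) (\<phi> i)" "finite I"
  shows "laurent (\<lambda>j. \<Sum>i\<in>I. c i j) (\<lambda>t. \<Sum>i\<in>I. \<phi> i t)"
  using assms(2,1) by (induction I rule: finite_induct) (auto simp: laurent_add laurent_def[of "\<lambda>_. 0"])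

context affine_variety
begin

text \<open>The weight space of weight \<open>i\<close>. Here and below a family \<open>a t\<close> matters for \<open>t \<noteq> 0\<close> and on \<open>X\<close> only.\<close>

definition wt :: "('k \<Rightarrow> 'k vec \<Rightarrow> 'k vec) \<Rightarrow> int \<Rightarrow> ('k vec \<Rightarrow> 'k) set" where
  "wt a i = {f \<in> A. \<forall>t x. t \<noteq> 0 \<longrightarrow> x \<in> X \<longrightarrow> f (a t x) = t powi i * f x}"

text \<open>A one-parameter subgroup, characterised by the decomposition of \<open>A\<close> into weight spaces. The group
law and regularity follow from it, because points of \<open>X\<close> are separated by weight functions.\<close>

definition onepar :: "('k \<Rightarrow> 'k vec \<Rightarrow> 'k vec) \<Rightarrow> bool" where
  "onepar a \<longleftrightarrow> (\<forall>t x. t \<noteq> 0 \<longrightarrow> x \<in> X \<longrightarrow> a t x \<in> X) \<and>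
     (\<forall>f\<in>A. \<exists>F c. finite F \<and> (\<forall>i. c i \<in> wt a i) \<and> f = (\<Sum>i\<in>F. c i))"

text \<open>The projection of \<open>A\<close> to the weight space of weight \<open>i\<close>.\<close>

definition component :: "('k \<Rightarrow> 'k vec \<Rightarrow> 'k vec) \<Rightarrow> ('k vec \<Rightarrow> 'k) \<Rightarrow> int \<Rightarrow> 'k vec \<Rightarrow> 'k" where
  "component a f i = cut (\<lambda>x. lcoeff (\<lambda>t. f (a t x)) i)"

text \<open>The infinitesimal generator, which multiplies each weight space by its weight.\<close>

definition generator :: "('k \<Rightarrow> 'k vec \<Rightarrow> 'k vec) \<Rightarrow> ('k vec \<Rightarrow> 'k) \<Rightarrow> 'k vec \<Rightarrow> 'k" where
  "generator a f = cut (\<lambda>x. lderiv (\<lambda>t. f (a t x)))"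

definition pull :: "('k vec \<Rightarrow> 'k vec) \<Rightarrow> ('k vec \<Rightarrow> 'k) \<Rightarrow> 'k vec \<Rightarrow> 'k" where
  "pull a f = cut (\<lambda>x. f (a x))"

lemma wt_A: "f \<in> wt a i \<Longrightarrow> f \<in> A"
  and wt_apply: "f \<in> wt a i \<Longrightarrow> t \<noteq> 0 \<Longrightarrow> x \<in> X \<Longrightarrow> f (a t x) = t powi i * f x"
  by (auto simp: wt_def)

lemma wtI:
  "f \<in> A \<Longrightarrow> (\<And>t x. t \<noteq> 0 \<Longrightarrow> x \<in> X \<Longrightarrow> f (a t x) = t powi i * f x) \<Longrightarrow> f \<in> wt a i"
  by (auto simp: wt_def)

lemma wt_zero [simp]: "0 \<in> wt a i"
  by (rule wtI) (auto simp: fun_apply)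

lemma wt_add: "f \<in> wt a i \<Longrightarrow> g \<in> wt a i \<Longrightarrow> f + g \<in> wt a i"
  by (rule wtI) (auto simp: fun_apply wt_apply wt_A A_add distrib_left)

lemma wt_sum: "(\<And>j. j \<in> J \<Longrightarrow> f j \<in> wt a i) \<Longrightarrow> (\<Sum>j\<in>J. f j) \<in> wt a i"
  by (induction J rule: infinite_finite_induct) (auto intro: wt_add)

lemma wt_scale: "f \<in> wt a i \<Longrightarrow> (\<lambda>x. c * f x) \<in> wt a i"
  by (rule wtI) (auto simp: wt_apply wt_A A_scale)

lemma onepar_X: "onepar a \<Longrightarrow> t \<noteq> 0 \<Longrightarrow> x \<in> X \<Longrightarrow> a t x \<in> X"
  by (auto simp: onepar_def)

lemma family_A:
  assumes "\<And>j. j \<in> J \<Longrightarrow> c j \<in> wt a (d j)"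
  shows "(\<Sum>j\<in>J. c j) \<in> A"
  by (intro A_sum) (use assms wt_A in blast)

lemma family_apply:
  assumes "\<And>j. j \<in> J \<Longrightarrow> c j \<in> wt a (d j)" "t \<noteq> 0" "x \<in> X"
  shows "(\<Sum>j\<in>J. c j) (a t x) = (\<Sum>j\<in>J. c j x * t powi d j)"
  unfolding fun_apply by (rule sum.cong) (auto simp: wt_apply[OF assms(1) assms(2,3)])

lemma component_family:
  assumes J: "finite J" and c: "\<And>j. j \<in> J \<Longrightarrow> c j \<in> wt a (d j)"
  shows "component a (\<Sum>j\<in>J. c j) i = (\<Sum>j | j \<in> J \<and> d j = i. c j)"
proof (rule A_eqI)
  have "component a (\<Sum>j\<in>J. c j) i x = (\<Sum>j | j \<in> J \<and> d j = i. c j) x" for x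
  proof (cases "x \<in> X")
    case True
    then show ?thesis
      unfolding component_def
      using lcoeff_family[OF J family_apply[where a = a and c = c, OF c _ True]]
      by (simp add: fun_apply)
  next
    case False
    then have "c j x = 0" if "j \<in> J" for j using A_outside[OF wt_A[OF c[OF that]]] by blast
    then show ?thesis using False by (simp add: component_def fun_apply)
  qed
  then have "component a (\<Sum>j\<in>J. c j) i = (\<Sum>j | j \<in> J \<and> d j = i. c j)" by blast
  moreover show "(\<Sum>j | j \<in> J \<and> d j = i. c j) \<in> A" by (rule family_A) (use c in auto)
  ultimately show "component a (\<Sum>j\<in>J. c j) i \<in> A"
    "\<And>x. component a (\<Sum>j\<in>J. c j) i x = (\<Sum>j | j \<in> J \<and> d j = i. c j) x" by auto
qed

lemma generator_family:
  assumes J: "finite J" and c: "\<And>j. j \<in> J \<Longrightarrow> c j \<in> wt a (d j)"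
  shows "generator a (\<Sum>j\<in>J. c j) = (\<Sum>j\<in>J. (\<lambda>x. of_int (d j) * c j x))"
proof
  fix x
  show "generator a (\<Sum>j\<in>J. c j) x = (\<Sum>j\<in>J. (\<lambda>x. of_int (d j) * c j x)) x"
  proof (cases "x \<in> X")
    case True
    then show ?thesis
      unfolding generator_def
      using lderiv_family[OF J family_apply[where a = a and c = c, OF c _ True]]
      by (simp add: fun_apply)
  next
    case False
    then have "c j x = 0" if "j \<in> J" for j using A_outside[OF wt_A[OF c[OF that]]] by blast
    then show ?thesis using False by (simp add: generator_def fun_apply)
  qed
qed

lemma generator_wt:
  assumes "f \<in> wt a i" shows "generator a f = (\<lambda>x. of_int i * f x)"
  using generator_family[of "{()}" "\<lambda>_. f" a "\<lambda>_. i"] assms by simp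

lemma component_wt:
  assumes "f \<in> wt a i" shows "component a f j = (if j = i then f else 0)"
proof -
  have "{u. u \<in> {()} \<and> i = j} = (if j = i then {()} else {})" by auto
  then show ?thesis using component_family[of "{()}" "\<lambda>_. f" a "\<lambda>_. i" j] assms by auto
qed

lemma pull_add: "pull b (f + g) = pull b f + pull b g"
  and pull_mult: "pull b (f * g) = pull b f * pull b g"
  by (auto simp: pull_def cut_def fun_apply)

context
  fixes a assumes a: "onepar a"
begin

lemma onepar_decompose:
  assumes "f \<in> A" obtains F c where "finite F" "\<And>i. c i \<in> wt a i" "f = (\<Sum>i\<in>F. c i)"
  using a assms unfolding onepar_def by blast

lemma component_in_wt: assumes "f \<in> A" shows "component a f i \<in> wt a i"
proof -
  obtain F c where F: "finite F" "\<And>i. c i \<in> wt a i" "f = (\<Sum>i\<in>F. c i)"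
    using onepar_decompose[OF assms] by blast
  have "component a f i = (\<Sum>j | j \<in> F \<and> j = i. c j)"
    unfolding F(3) by (rule component_family[where d = "\<lambda>i. i"]) (use F in auto)
  then show ?thesis using wt_sum[of "{j. j \<in> F \<and> j = i}" c a i] F(2) by auto
qed

lemma component_A: "f \<in> A \<Longrightarrow> component a f i \<in> A"
  using component_in_wt wt_A by blast

lemma assumes "f \<in> A" shows finite_component: "finite {i. component a f i \<noteq> 0}"
  and sum_component: "f = (\<Sum>i | component a f i \<noteq> 0. component a f i)"
proof -
  obtain F c where F: "finite F" "\<And>i. c i \<in> wt a i" "f = (\<Sum>i\<in>F. c i)"
    using onepar_decompose[OF assms] by blast
  have eq: "component a f i = (if i \<in> F then c i else 0)" for i
  proof -
    have "component a f i = (\<Sum>j | j \<in> F \<and> j = i. c j)"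
      unfolding F(3) by (rule component_family[where d = "\<lambda>i. i"]) (use F in auto)
    moreover have "{j. j \<in> F \<and> j = i} = (if i \<in> F then {i} else {})" by auto
    ultimately show ?thesis by simp
  qed
  have sub: "{i. component a f i \<noteq> 0} \<subseteq> F" using eq by auto
  then show "finite {i. component a f i \<noteq> 0}" using F(1) finite_subset by blast
  have "(\<Sum>i\<in>F. c i) = (\<Sum>i\<in>F. component a f i)" by (rule sum.cong) (simp_all add: eq)
  note trans[OF F(3) this]
  also have "\<dots> = (\<Sum>i | component a f i \<noteq> 0. component a f i)"
    by (rule sum.mono_neutral_right) (use F sub in auto)
  finally show "f = (\<Sum>i | component a f i \<noteq> 0. component a f i)" .
qed

lemma laurent_orbit:
  assumes f: "f \<in> A" and x: "x \<in> X"
  shows "laurent (\<lambda>i. component a f i x) (\<lambda>t. f (a t x))"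
proof (rule laurentI[OF finite_component[OF f]])
  fix t :: 'k assume t: "t \<noteq> 0"
  show "f (a t x) = (\<Sum>i | component a f i \<noteq> 0. component a f i x * t powi i)"
    by (subst sum_component[OF f]) (rule family_apply[OF component_in_wt[OF f] t x])
qed (simp add: fun_apply)

lemma component_add:
  assumes "f \<in> A" "g \<in> A" shows "component a (f + g) i = component a f i + component a g i"
proof (rule A_eqI)
  fix x assume x: "x \<in> X"
  have "laurent (\<lambda>i. component a f i x + component a g i x) (\<lambda>t. (f + g) (a t x))"
    using laurent_add[OF laurent_orbit[OF assms(1) x] laurent_orbit[OF assms(2) x]] by (simp add: fun_apply)
  from fun_cong[OF laurent_unique[OF laurent_orbit[OF A_add[OF assms] x] this], of i]
  show "component a (f + g) i x = (component a f i + component a g i) x" by (simp add: fun_apply)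
qed (intro component_A A_add assms)+

lemma component_zero: "component a 0 i = 0"
  using component_wt[OF wt_zero] by simp

lemma component_sum:
  assumes "\<And>j. j \<in> J \<Longrightarrow> f j \<in> A" shows "component a (\<Sum>j\<in>J. f j) i = (\<Sum>j\<in>J. component a (f j) i)"
  using assms by (induction J rule: infinite_finite_induct) (simp_all add: component_zero component_add A_sum)

lemma component_scale:
  assumes f: "f \<in> A" shows "component a (\<lambda>x. c * f x) i = (\<lambda>x. c * component a f i x)"
proof (rule A_eqI)
  fix x assume x: "x \<in> X"
  show "component a (\<lambda>x. c * f x) i x = c * component a f i x"
    using fun_cong[OF laurent_unique[OF laurent_orbit[OF A_scale[OF f, of c] x]
        laurent_scale[OF laurent_orbit[OF f x], of c]], of i] .
qed (intro component_A A_scale f)+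

lemma generator_derivation: "derivation (generator a)"
  unfolding derivation_def
proof (intro conjI ballI allI)
  show "generator a f \<in> A" if f: "f \<in> A" for f
  proof -
    have "generator a f = (\<Sum>i | component a f i \<noteq> 0. (\<lambda>x. of_int i * component a f i x))"
      by (subst (1) sum_component[OF f], rule generator_family[OF finite_component[OF f] component_in_wt[OF f]])
    then show ?thesis using A_sum[OF A_scale[OF component_A[OF f]]] by simp
  qed
  note gA = this
  fix f g assume f: "f \<in> A" and g: "g \<in> A"
  show "generator a (f + g) = generator a f + generator a g"
    by (rule A_eqI[OF gA[OF A_add[OF f g]] A_add[OF gA[OF f] gA[OF g]]])
      (simp add: generator_def fun_apply lderiv_add[OF laurent_orbit[OF f] laurent_orbit[OF g]])
  have 1: "h (a 1 x) = h x" if "h \<in> A" "x \<in> X" for h x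
    using laurentD[OF laurent_orbit[OF that] finite_component[OF that(1)], of 1]
      fun_cong[OF sum_component[OF that(1)], of x] by (simp add: fun_apply)
  show "generator a (f * g) = generator a f * g + f * generator a g"
    by (rule A_eqI[OF gA[OF A_mult[OF f g]] A_add[OF A_mult[OF gA[OF f] g] A_mult[OF f gA[OF g]]]])
      (simp add: generator_def fun_apply lderiv_mult[OF laurent_orbit[OF f] laurent_orbit[OF g]] 1 f g)
next
  fix c
  have "cut (\<lambda>_. c) \<in> wt a 0" by (rule wtI[OF A_const]) (simp add: onepar_X[OF a])
  then show "generator a (cut (\<lambda>_. c)) = 0" by (simp add: generator_wt zero_fun_def)
qed

text \<open>The eigenspaces of the generator are the weight spaces: distinct integers stay distinct in
characteristic zero.\<close>

lemma wt_generatorD: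
  assumes f: "f \<in> A" and eq: "generator a f = (\<lambda>x. of_int i * f x)" shows "f \<in> wt a i"
proof -
  have "component a f j = 0" if j: "j \<noteq> i" for j
  proof -
    have "generator a f = (\<Sum>i | component a f i \<noteq> 0. (\<lambda>x. of_int i * component a f i x))"
      by (subst (1) sum_component[OF f], rule generator_family[OF finite_component[OF f] component_in_wt[OF f]])
    then have "component a (generator a f) j
        = (\<Sum>k | k \<in> {i. component a f i \<noteq> 0} \<and> k = j. (\<lambda>x. of_int k * component a f k x))"
      using component_family[OF finite_component[OF f] wt_scale[OF component_in_wt[OF f]], where i = j] by simp
    also have "\<dots> = (\<lambda>x. of_int j * component a f j x)"
    proof -
      have "{k. k \<in> {i. component a f i \<noteq> 0} \<and> k = j} = (if component a f j = 0 then {} else {j})" by auto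
      then show ?thesis by (auto simp: zero_fun_def)
    qed
    finally have "(\<lambda>x. of_int i * component a f j x) = (\<lambda>x. of_int j * component a f j x)"
      using component_scale[OF f] eq by simp
    then have "of_int i * component a f j x = of_int j * component a f j x" for x by (rule fun_cong)
    then have "component a f j x = 0" for x using j by simp
    then show ?thesis by (auto simp: zero_fun_def)
  qed
  then have "f = (\<Sum>j | component a f j \<noteq> 0 . if j = i then component a f i else 0)"
    by (subst sum_component[OF f]) (rule sum.cong, auto)
  moreover have "\<dots> \<in> wt a i" by (rule wt_sum) (use component_in_wt[OF f] in auto)
  ultimately show ?thesis by simp
qed

lemma pull_family:
  assumes c: "\<And>j. j \<in> J \<Longrightarrow> c j \<in> wt a (d j)" and s: "s \<noteq> 0"
  shows "pull (a s) (\<Sum>j\<in>J. c j) = (\<Sum>j\<in>J. (\<lambda>x. s powi d j * c j x))"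
proof
  fix x show "pull (a s) (\<Sum>j\<in>J. c j) x = (\<Sum>j\<in>J. (\<lambda>x. s powi d j * c j x)) x"
  proof (cases "x \<in> X")
    case True
    then show ?thesis
      using family_apply[where c = c and d = d and a = a, OF c s True] by (simp add: pull_def fun_apply mult.commute)
  next
    case False
    then have "c j x = 0" if "j \<in> J" for j using A_outside[OF wt_A[OF c[OF that]]] by blast
    then show ?thesis using False by (simp add: pull_def fun_apply)
  qed
qed

lemma pull_A: assumes f: "f \<in> A" and s: "s \<noteq> 0" shows "pull (a s) f \<in> A"
  by (subst sum_component[OF f], subst pull_family[OF component_in_wt[OF f] s])
    (intro A_sum A_scale component_A f)

lemma pull_inverse:
  assumes f: "f \<in> A" and s: "s \<noteq> 0" shows "pull (a s) (pull (a (inverse s)) f) = f"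
proof -
  have "pull (a s) (pull (a (inverse s)) f)
      = pull (a s) (\<Sum>j | component a f j \<noteq> 0. (\<lambda>x. inverse s powi j * component a f j x))"
    by (subst (1) sum_component[OF f], subst pull_family[OF component_in_wt[OF f]]) (use s in auto)
  also have "\<dots> = (\<Sum>j | component a f j \<noteq> 0. (\<lambda>x. s powi j * (inverse s powi j * component a f j x)))"
    by (rule pull_family[OF wt_scale[OF component_in_wt[OF f]] s])
  also have "\<dots> = (\<Sum>j | component a f j \<noteq> 0. component a f j)"
    by (rule sum.cong[OF refl]) (use s in \<open>simp add: power_int_inverse mult.assoc[symmetric]\<close>)
  finally show ?thesis using sum_component[OF f] by simp
qed

end

section \<open>One-parameter families on a rigid variety commute\<close>

context
  fixes a u assumes a: "onepar a" and u: "onepar u"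
begin

text \<open>The generator \<open>D\<close> of \<open>u\<close> conjugated by \<open>a s\<close>. Expanding it in powers of \<open>s\<close> yields the homogeneous
components of \<open>D\<close> for the grading by \<open>a\<close>, and the conjugate being a derivation for every \<open>s\<close>, so
is each coefficient.\<close>

definition conj_gen :: "'k \<Rightarrow> ('k vec \<Rightarrow> 'k) \<Rightarrow> 'k vec \<Rightarrow> 'k" where
  "conj_gen s f = pull (a s) (generator u (pull (a (inverse s)) f))"

definition derivation_component :: "int \<Rightarrow> ('k vec \<Rightarrow> 'k) \<Rightarrow> 'k vec \<Rightarrow> 'k" where
  "derivation_component j f = cut (\<lambda>x. lcoeff (\<lambda>s. conj_gen s f x) j)"

lemmas gen_u = generator_derivation[OF u]

lemma conj_gen_derivation: assumes s: "s \<noteq> 0" shows "derivation (conj_gen s)"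
  unfolding derivation_def
proof (intro conjI ballI allI)
  have s': "inverse s \<noteq> 0" using s by simp
  note pA = pull_A[OF a _ s] pull_A[OF a _ s']
  show "conj_gen s f \<in> A" if "f \<in> A" for f
    unfolding conj_gen_def by (intro pA derivation_A[OF gen_u] that)
  fix f g assume f: "f \<in> A" and g: "g \<in> A"
  show "conj_gen s (f + g) = conj_gen s f + conj_gen s g"
    unfolding conj_gen_def pull_add by (simp add: derivation_add[OF gen_u pA(2)[OF f] pA(2)[OF g]] pull_add)
  show "conj_gen s (f * g) = conj_gen s f * g + f * conj_gen s g"
    unfolding conj_gen_def pull_mult derivation_mult[OF gen_u pA(2)[OF f] pA(2)[OF g]] pull_add
    by (simp add: pull_mult pull_inverse[OF a _ s] f g)
next
  fix c
  have "pull (a t) (cut (\<lambda>_. c)) = cut (\<lambda>_. c)" if "t \<noteq> 0" for t c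
    by (auto simp: pull_def cut_def onepar_X[OF a that])
  from this[of "inverse s" c] this[of s 0] show "conj_gen s (cut (\<lambda>_. c)) = 0"
    unfolding conj_gen_def using s derivation_const[OF gen_u, of c] by (simp add: cut_zero)
qed

lemma conj_gen_wt:
  assumes f: "f \<in> wt a i" and s: "s \<noteq> 0" and x: "x \<in> X"
  shows "conj_gen s f x = (\<Sum>k | component a (generator u f) k \<noteq> 0. component a (generator u f) k x * s powi (k - i))"
proof -
  let ?c = "component a (generator u f)"
  have Df: "generator u f \<in> A" by (rule derivation_A[OF gen_u wt_A[OF f]])
  have "pull (a (inverse s)) f = (\<lambda>x. inverse s powi i * f x)"
    using pull_family[OF a, of "{()}" "\<lambda>_. f" "\<lambda>_. i" "inverse s"] f s by simp
  then have "generator u (pull (a (inverse s)) f) = (\<lambda>x. inverse s powi i * generator u f x)"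
    using derivation_scale[OF gen_u wt_A[OF f]] by simp
  then have "conj_gen s f x = inverse s powi i * generator u f (a s x)"
    unfolding conj_gen_def using x by (simp add: pull_def)
  also have "generator u f (a s x) = (\<Sum>k | ?c k \<noteq> 0. ?c k x * s powi k)"
    by (rule laurentD[OF laurent_orbit[OF a Df x] finite_component[OF a Df] _ s]) (simp add: fun_apply)
  finally show ?thesis
    using s by (simp add: sum_distrib_left power_int_diff power_int_inverse divide_inverse mult_ac)
qed

lemma laurent_conj_gen_wt:
  assumes f: "f \<in> wt a i" and x: "x \<in> X"
  shows "laurent (\<lambda>j. component a (generator u f) (i + j) x) (\<lambda>s. conj_gen s f x)"
proof -
  let ?c = "component a (generator u f)"
  have fin: "finite {k. ?c k \<noteq> 0}" by (rule finite_component[OF a derivation_A[OF gen_u wt_A[OF f]]])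
  have "(\<Sum>k | k \<in> {k. ?c k \<noteq> 0} \<and> k - i = j. ?c k x) = ?c (i + j) x" for j
  proof -
    have "{k. k \<in> {k. ?c k \<noteq> 0} \<and> k - i = j} = (if ?c (i + j) = 0 then {} else {i + j})" by auto
    then show ?thesis by (simp add: fun_apply)
  qed
  then show ?thesis
    using laurent_family[OF fin conj_gen_wt[OF f _ x]] by simp
qed

lemma derivation_component_wt:
  assumes f: "f \<in> wt a i" shows "derivation_component j f = component a (generator u f) (i + j)"
proof
  fix x show "derivation_component j f x = component a (generator u f) (i + j) x"
    by (cases "x \<in> X") (simp_all add: derivation_component_def lcoeff_eqI[OF laurent_conj_gen_wt[OF f]] component_def)
qed

lemma conj_gen_decompose:
  assumes f: "f \<in> A" and s: "s \<noteq> 0"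
  shows "conj_gen s f = (\<Sum>i | component a f i \<noteq> 0. conj_gen s (component a f i))"
  by (subst sum_component[OF a f], rule derivation_sum[OF conj_gen_derivation[OF s] component_A[OF a f]])

lemma laurent_conj_gen_sum:
  assumes f: "f \<in> A" and x: "x \<in> X"
  shows "laurent (\<lambda>j. \<Sum>i | component a f i \<noteq> 0. derivation_component j (component a f i) x) (\<lambda>s. conj_gen s f x)"
proof (rule laurent_cong)
  show "laurent (\<lambda>j. \<Sum>i | component a f i \<noteq> 0. derivation_component j (component a f i) x)
      (\<lambda>s. \<Sum>i | component a f i \<noteq> 0. conj_gen s (component a f i) x)"
    by (rule laurent_sum[OF _ finite_component[OF a f]])
      (simp add: derivation_component_wt[OF component_in_wt[OF a f]] laurent_conj_gen_wt[OF component_in_wt[OF a f] x])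
  show "(\<Sum>i | component a f i \<noteq> 0. conj_gen s (component a f i) x) = conj_gen s f x" if "s \<noteq> 0" for s
    unfolding conj_gen_decompose[OF f that] by (simp add: fun_apply)
qed

lemma derivation_component_decompose:
  assumes f: "f \<in> A"
  shows "derivation_component j f = (\<Sum>i | component a f i \<noteq> 0. derivation_component j (component a f i))"
proof
  fix x
  show "derivation_component j f x = (\<Sum>i | component a f i \<noteq> 0. derivation_component j (component a f i)) x"
    by (cases "x \<in> X") (simp_all add: fun_apply derivation_component_def[of j f] derivation_component_def[of j "component a f _"]
        lcoeff_eqI[OF laurent_conj_gen_sum[OF f], unfolded derivation_component_def])
qed

lemma laurent_conj_gen:
  assumes f: "f \<in> A" and x: "x \<in> X"
  shows "laurent (\<lambda>j. derivation_component j f x) (\<lambda>s. conj_gen s f x)"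
  using laurent_conj_gen_sum[OF assms] unfolding derivation_component_decompose[OF f] fun_apply .

lemma derivation_component_A: assumes f: "f \<in> A" shows "derivation_component j f \<in> A"
  unfolding derivation_component_decompose[OF f] derivation_component_wt[OF component_in_wt[OF a f]]
  by (intro A_sum component_A[OF a] derivation_A[OF gen_u] f)

lemma derivation_component_derivation: "derivation (derivation_component j)"
  unfolding derivation_def
proof (intro conjI ballI allI)
  fix f g assume f: "f \<in> A" and g: "g \<in> A"
  note L = laurent_conj_gen
  show "derivation_component j (f + g) = derivation_component j f + derivation_component j g"
  proof (rule A_eqI)
    fix x assume x: "x \<in> X"
    have "laurent (\<lambda>j. derivation_component j f x + derivation_component j g x) (\<lambda>s. conj_gen s (f + g) x)"
      by (rule laurent_cong[OF laurent_add[OF L[OF f x] L[OF g x]]])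
        (simp add: derivation_add[OF conj_gen_derivation f g] fun_apply)
    from fun_cong[OF laurent_unique[OF L[OF A_add[OF f g] x] this], of j]
    show "derivation_component j (f + g) x = (derivation_component j f + derivation_component j g) x" by (simp add: fun_apply)
  qed (intro A_add derivation_component_A f g)+
  show "derivation_component j (f * g) = derivation_component j f * g + f * derivation_component j g"
  proof (rule A_eqI)
    fix x assume x: "x \<in> X"
    have "laurent (\<lambda>j. g x * derivation_component j f x + f x * derivation_component j g x) (\<lambda>s. conj_gen s (f * g) x)"
      by (rule laurent_cong[OF laurent_add[OF laurent_scale[OF L[OF f x]] laurent_scale[OF L[OF g x]]]])
        (simp add: derivation_mult[OF conj_gen_derivation f g] fun_apply mult.commute)
    from fun_cong[OF laurent_unique[OF L[OF A_mult[OF f g] x] this], of j]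
    show "derivation_component j (f * g) x = (derivation_component j f * g + f * derivation_component j g) x" by (simp add: fun_apply)
  qed (intro A_add A_mult derivation_component_A f g)+
next
  fix c
  show "derivation_component j (cut (\<lambda>_. c)) = 0"
  proof (rule A_eqI)
    fix x assume x: "x \<in> X"
    have "laurent (\<lambda>_. 0) (\<lambda>s. conj_gen s (cut (\<lambda>_. c)) x)"
      by (simp add: laurent_def derivation_const[OF conj_gen_derivation] fun_apply)
    from fun_cong[OF laurent_unique[OF laurent_conj_gen[OF A_const x] this], of j]
    show "derivation_component j (cut (\<lambda>_. c)) x = 0 x" by (simp add: fun_apply)
  qed (intro derivation_component_A A_const A_zero)+
qed (rule derivation_component_A)

text \<open>The degrees in which \<open>D\<close> has a nonzero component. A derivation is determined by its values on the
coordinates, whence finiteness.\<close>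

definition degrees :: "int set" where
  "degrees = {j. \<exists>f\<in>A. derivation_component j f \<noteq> 0}"

lemma finite_derivation_component: assumes f: "f \<in> A" shows "finite {j. derivation_component j f \<noteq> 0}"
proof (rule finite_subset)
  let ?F = "{i. component a f i \<noteq> 0}"
  let ?G = "\<lambda>i. {k. component a (generator u (component a f i)) k \<noteq> 0}"
  show "finite (\<Union>i\<in>?F. (\<lambda>k. k - i) ` ?G i)"
    by (intro finite_UN_I finite_imageI finite_component[OF a] derivation_A[OF gen_u] component_A[OF a] f)
  show "{j. derivation_component j f \<noteq> 0} \<subseteq> (\<Union>i\<in>?F. (\<lambda>k. k - i) ` ?G i)"
  proof
    fix j assume "j \<in> {j. derivation_component j f \<noteq> 0}"
    then have "(\<Sum>i\<in>?F. component a (generator u (component a f i)) (i + j)) \<noteq> 0"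
      unfolding derivation_component_decompose[OF f] derivation_component_wt[OF component_in_wt[OF a f]] by simp
    then obtain i where "i \<in> ?F" "component a (generator u (component a f i)) (i + j) \<noteq> 0"
      by (rule sum.not_neutral_contains_not_neutral)
    then show "j \<in> (\<Union>i\<in>?F. (\<lambda>k. k - i) ` ?G i)"
      by (intro UN_I[of i] image_eqI[of _ _ "i + j"]) auto
  qed
qed

lemma finite_degrees: "finite degrees"
proof (rule finite_subset)
  show "finite (\<Union>i<n. {j. derivation_component j (crd i) \<noteq> 0})"
    by (intro finite_UN_I finite_derivation_component crd_A) auto
  show "degrees \<subseteq> (\<Union>i<n. {j. derivation_component j (crd i) \<noteq> 0})"
    unfolding degrees_def using derivation_eq_0I[OF derivation_component_derivation] by fastforce
qed

lemma generator_eq_sum: assumes f: "f \<in> A" shows "generator u f = (\<Sum>j\<in>degrees. derivation_component j f)"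
proof (rule A_eqI)
  fix x assume x: "x \<in> X"
  have 1: "pull (a 1) g = g" if "g \<in> A" for g
    by (subst (1 2) sum_component[OF a that], subst pull_family[OF a component_in_wt[OF a that]]) auto
  have "conj_gen 1 f x = (\<Sum>j\<in>degrees. derivation_component j f x * 1 powi j)"
    by (rule laurentD[OF laurent_conj_gen[OF f x] finite_degrees])
      (use f in \<open>auto simp: degrees_def fun_apply\<close>)
  then show "generator u f x = (\<Sum>j\<in>degrees. derivation_component j f) x"
    by (simp add: conj_gen_def 1 f derivation_A[OF gen_u] fun_apply)
qed (intro derivation_A[OF gen_u] A_sum derivation_component_A f)+

lemma component_derivation_component:
  assumes f: "f \<in> A" shows "component a (derivation_component j f) k = derivation_component j (component a f (k - j))"
proof -
  let ?F = "{i. component a f i \<noteq> 0}"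
  have c: "derivation_component j (component a f i) \<in> wt a (i + j)" for i
    unfolding derivation_component_wt[OF component_in_wt[OF a f]]
    by (rule component_in_wt[OF a derivation_A[OF gen_u component_A[OF a f]]])
  have "component a (derivation_component j f) k = (\<Sum>i | i \<in> ?F \<and> i + j = k. derivation_component j (component a f i))"
    unfolding derivation_component_decompose[OF f]
    by (rule component_family[OF finite_component[OF a f] c])
  also have "{i. i \<in> ?F \<and> i + j = k} = (if component a f (k - j) = 0 then {} else {k - j})" by auto
  finally show ?thesis by (simp add: derivation_zero[OF derivation_component_derivation])
qed

text \<open>The key step. Let \<open>f\<close> have \<open>a\<close>-weight \<open>i\<close>. Then \<open>D\<^sup>k f\<close> has no components above degree \<open>i + k m\<close>, and in
that degree its component is \<open>E\<^sup>k f\<close>, for the top component \<open>E\<close> of \<open>D\<close>. On the other hand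
\<open>D\<^sup>k f\<close> is a combination of the \<open>u\<close>-components of \<open>f\<close>, whose degrees are bounded by some \<open>B\<close>
independent of \<open>k\<close>. So \<open>E\<^sup>k f = 0\<close> as soon as \<open>i + k m > B\<close>.\<close>

lemma top_component_locally_nilpotent:
  assumes m: "0 < m" and max: "\<And>j. j \<in> degrees \<Longrightarrow> j \<le> m"
  shows "locally_nilpotent (derivation_component m)"
  unfolding locally_nilpotent_def
proof (intro conjI ballI derivation_component_derivation)
  let ?D = "generator u" and ?E = "derivation_component m"
  have homogeneous: "\<exists>k. (?E ^^ k) f = 0" if f: "f \<in> wt a i" for f i
  proof -
    have fA: "f \<in> A" by (rule wt_A[OF f])
    have DA: "(?D ^^ k) f \<in> A" for k by (rule funpow_derivation_A[OF gen_u fA])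
    have step: "(\<forall>j > i + int k * m. component a ((?D ^^ k) f) j = 0) \<and>
        (?E ^^ k) f = component a ((?D ^^ k) f) (i + int k * m)" for k
    proof (induction k)
      case 0
      then show ?case using component_wt[OF f] by simp
    next
      case (Suc k)
      let ?g = "(?D ^^ k) f" and ?t = "i + int k * m"
      have top: "i + int (Suc k) * m = ?t + m" by (simp add: algebra_simps)
      have comp: "component a ((?D ^^ Suc k) f) j = (\<Sum>l\<in>degrees. derivation_component l (component a ?g (j - l)))" for j
        by (simp add: generator_eq_sum[OF DA] component_sum[OF a] derivation_component_A DA component_derivation_component)
      have zero: "derivation_component l (component a ?g (j - l)) = 0" if "j - l > ?t" for j l
        using Suc.IH that derivation_zero[OF derivation_component_derivation] by simp
      have "component a ((?D ^^ Suc k) f) j = 0" if j: "j > ?t + m" for j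
        unfolding comp by (intro sum.neutral ballI zero) (use max j in force)
      moreover have "component a ((?D ^^ Suc k) f) (?t + m) = ?E (component a ?g ?t)"
      proof -
        have "(\<Sum>l\<in>degrees. derivation_component l (component a ?g (?t + m - l)))
            = (\<Sum>l\<in>degrees. if l = m then ?E (component a ?g ?t) else 0)"
          by (rule sum.cong[OF refl]) (use max zero in force)
        also have "\<dots> = ?E (component a ?g ?t)"
          using finite_degrees component_A[OF a DA[of k], of ?t] by (auto simp: degrees_def)
        finally show ?thesis unfolding comp .
      qed
      ultimately show ?case unfolding top using Suc.IH by simp
    qed
    \<comment> \<open>powers of \<open>D\<close> scale the components of \<open>f\<close> for its own grading, so they do not leave a
      finite-dimensional space\<close>
    let ?F = "{i. component u f i \<noteq> 0}"
    have power: "(?D ^^ k) f = (\<Sum>i\<in>?F. (\<lambda>x. of_int i ^ k * component u f i x))" for k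
    proof (induction k)
      case 0
      then show ?case using sum_component[OF u fA] by simp
    next
      case (Suc k)
      show ?case
        using generator_family[OF finite_component[OF u fA] wt_scale[OF component_in_wt[OF u fA]],
            of "\<lambda>i. of_int i ^ k"]
        by (simp add: Suc mult.assoc)
    qed
    have "finite (\<Union>i\<in>?F. {j. component a (component u f i) j \<noteq> 0})"
      by (intro finite_UN_I finite_component[OF a] finite_component[OF u] component_A[OF u] fA)
    then obtain B where "\<forall>j\<in>(\<Union>i\<in>?F. {j. component a (component u f i) j \<noteq> 0}). j \<le> B"
      using bdd_above_finite bdd_above_def by metis
    then have B: "component a (component u f i) j = 0" if "j > B" "i \<in> ?F" for i j
      using that by force
    have "component a ((?D ^^ k) f) j = 0" if "j > B" for j k
      unfolding power
      by (subst component_sum[OF a A_scale[OF component_A[OF u fA]]])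
        (auto simp: component_scale[OF a component_A[OF u fA]] B[OF that] fun_apply zero_fun_def intro!: sum.neutral)
    moreover obtain k where "i + int k * m > B"
    proof
      define K where "K = \<bar>B\<bar> + \<bar>i\<bar> + 1"
      have K: "K \<ge> 0" "B < i + K" unfolding K_def by arith+
      have "K * 1 \<le> K * m" by (rule mult_left_mono) (use m K in auto)
      then show "i + int (nat K) * m > B" using K by simp
    qed
    ultimately show ?thesis using step by metis
  qed
  fix f assume f: "f \<in> A"
  let ?F = "{i. component a f i \<noteq> 0}"
  obtain k where k: "(?E ^^ k i) (component a f i) = 0" for i
    using homogeneous[OF component_in_wt[OF a f]] by metis
  define K where "K = (\<Sum>i\<in>?F. k i)"
  have "(?E ^^ K) (component a f i) = 0" if "i \<in> ?F" for i
  proof -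
    have "k i \<le> K" unfolding K_def by (rule member_le_sum[OF that _ finite_component[OF a f]]) simp
    then have "(?E ^^ K) (component a f i) = (?E ^^ (K - k i)) ((?E ^^ k i) (component a f i))"
      by (metis comp_apply funpow_add le_add_diff_inverse2)
    then show ?thesis by (simp add: k funpow_derivation_zero[OF derivation_component_derivation])
  qed
  then have "(?E ^^ K) f = 0"
    by (subst sum_component[OF a f], subst funpow_derivation_sum[OF derivation_component_derivation component_A[OF a f]]) simp
  then show "\<exists>k. (?E ^^ k) f = 0" ..
qed

text \<open>The components above degree \<open>i\<close> come from components of \<open>D\<close> of positive degree. If there is one, the
top component of \<open>D\<close> is locally nilpotent, and rigidity forces it to vanish. The degrees below \<open>i\<close>
are later treated as degrees above \<open>- i\<close> for the inverse family.\<close>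

lemma generator_no_higher_weights:
  assumes rigid: "rigid n X" and f: "f \<in> wt a i" and k: "i < k"
  shows "component a (generator u f) k = 0"
proof (rule ccontr)
  assume *: "component a (generator u f) k \<noteq> 0"
  then have "derivation_component (k - i) f \<noteq> 0" by (simp add: derivation_component_wt[OF f])
  then have mem: "k - i \<in> degrees" using wt_A[OF f] by (auto simp: degrees_def)
  define m where "m = Max degrees"
  have m: "m \<in> degrees" "\<And>j. j \<in> degrees \<Longrightarrow> j \<le> m"
    unfolding m_def using finite_degrees mem by (auto intro: Max_in)
  have "0 < m" using m(2)[OF mem] k by simp
  then interpret locally_nilpotent_derivation n X "derivation_component m"
    by unfold_locales (rule top_component_locally_nilpotent[OF \<open>0 < m\<close> m(2)])
  show False using m(1) rigid_imp_zero[OF rigid] by (auto simp: degrees_def)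
qed

end

lemma wt_inverse: "wt (\<lambda>t. a (inverse t)) i = wt a (- i)"
proof -
  have "f (a (inverse t) x) = t powi i * f x"
    if "\<And>t x. t \<noteq> 0 \<Longrightarrow> x \<in> X \<Longrightarrow> f (a t x) = t powi (- i) * f x" "t \<noteq> 0" "x \<in> X" for f t x
    using that(1)[of "inverse t" x] that(2,3) by (simp add: power_int_minus power_int_inverse)
  moreover have "f (a t x) = t powi (- i) * f x"
    if "\<And>t x. t \<noteq> 0 \<Longrightarrow> x \<in> X \<Longrightarrow> f (a (inverse t) x) = t powi i * f x" "t \<noteq> 0" "x \<in> X" for f t x
    using that(1)[of "inverse t" x] that(2,3) by (simp add: power_int_minus power_int_inverse)
  ultimately show ?thesis unfolding wt_def by blast
qed

lemma onepar_inverse: assumes a: "onepar a" shows "onepar (\<lambda>t. a (inverse t))"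
  unfolding onepar_def
proof (intro conjI allI impI ballI)
  show "a (inverse t) x \<in> X" if "t \<noteq> 0" "x \<in> X" for t x using onepar_X[OF a] that by simp
  fix f assume f: "f \<in> A"
  obtain F c where F: "finite F" "\<And>i. c i \<in> wt a i" "f = (\<Sum>i\<in>F. c i)"
    using onepar_decompose[OF a f] by blast
  have "f = (\<Sum>i\<in>uminus ` F. c (- i))"
    by (simp add: F(3) sum.reindex)
  then show "\<exists>F c. finite F \<and> (\<forall>i. c i \<in> wt (\<lambda>t. a (inverse t)) i) \<and> f = (\<Sum>i\<in>F. c i)"
    using F(1,2) by (intro exI[of _ "uminus ` F"] exI[of _ "\<lambda>i. c (- i)"]) (simp add: wt_inverse)
qed

lemma component_inverse:
  assumes a: "onepar a" and f: "f \<in> A"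
  shows "component (\<lambda>t. a (inverse t)) f i = component a f (- i)"
proof -
  let ?F = "{i. component a f i \<noteq> 0}"
  have "component (\<lambda>t. a (inverse t)) (\<Sum>j\<in>?F. component a f j) i = (\<Sum>j | j \<in> ?F \<and> - j = i. component a f j)"
    by (rule component_family[OF finite_component[OF a f]]) (simp add: wt_inverse component_in_wt[OF a f])
  also have "{j. j \<in> ?F \<and> - j = i} = (if component a f (- i) = 0 then {} else {- i})" by auto
  finally show ?thesis using sum_component[OF a f] by simp
qed

text \<open>By \<open>generator_no_higher_weights\<close> for \<open>a\<close> and its inverse, the generator of \<open>u\<close> preserves the \<open>a\<close>-weight
spaces. So it commutes with the action of \<open>a\<close> on functions, which therefore preserves the
eigenspaces of the generator, the weight spaces of \<open>u\<close>.\<close>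

theorem onepar_commute:
  assumes rigid: "rigid n X" and a: "onepar a" and u: "onepar u"
    and s: "s \<noteq> 0" and t: "t \<noteq> 0" and x: "x \<in> X"
  shows "a s (u t x) = u t (a s x)"
proof -
  let ?D = "generator u"
  note D = generator_derivation[OF u]
  have pres: "?D f \<in> wt a i" if f: "f \<in> wt a i" for f i
  proof -
    have Df: "?D f \<in> A" by (rule derivation_A[OF D wt_A[OF f]])
    have "component a (?D f) k = 0" if "k \<noteq> i" for k
    proof (cases "i < k")
      case True
      then show ?thesis using generator_no_higher_weights[OF a u rigid f] by blast
    next
      case False
      have "f \<in> wt (\<lambda>t. a (inverse t)) (- i)" using f by (simp add: wt_inverse)
      moreover have "- i < - k" using False that by simp
      ultimately have "component (\<lambda>t. a (inverse t)) (?D f) (- k) = 0"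
        using generator_no_higher_weights[OF onepar_inverse[OF a] u rigid] by blast
      then show ?thesis by (simp add: component_inverse[OF a Df])
    qed
    then have "?D f = (\<Sum>k | component a (?D f) k \<noteq> 0. if k = i then component a (?D f) i else 0)"
      by (subst sum_component[OF a Df]) (rule sum.cong, auto)
    moreover have "\<dots> \<in> wt a i" by (rule wt_sum) (use component_in_wt[OF a Df] in auto)
    ultimately show ?thesis by simp
  qed
  have comm: "?D (pull (a s) f) = pull (a s) (?D f)" if f: "f \<in> A" for f
  proof -
    let ?F = "{i. component a f i \<noteq> 0}"
    have "?D (pull (a s) f) = ?D (\<Sum>i\<in>?F. (\<lambda>x. s powi i * component a f i x))"
      by (subst (1) sum_component[OF a f], subst pull_family[OF a component_in_wt[OF a f] s]) simp
    also have "\<dots> = (\<Sum>i\<in>?F. (\<lambda>x. s powi i * ?D (component a f i) x))"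
      by (subst derivation_sum[OF D A_scale[OF component_A[OF a f]]])
        (simp add: derivation_scale[OF D component_A[OF a f]])
    also have "\<dots> = pull (a s) (\<Sum>i\<in>?F. ?D (component a f i))"
      by (rule pull_family[OF a pres[OF component_in_wt[OF a f]] s, symmetric])
    also have "(\<Sum>i\<in>?F. ?D (component a f i)) = ?D f"
      using derivation_sum[OF D component_A[OF a f], of "\<lambda>i. i" ?F] sum_component[OF a f] by simp
    finally show ?thesis .
  qed
  have wt: "pull (a s) f \<in> wt u j" if f: "f \<in> wt u j" for f j
  proof (rule wt_generatorD[OF u pull_A[OF a wt_A[OF f] s]])
    show "?D (pull (a s) f) = (\<lambda>x. of_int j * pull (a s) f x)"
      unfolding comm[OF wt_A[OF f]] generator_wt[OF f] by (auto simp: pull_def cut_def)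
  qed
  have mem: "u t x \<in> X" "a s x \<in> X" "a s (u t x) \<in> X" "u t (a s x) \<in> X"
    using onepar_X[OF a s] onepar_X[OF u t] x by auto
  have eq: "f (a s (u t x)) = f (u t (a s x))" if f: "f \<in> wt u j" for f j
    using wt_apply[OF wt[OF f] t x] wt_apply[OF f t mem(2)] x mem by (simp add: pull_def)
  show ?thesis
  proof (rule A_separates[OF mem(3,4)])
    fix f assume f: "f \<in> A"
    show "f (a s (u t x)) = f (u t (a s x))"
      by (subst (1 2) sum_component[OF u f]) (simp add: fun_apply eq[OF component_in_wt[OF u f]])
  qed
qed

end

section \<open>Torus actions and their weights\<close>

text \<open>The points of \<open>(K\<^sup>\<times>)\<^sup>r\<close>, as sequences of which only the entries below \<open>r\<close> matter. Sequences rather than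
vectors make it easy to extend a torus by one more coordinate.\<close>

definition nz :: "nat \<Rightarrow> (nat \<Rightarrow> 'k::field) set" where
  "nz r = {t. \<forall>i<r. t i \<noteq> 0}"

text \<open>The character with exponents \<open>w\<close>.\<close>

definition chi :: "nat \<Rightarrow> (nat \<Rightarrow> int) \<Rightarrow> (nat \<Rightarrow> 'k::field) \<Rightarrow> 'k" where
  "chi r w t = (\<Prod>i<r. t i powi w i)"

text \<open>Weights of rank \<open>r\<close>, normalised so that equal characters have equal weights.\<close>

definition supp :: "nat \<Rightarrow> (nat \<Rightarrow> int) set" where
  "supp r = {w. \<forall>i\<ge>r. w i = 0}"

lemma chi_nonzero: "t \<in> nz r \<Longrightarrow> chi r w t \<noteq> 0"
  by (auto simp: nz_def chi_def)

lemma chi_mult: "chi r w (\<lambda>i. s i * t i) = chi r w s * chi r w t"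
  by (simp add: chi_def power_int_mult_distrib prod.distrib)

lemma chi_add: "t \<in> nz r \<Longrightarrow> chi r (v + w) t = chi r v t * chi r w t"
  by (simp add: chi_def nz_def power_int_add prod.distrib[symmetric] fun_apply)

lemma chi_one: "chi r w (\<lambda>_. 1) = 1"
  by (simp add: chi_def)

lemma chi_zero: "chi r 0 t = 1"
  by (simp add: chi_def fun_apply)

lemma chi_cong: "(\<And>i. i < r \<Longrightarrow> s i = t i) \<Longrightarrow> chi r w s = chi r w t"
  by (simp add: chi_def)

lemma chi_powi:
  assumes "s \<noteq> 0" shows "chi r w (\<lambda>i. s powi e i) = s powi (\<Sum>i<r. e i * w i)"
  using assms by (induction r) (auto simp: chi_def power_int_mult[symmetric] power_int_add)

lemma chi_single: "i < r \<Longrightarrow> chi r w (\<lambda>j. if j = i then s else 1) = s powi w i"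
proof -
  assume i: "i < r"
  have "chi r w (\<lambda>j. if j = i then s else 1) = (\<Prod>j<r. if j = i then s powi w i else 1)"
    unfolding chi_def by (rule prod.cong) auto
  then show ?thesis using i by simp
qed

context affine_variety
begin

text \<open>Simultaneous weight spaces, for actions of \<open>(K\<^sup>\<times>)\<^sup>r\<close>.\<close>

definition mwt :: "nat \<Rightarrow> ((nat \<Rightarrow> 'k) \<Rightarrow> 'k vec \<Rightarrow> 'k vec) \<Rightarrow> (nat \<Rightarrow> int) \<Rightarrow> ('k vec \<Rightarrow> 'k) set" where
  "mwt r \<rho> w = {f \<in> A. \<forall>t\<in>nz r. \<forall>x\<in>X. f (\<rho> t x) = chi r w t * f x}"

definition toric :: "nat \<Rightarrow> ((nat \<Rightarrow> 'k) \<Rightarrow> 'k vec \<Rightarrow> 'k vec) \<Rightarrow> bool" where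
  "toric r \<rho> \<longleftrightarrow> (\<forall>t\<in>nz r. \<forall>x\<in>X. \<rho> t x \<in> X) \<and>
     (\<forall>f\<in>A. \<exists>F c. finite F \<and> F \<subseteq> supp r \<and> (\<forall>w\<in>F. c w \<in> mwt r \<rho> w) \<and> f = (\<Sum>w\<in>F. c w))"

definition weights :: "nat \<Rightarrow> ((nat \<Rightarrow> 'k) \<Rightarrow> 'k vec \<Rightarrow> 'k vec) \<Rightarrow> (nat \<Rightarrow> int) set" where
  "weights r \<rho> = {w \<in> supp r. \<exists>f\<in>mwt r \<rho> w. f \<noteq> 0}"

text \<open>The subgroup of \<open>\<int>\<^sup>r\<close> generated by the weights: as the weights form a monoid, differences suffice.\<close>

definition wdiff :: "nat \<Rightarrow> ((nat \<Rightarrow> 'k) \<Rightarrow> 'k vec \<Rightarrow> 'k vec) \<Rightarrow> (nat \<Rightarrow> int) set" where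
  "wdiff r \<rho> = {v - w | v w. v \<in> weights r \<rho> \<and> w \<in> weights r \<rho>}"

definition unit :: "nat \<Rightarrow> nat \<Rightarrow> int" where
  "unit i = (\<lambda>j. if j = i then 1 else 0)"

text \<open>The weights are required to generate \<open>\<int>\<^sup>r\<close>, and not just the action to be faithful, because this
form is what one obtains when the torus is enlarged. Faithfulness is a consequence.\<close>

definition frame :: "nat \<Rightarrow> ((nat \<Rightarrow> 'k) \<Rightarrow> 'k vec \<Rightarrow> 'k vec) \<Rightarrow> bool" where
  "frame r \<rho> \<longleftrightarrow> toric r \<rho> \<and> (\<forall>i<r. unit i \<in> wdiff r \<rho>)"

lemma mwt_A: "f \<in> mwt r \<rho> w \<Longrightarrow> f \<in> A"
  and mwt_apply: "f \<in> mwt r \<rho> w \<Longrightarrow> t \<in> nz r \<Longrightarrow> x \<in> X \<Longrightarrow> f (\<rho> t x) = chi r w t * f x"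
  by (auto simp: mwt_def)

lemma mwtI:
  "f \<in> A \<Longrightarrow> (\<And>t x. t \<in> nz r \<Longrightarrow> x \<in> X \<Longrightarrow> f (\<rho> t x) = chi r w t * f x) \<Longrightarrow> f \<in> mwt r \<rho> w"
  by (auto simp: mwt_def)

lemma mwt_zero [simp]: "0 \<in> mwt r \<rho> w"
  by (rule mwtI) (auto simp: fun_apply)

lemma mwt_add: "f \<in> mwt r \<rho> w \<Longrightarrow> g \<in> mwt r \<rho> w \<Longrightarrow> f + g \<in> mwt r \<rho> w"
  by (rule mwtI) (auto simp: fun_apply mwt_apply mwt_A A_add distrib_left)

lemma mwt_sum: "(\<And>j. j \<in> J \<Longrightarrow> f j \<in> mwt r \<rho> w) \<Longrightarrow> (\<Sum>j\<in>J. f j) \<in> mwt r \<rho> w"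
  by (induction J rule: infinite_finite_induct) (auto intro: mwt_add)

lemma mwt_mult: "f \<in> mwt r \<rho> v \<Longrightarrow> g \<in> mwt r \<rho> w \<Longrightarrow> f * g \<in> mwt r \<rho> (v + w)"
  by (rule mwtI) (auto simp: fun_apply mwt_apply mwt_A A_mult chi_add)

lemma toric_X: "toric r \<rho> \<Longrightarrow> t \<in> nz r \<Longrightarrow> x \<in> X \<Longrightarrow> \<rho> t x \<in> X"
  by (auto simp: toric_def)

lemma toric_decompose:
  assumes "toric r \<rho>" "f \<in> A"
  shows "\<exists>F c. finite F \<and> F \<subseteq> supp r \<and> (\<forall>w\<in>F. c w \<in> mwt r \<rho> w) \<and> f = (\<Sum>w\<in>F. c w)"
  using assms unfolding toric_def by (elim conjE bspec)

text \<open>Weights may repeat in a decomposition, since equal ones can be collected.\<close>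

lemma toricI_family:
  assumes X: "\<And>t x. t \<in> nz r \<Longrightarrow> x \<in> X \<Longrightarrow> \<rho> t x \<in> X"
    and dec: "\<And>f. f \<in> A \<Longrightarrow> \<exists>J (c :: 'j \<Rightarrow> _) d. finite J \<and>
      (\<forall>j\<in>J. d j \<in> supp r \<and> c j \<in> mwt r \<rho> (d j)) \<and> f = (\<Sum>j\<in>J. c j)"
  shows "toric r \<rho>"
  unfolding toric_def
proof (intro conjI ballI X)
  fix f assume "f \<in> A"
  then obtain J and c :: "'j \<Rightarrow> _" and d where J: "finite J"
    "\<forall>j\<in>J. d j \<in> supp r \<and> c j \<in> mwt r \<rho> (d j)" "f = (\<Sum>j\<in>J. c j)" using dec by metis
  let ?c = "\<lambda>w. \<Sum>j | j \<in> J \<and> d j = w. c j"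
  have "?c w \<in> mwt r \<rho> w" for w by (rule mwt_sum) (use J(2) in auto)
  moreover have "f = (\<Sum>w\<in>d ` J. ?c w)"
    unfolding J(3) by (rule sum.image_gen[OF J(1)])
  ultimately show "\<exists>F c. finite F \<and> F \<subseteq> supp r \<and> (\<forall>w\<in>F. c w \<in> mwt r \<rho> w) \<and> f = (\<Sum>w\<in>F. c w)"
    using J(1,2) by (intro exI[of _ "d ` J"] exI[of _ ?c]) auto
qed

lemma oneparI_family:
  assumes X: "\<And>t x. t \<noteq> 0 \<Longrightarrow> x \<in> X \<Longrightarrow> a t x \<in> X"
    and dec: "\<And>f. f \<in> A \<Longrightarrow> \<exists>J (c :: 'j \<Rightarrow> _) d. finite J \<and>
      (\<forall>j\<in>J. c j \<in> wt a (d j)) \<and> f = (\<Sum>j\<in>J. c j)"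
  shows "onepar a"
  unfolding onepar_def
proof (intro conjI allI impI ballI X)
  fix f assume "f \<in> A"
  then obtain J and c :: "'j \<Rightarrow> _" and d where J: "finite J"
    "\<forall>j\<in>J. c j \<in> wt a (d j)" "f = (\<Sum>j\<in>J. c j)" using dec by metis
  let ?c = "\<lambda>w. \<Sum>j | j \<in> J \<and> d j = w. c j"
  have "?c i \<in> wt a i" for i by (rule wt_sum) (use J(2) in auto)
  moreover have "f = (\<Sum>w\<in>d ` J. ?c w)"
    unfolding J(3) by (rule sum.image_gen[OF J(1)])
  ultimately show "\<exists>F c. finite F \<and> (\<forall>i. c i \<in> wt a i) \<and> f = (\<Sum>i\<in>F. c i)"
    using J(1) by (intro exI[of _ "d ` J"] exI[of _ ?c]) auto
qed

lemma toric_separates: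
  assumes \<rho>: "toric r \<rho>" and "y \<in> X" "z \<in> X"
    and eq: "\<And>w f. w \<in> supp r \<Longrightarrow> f \<in> mwt r \<rho> w \<Longrightarrow> f y = f z"
  shows "y = z"
proof (rule A_separates[OF assms(2,3)])
  fix f assume fA: "f \<in> A"
  obtain F c where F: "finite F" "F \<subseteq> supp r" "\<And>w. w \<in> F \<Longrightarrow> c w \<in> mwt r \<rho> w" "f = (\<Sum>w\<in>F. c w)"
    using toric_decompose[OF \<rho> fA]
      by (elim exE conjE) (rule that, assumption, assumption, erule bspec, assumption+)
  show "f y = f z" unfolding F(4) fun_apply by (rule sum.cong[OF refl], rule eq) (use F in auto)
qed

lemma toric_cong:
  assumes \<rho>: "toric r \<rho>" and s: "s \<in> nz r" and eq: "\<And>i. i < r \<Longrightarrow> s i = t i" and x: "x \<in> X"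
  shows "\<rho> s x = \<rho> t x"
proof -
  have t: "t \<in> nz r" using s eq by (auto simp: nz_def)
  show ?thesis
    by (rule toric_separates[OF \<rho> toric_X[OF \<rho> s x] toric_X[OF \<rho> t x]])
      (simp add: mwt_apply s t x chi_cong[OF eq])
qed

lemma toric_mult:
  assumes \<rho>: "toric r \<rho>" and s: "s \<in> nz r" and t: "t \<in> nz r" and x: "x \<in> X"
  shows "\<rho> (\<lambda>i. s i * t i) x = \<rho> s (\<rho> t x)"
proof -
  have st: "(\<lambda>i. s i * t i) \<in> nz r" using s t by (auto simp: nz_def)
  show ?thesis
    by (rule toric_separates[OF \<rho> toric_X[OF \<rho> st x] toric_X[OF \<rho> s toric_X[OF \<rho> t x]]])
      (simp add: mwt_apply s t st x toric_X[OF \<rho> t x] chi_mult mult.assoc)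
qed

lemma toric_one:
  assumes \<rho>: "toric r \<rho>" and x: "x \<in> X" shows "\<rho> (\<lambda>_. 1) x = x"
proof -
  have 1: "(\<lambda>_. 1) \<in> nz r" by (auto simp: nz_def)
  show ?thesis
    by (rule toric_separates[OF \<rho> toric_X[OF \<rho> 1 x] x]) (simp add: mwt_apply 1 x chi_one)
qed

lemma toric_onepar_wt:
  assumes "f \<in> mwt r \<rho> w" shows "f \<in> wt (\<lambda>t. \<rho> (\<lambda>i. t powi e i)) (\<Sum>i<r. e i * w i)"
proof (rule wtI[OF mwt_A[OF assms]])
  fix t :: 'k and x assume t: "t \<noteq> 0" and x: "x \<in> X"
  have "(\<lambda>i. t powi e i) \<in> nz r" using t by (auto simp: nz_def)
  then show "f (\<rho> (\<lambda>i. t powi e i) x) = t powi (\<Sum>i<r. e i * w i) * f x"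
    using mwt_apply[OF assms _ x] chi_powi[OF t, of r w e] by simp
qed

lemma toric_onepar:
  assumes \<rho>: "toric r \<rho>" shows "onepar (\<lambda>t. \<rho> (\<lambda>i. t powi e i))"
proof (rule oneparI_family)
  show "\<rho> (\<lambda>i. t powi e i) x \<in> X" if "t \<noteq> 0" "x \<in> X" for t x
    by (rule toric_X[OF \<rho>]) (use that in \<open>auto simp: nz_def\<close>)
  fix f assume fA: "f \<in> A"
  obtain F c where F: "finite F" "F \<subseteq> supp r" "\<And>w. w \<in> F \<Longrightarrow> c w \<in> mwt r \<rho> w" "f = (\<Sum>w\<in>F. c w)"
    using toric_decompose[OF \<rho> fA]
      by (elim exE conjE) (rule that, assumption, assumption, erule bspec, assumption+)
  show "\<exists>J (c :: (nat \<Rightarrow> int) \<Rightarrow> _) d. finite J \<and> (\<forall>j\<in>J. c j \<in> wt (\<lambda>t. \<rho> (\<lambda>i. t powi e i)) (d j)) \<and> f = (\<Sum>j\<in>J. c j)"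
    by (intro exI[of _ F] exI[of _ c] exI[of _ "\<lambda>w. \<Sum>i<r. e i * w i"])
      (use F in \<open>simp add: toric_onepar_wt\<close>)
qed

text \<open>Actions of \<open>(K\<^sup>\<times>)\<^sup>r\<close> without any regularity. They occur as parametrised subtori before their weight
decomposition is known.\<close>

definition param_action :: "nat \<Rightarrow> ((nat \<Rightarrow> 'k) \<Rightarrow> 'k vec \<Rightarrow> 'k vec) \<Rightarrow> bool" where
  "param_action r \<sigma> \<longleftrightarrow> (\<forall>t\<in>nz r. \<forall>x\<in>X. \<sigma> t x \<in> X) \<and> (\<forall>x\<in>X. \<sigma> (\<lambda>_. 1) x = x) \<and>
     (\<forall>s\<in>nz r. \<forall>t\<in>nz r. \<forall>x\<in>X. \<sigma> (\<lambda>i. s i * t i) x = \<sigma> s (\<sigma> t x)) \<and>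
     (\<forall>s\<in>nz r. \<forall>t. (\<forall>i<r. s i = t i) \<longrightarrow> (\<forall>x\<in>X. \<sigma> s x = \<sigma> t x))"

lemma toric_param_action: "toric r \<rho> \<Longrightarrow> param_action r \<rho>"
  unfolding param_action_def using toric_X toric_one toric_mult toric_cong by blast

text \<open>The torus is generated by its coordinate one-parameter subgroups: \<open>t\<close> is built up from the sequences
\<open>tr k\<close>, which agree with \<open>t\<close> below \<open>k\<close> and are \<open>1\<close> from \<open>k\<close> on.\<close>

lemma param_action_induct:
  assumes \<sigma>: "param_action r \<sigma>" and t: "t \<in> nz r"
    and one: "P (\<lambda>x. x)"
    and step: "\<And>i g. i < r \<Longrightarrow> P g \<Longrightarrow> P (\<lambda>x. \<sigma> (\<lambda>j. t i powi unit i j) (g x))"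
    and cong: "\<And>g h. (\<And>x. x \<in> X \<Longrightarrow> g x = h x) \<Longrightarrow> P g \<Longrightarrow> P h"
  shows "P (\<sigma> t)"
proof -
  define tr where "tr = (\<lambda>k j. if j < k then t j else 1)"
  have tr: "tr k \<in> nz r" for k using t by (auto simp: tr_def nz_def)
  have "P (\<sigma> (tr k))" if "k \<le> r" for k
    using that
  proof (induction k)
    case 0
    have "tr 0 = (\<lambda>_. 1)" by (auto simp: tr_def)
    then show ?case using \<sigma> by (auto intro: cong[OF _ one] simp: param_action_def)
  next
    case (Suc k)
    have nz: "(\<lambda>j. t k powi unit k j) \<in> nz r" using t Suc.prems by (auto simp: nz_def unit_def)
    have "tr (Suc k) = (\<lambda>j. t k powi unit k j * tr k j)"
      by (rule ext) (auto simp: tr_def unit_def less_Suc_eq)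
    then have "\<sigma> (\<lambda>j. t k powi unit k j) (\<sigma> (tr k) x) = \<sigma> (tr (Suc k)) x" if "x \<in> X" for x
      using \<sigma> nz tr[of k] that unfolding param_action_def by metis
    moreover have "P (\<lambda>x. \<sigma> (\<lambda>j. t k powi unit k j) (\<sigma> (tr k) x))"
      using Suc by (intro step) auto
    ultimately show ?case by (rule cong)
  qed
  moreover have "\<sigma> (tr r) x = \<sigma> t x" if "x \<in> X" for x
    using \<sigma> tr[of r] that unfolding param_action_def by (simp add: tr_def)
  ultimately show ?thesis using cong by blast
qed

lemma onepar_toric_commute:
  assumes rigid: "rigid n X" and \<rho>: "toric r \<rho>" and a: "onepar a"
    and s: "s \<noteq> 0" and t: "t \<in> nz r" and x: "x \<in> X"
  shows "a s (\<rho> t x) = \<rho> t (a s x)"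
proof -
  have "\<forall>x\<in>X. \<rho> t x \<in> X \<and> a s (\<rho> t x) = \<rho> t (a s x)"
  proof (rule param_action_induct[OF toric_param_action[OF \<rho>] t, where P = "\<lambda>g. \<forall>x\<in>X. g x \<in> X \<and> a s (g x) = g (a s x)"])
    fix i g assume i: "i < r" and g: "\<forall>x\<in>X. g x \<in> X \<and> a s (g x) = g (a s x)"
    have "t i \<noteq> 0" using i t by (auto simp: nz_def)
    then show "\<forall>x\<in>X. \<rho> (\<lambda>j. t i powi unit i j) (g x) \<in> X \<and>
        a s (\<rho> (\<lambda>j. t i powi unit i j) (g x)) = \<rho> (\<lambda>j. t i powi unit i j) (g (a s x))"
      using onepar_commute[OF rigid a toric_onepar[OF \<rho>] s] onepar_X[OF toric_onepar[OF \<rho>]] g by metis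
  next
    fix g h assume gh: "\<And>x. x \<in> X \<Longrightarrow> g x = h x" and g: "\<forall>x\<in>X. g x \<in> X \<and> a s (g x) = g (a s x)"
    then show "\<forall>x\<in>X. h x \<in> X \<and> a s (h x) = h (a s x)"
      using onepar_X[OF a s] by metis
  qed simp
  then show ?thesis using x by blast
qed

subsection \<open>The group of weights\<close>

lemma weights_supp: "w \<in> weights r \<rho> \<Longrightarrow> w \<in> supp r"
  by (auto simp: weights_def)

text \<open>The product of two nonzero weight functions is nonzero, as \<open>A\<close> is a domain.\<close>

lemma weights_add:
  assumes "v \<in> weights r \<rho>" "w \<in> weights r \<rho>" shows "v + w \<in> weights r \<rho>"
proof -
  obtain f g where fg: "f \<in> mwt r \<rho> v" "f \<noteq> 0" "g \<in> mwt r \<rho> w" "g \<noteq> 0"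
    using assms by (auto simp: weights_def)
  then have "f * g \<noteq> 0" using A_domain mwt_A by blast
  moreover have "f * g \<in> mwt r \<rho> (v + w)" by (rule mwt_mult[OF fg(1,3)])
  moreover have "v + w \<in> supp r" using assms by (simp add: weights_def supp_def fun_apply)
  ultimately show ?thesis unfolding weights_def by blast
qed

lemma weights_zero: assumes "toric r \<rho>" shows "0 \<in> weights r \<rho>"
proof -
  have "cut (\<lambda>_. 1) \<in> mwt r \<rho> 0"
    by (rule mwtI[OF A_const]) (simp add: toric_X[OF assms] chi_zero)
  moreover have "cut (\<lambda>_. 1) \<noteq> 0"
    using X_nonempty by (auto simp: cut_def zero_fun_def fun_eq_iff)
  ultimately show ?thesis by (auto simp: weights_def supp_def fun_apply)
qed

lemma weights_sum:
  assumes "toric r \<rho>" "\<And>i. i \<in> I \<Longrightarrow> w i \<in> weights r \<rho>" shows "(\<Sum>i\<in>I. w i) \<in> weights r \<rho>"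
  using assms(2)
  by (induction I rule: infinite_finite_induct) (auto simp: weights_zero[OF assms(1)] weights_add)

lemma wdiff_weights: "toric r \<rho> \<Longrightarrow> w \<in> weights r \<rho> \<Longrightarrow> w \<in> wdiff r \<rho>"
  using weights_zero[of r \<rho>] unfolding wdiff_def by (metis (mono_tags, lifting) diff_zero mem_Collect_eq)

lemma wdiff_outside: "w \<in> wdiff r \<rho> \<Longrightarrow> r \<le> j \<Longrightarrow> w j = 0"
  by (auto simp: wdiff_def weights_def supp_def)

lemma wdiff_zero: "toric r \<rho> \<Longrightarrow> 0 \<in> wdiff r \<rho>"
  using wdiff_weights weights_zero by blast

lemma wdiff_diff:
  assumes "v \<in> wdiff r \<rho>" "w \<in> wdiff r \<rho>" shows "v - w \<in> wdiff r \<rho>"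
proof -
  obtain v1 v2 w1 w2 where *: "v = v1 - v2" "w = w1 - w2"
    "v1 \<in> weights r \<rho>" "v2 \<in> weights r \<rho>" "w1 \<in> weights r \<rho>" "w2 \<in> weights r \<rho>"
    using assms by (auto simp: wdiff_def)
  have "v - w = (v1 + w2) - (v2 + w1)" unfolding *(1,2) by (simp add: algebra_simps)
  then show ?thesis using * weights_add unfolding wdiff_def by blast
qed

lemma wdiff_add:
  assumes "toric r \<rho>" "v \<in> wdiff r \<rho>" "w \<in> wdiff r \<rho>" shows "v + w \<in> wdiff r \<rho>"
  using wdiff_diff[OF assms(2) wdiff_diff[OF wdiff_zero[OF assms(1)] assms(3)]] by simp

lemma wdiff_sum:
  assumes "toric r \<rho>" "\<And>i. i \<in> I \<Longrightarrow> w i \<in> wdiff r \<rho>" shows "(\<Sum>i\<in>I. w i) \<in> wdiff r \<rho>"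
  using assms(2)
  by (induction I rule: infinite_finite_induct) (auto simp: wdiff_zero[OF assms(1)] wdiff_add[OF assms(1)])

lemma wdiff_scale:
  assumes \<rho>: "toric r \<rho>" and w: "w \<in> wdiff r \<rho>" shows "(\<lambda>j. k * w j) \<in> wdiff r \<rho>"
proof -
  have nat: "(\<lambda>j. int m * w j) \<in> wdiff r \<rho>" for m
  proof (induction m)
    case 0
    then show ?case using wdiff_zero[OF \<rho>] by (simp add: zero_fun_def)
  next
    case (Suc m)
    have "(\<lambda>j. int (Suc m) * w j) = (\<lambda>j. int m * w j) + w"
      by (auto simp: fun_apply algebra_simps)
    then show ?case using wdiff_add[OF \<rho> Suc w] by simp
  qed
  show ?thesis
  proof (cases "k \<ge> 0")
    case True
    then show ?thesis using nat[of "nat k"] by simp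
  next
    case False
    have "(\<lambda>j. k * w j) = 0 - (\<lambda>j. int (nat (- k)) * w j)" using False by (auto simp: fun_apply)
    then show ?thesis using wdiff_diff[OF wdiff_zero[OF \<rho>] nat[of "nat (- k)"]] by simp
  qed
qed

lemma int_subgroup_generator:
  fixes H :: "int set"
  assumes diff: "\<And>a b. a \<in> H \<Longrightarrow> b \<in> H \<Longrightarrow> a - b \<in> H" and h: "h \<in> H" "h \<noteq> 0"
  shows "\<exists>d>0. d \<in> H \<and> (\<forall>a\<in>H. d dvd a)"
proof -
  have zero: "0 \<in> H" using diff[OF h(1) h(1)] by simp
  have neg: "- a \<in> H" if "a \<in> H" for a using diff[OF zero that] by simp
  define P where "P = (\<lambda>m::nat. m > 0 \<and> int m \<in> H)"
  have "P (nat \<bar>h\<bar>)" using h neg by (auto simp: P_def abs_if)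
  then have P: "P (Least P)" by (rule LeastI)
  let ?d = "int (Least P)"
  have mult: "?d * int q \<in> H" for q
  proof (induction q)
    case 0 then show ?case using zero by simp
  next
    case (Suc q)
    have "?d * int (Suc q) = ?d * int q - (- ?d)" by (simp add: algebra_simps)
    then show ?case using diff[OF Suc neg] P by (simp add: P_def)
  qed
  have multi: "?d * q \<in> H" for q
    using mult[of "nat \<bar>q\<bar>"] neg[OF mult[of "nat \<bar>q\<bar>"]] by (cases "q \<ge> 0") auto
  have "?d dvd a" if a: "a \<in> H" for a
  proof -
    have "a mod ?d = a - ?d * (a div ?d)" by (simp add: minus_mult_div_eq_mod)
    then have mem: "a mod ?d \<in> H" using diff[OF a multi] by simp
    have pos: "?d > 0" using P by (simp add: P_def)
    have bound: "0 \<le> a mod ?d" "a mod ?d < ?d" using pos by auto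
    have "a mod ?d = 0"
    proof (rule ccontr)
      assume "a mod ?d \<noteq> 0"
      then have "P (nat (a mod ?d))" using mem bound by (simp add: P_def)
      then have "Least P \<le> nat (a mod ?d)" by (rule Least_le)
      then show False using bound by linarith
    qed
    then show ?thesis by auto
  qed
  then show ?thesis using P by (intro exI[of _ ?d]) (auto simp: P_def)
qed

subsection \<open>Enlarging a torus\<close>

text \<open>The torus and \<open>a\<close> commute, so the \<open>a\<close>-components of a weight function of the torus have the same
torus weight. This gives the simultaneous weight decomposition for the torus combined with \<open>a\<close>.\<close>

lemma component_in_mwt:
  assumes rigid: "rigid n X" and \<rho>: "toric r \<rho>" and a: "onepar a" and f: "f \<in> mwt r \<rho> w"
  shows "component a f k \<in> mwt r \<rho> w"
proof (rule mwtI[OF component_A[OF a mwt_A[OF f]]])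
  fix t :: "nat \<Rightarrow> 'k" and x assume t: "t \<in> nz r" and x: "x \<in> X"
  have "laurent (\<lambda>i. chi r w t * component a f i x) (\<lambda>s. f (a s (\<rho> t x)))"
    by (rule laurent_cong[OF laurent_scale[OF laurent_orbit[OF a mwt_A[OF f] x]]])
      (simp add: onepar_toric_commute[OF rigid \<rho> a _ t x] mwt_apply[OF f t] onepar_X[OF a _ x])
  from fun_cong[OF laurent_unique[OF laurent_orbit[OF a mwt_A[OF f] toric_X[OF \<rho> t x]] this]]
  show "component a f k (\<rho> t x) = chi r w t * component a f k x" .
qed

lemma combine_mwt:
  assumes \<rho>: "toric r \<rho>" and a: "onepar a" and f: "f \<in> mwt r \<rho> w" "f \<in> wt a k"
  shows "f \<in> mwt (Suc r) (\<lambda>t x. \<rho> t (a (t r) x)) (w(r := k))"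
proof (rule mwtI[OF mwt_A[OF f(1)]])
  fix t :: "nat \<Rightarrow> 'k" and x assume t: "t \<in> nz (Suc r)" and x: "x \<in> X"
  have t': "t r \<noteq> 0" "t \<in> nz r" using t by (auto simp: nz_def)
  have "chi (Suc r) (w(r := k)) t = chi r w t * t r powi k"
    by (simp add: chi_def)
  then show "f (\<rho> t (a (t r) x)) = chi (Suc r) (w(r := k)) t * f x"
    using mwt_apply[OF f(1) t'(2) onepar_X[OF a t'(1) x]] wt_apply[OF f(2) t'(1) x] by simp
qed

lemma combine_toric:
  assumes rigid: "rigid n X" and \<rho>: "toric r \<rho>" and a: "onepar a"
  shows "toric (Suc r) (\<lambda>t x. \<rho> t (a (t r) x))"
proof (rule toricI_family)
  show "\<rho> t (a (t r) x) \<in> X" if "t \<in> nz (Suc r)" "x \<in> X" for t x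
    by (intro toric_X[OF \<rho>] onepar_X[OF a]) (use that in \<open>auto simp: nz_def\<close>)
  fix f assume fA: "f \<in> A"
  obtain F c where F: "finite F" "F \<subseteq> supp r" "\<And>w. w \<in> F \<Longrightarrow> c w \<in> mwt r \<rho> w" "f = (\<Sum>w\<in>F. c w)"
    using toric_decompose[OF \<rho> fA]
      by (elim exE conjE) (rule that, assumption, assumption, erule bspec, assumption+)
  let ?G = "\<lambda>w. {k. component a (c w) k \<noteq> 0}"
  have cA: "c w \<in> A" if "w \<in> F" for w using F(3)[OF that] mwt_A by blast
  have fin: "finite (Sigma F ?G)" by (intro finite_SigmaI F(1) finite_component[OF a] cA)
  have "f = (\<Sum>w\<in>F. \<Sum>k\<in>?G w. component a (c w) k)"
    unfolding F(4) by (rule sum.cong[OF refl]) (use sum_component[OF a cA] in blast)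
  also have "\<dots> = (\<Sum>(w, k)\<in>Sigma F ?G. component a (c w) k)"
    by (rule sum.Sigma) (use F(1) finite_component[OF a cA] in auto)
  finally have f: "f = (\<Sum>(w, k)\<in>Sigma F ?G. component a (c w) k)" .
  show "\<exists>J (c :: (nat \<Rightarrow> int) \<times> int \<Rightarrow> _) d. finite J \<and> (\<forall>j\<in>J. d j \<in> supp (Suc r) \<and>
      c j \<in> mwt (Suc r) (\<lambda>t x. \<rho> t (a (t r) x)) (d j)) \<and> f = (\<Sum>j\<in>J. c j)"
  proof (intro exI[of _ "Sigma F ?G"] exI[of _ "\<lambda>(w, k). component a (c w) k"]
      exI[of _ "\<lambda>(w, k). w(r := k)"] conjI fin f ballI)
    fix j assume j: "j \<in> Sigma F ?G"
    obtain w k where wk: "j = (w, k)" "w \<in> F" using j by auto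
    show "(case j of (w, k) \<Rightarrow> w(r := k)) \<in> supp (Suc r)"
      using wk F(2) by (auto simp: supp_def)
    show "(case j of (w, k) \<Rightarrow> component a (c w) k) \<in> mwt (Suc r) (\<lambda>t x. \<rho> t (a (t r) x)) (case j of (w, k) \<Rightarrow> w(r := k))"
      unfolding wk(1) prod.case
      by (intro combine_mwt[OF \<rho> a] component_in_mwt[OF rigid \<rho> a F(3)[OF wk(2)]] component_in_wt[OF a cA[OF wk(2)]])
  qed
qed

lemma combine_weights:
  assumes rigid: "rigid n X" and \<rho>: "toric r \<rho>" and a: "onepar a" and w: "w \<in> weights r \<rho>"
  shows "\<exists>k. w(r := k) \<in> weights (Suc r) (\<lambda>t x. \<rho> t (a (t r) x))"
proof -
  obtain f where f: "f \<in> mwt r \<rho> w" "f \<noteq> 0" using w by (auto simp: weights_def)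
  have "\<exists>k. component a f k \<noteq> 0"
    using sum_component[OF a mwt_A[OF f(1)]] f(2) by (metis (mono_tags, lifting) sum.neutral)
  then obtain k where k: "component a f k \<noteq> 0" by blast
  have "component a f k \<in> mwt (Suc r) (\<lambda>t x. \<rho> t (a (t r) x)) (w(r := k))"
    by (intro combine_mwt[OF \<rho> a] component_in_mwt[OF rigid \<rho> a f(1)] component_in_wt[OF a mwt_A[OF f(1)]])
  moreover have "w(r := k) \<in> supp (Suc r)" using weights_supp[OF w] by (auto simp: supp_def)
  ultimately show ?thesis using k unfolding weights_def by blast
qed

text \<open>A change of parameters \<open>\<phi>\<close> is only asked to turn each weight of the action into a character of the
new parameters. This lets \<open>\<phi>\<close> contain roots that are chosen arbitrarily for each parameter.\<close>

lemma reparametrize: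
  assumes \<rho>: "toric r \<rho>" and \<phi>: "\<And>t. t \<in> nz r' \<Longrightarrow> \<phi> t \<in> nz r"
    and \<Phi>: "\<And>w. w \<in> weights r \<rho> \<Longrightarrow> \<Phi> w \<in> supp r'"
    and chi: "\<And>w t. w \<in> weights r \<rho> \<Longrightarrow> t \<in> nz r' \<Longrightarrow> chi r w (\<phi> t) = chi r' (\<Phi> w) t"
  shows "toric r' (\<lambda>t. \<rho> (\<phi> t))"
    and "w \<in> weights r \<rho> \<Longrightarrow> \<Phi> w \<in> weights r' (\<lambda>t. \<rho> (\<phi> t))"
proof -
  have mwt: "f \<in> mwt r' (\<lambda>t. \<rho> (\<phi> t)) (\<Phi> w)" if "w \<in> weights r \<rho>" "f \<in> mwt r \<rho> w" for f w
    by (rule mwtI[OF mwt_A[OF that(2)]]) (simp add: mwt_apply[OF that(2) \<phi>] chi[OF that(1)])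
  show "w \<in> weights r \<rho> \<Longrightarrow> \<Phi> w \<in> weights r' (\<lambda>t. \<rho> (\<phi> t))"
  proof -
    assume w: "w \<in> weights r \<rho>"
    then obtain f where "f \<in> mwt r \<rho> w" "f \<noteq> 0" by (auto simp: weights_def)
    then show "\<Phi> w \<in> weights r' (\<lambda>t. \<rho> (\<phi> t))" unfolding weights_def using mwt[OF w] \<Phi>[OF w] by blast
  qed
  show "toric r' (\<lambda>t. \<rho> (\<phi> t))"
  proof (rule toricI_family)
    show "\<rho> (\<phi> t) x \<in> X" if "t \<in> nz r'" "x \<in> X" for t x by (rule toric_X[OF \<rho> \<phi>[OF that(1)] that(2)])
    fix f assume fA: "f \<in> A"
    obtain F c where F: "finite F" "F \<subseteq> supp r" "\<And>w. w \<in> F \<Longrightarrow> c w \<in> mwt r \<rho> w" "f = (\<Sum>w\<in>F. c w)"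
      using toric_decompose[OF \<rho> fA]
      by (elim exE conjE) (rule that, assumption, assumption, erule bspec, assumption+)
    let ?F = "{w \<in> F. c w \<noteq> 0}"
    have W: "w \<in> weights r \<rho>" if "w \<in> ?F" for w using that F(2,3) by (auto simp: weights_def)
    have "f = (\<Sum>w\<in>?F. c w)" unfolding F(4) by (rule sum.mono_neutral_right) (use F(1) in auto)
    then show "\<exists>J (c :: (nat \<Rightarrow> int) \<Rightarrow> _) d. finite J \<and> (\<forall>j\<in>J. d j \<in> supp r' \<and> c j \<in> mwt r' (\<lambda>t. \<rho> (\<phi> t)) (d j)) \<and>
        f = (\<Sum>j\<in>J. c j)"
      using W F by (intro exI[of _ ?F] exI[of _ c] exI[of _ \<Phi>]) (auto intro!: mwt \<Phi>)
  qed
qed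

text \<open>Put \<open>a\<close> in the last coordinate \<open>r\<close> of a combined torus \<open>\<rho>1\<close>. For \<open>i < r\<close> the unit vector \<open>unit i\<close>
lifts to a difference of weights with some last entry \<open>e i\<close>. The linear form
\<open>l w = w r - (\<Sum>i<r. e i * w i)\<close> vanishes on these lifts. If it vanishes on all weights, then \<open>a s\<close>
is the element of the frame with coordinates \<open>s powi e i\<close>. Otherwise its values on differences of
weights form the group \<open>d \<int>\<close> with \<open>d > 0\<close>, and \<open>w \<mapsto> (w 0, \<dots>, w (r - 1), l w / d)\<close> maps the
differences onto \<open>\<int>\<^sup>r\<^sup>+\<^sup>1\<close>. On parameters this map is dual to replacing \<open>t r\<close> by a \<open>d\<close>-th root \<open>s\<close> of
it and \<open>t i\<close> by \<open>t i * s powi - e i\<close>; here algebraic closedness is used.\<close>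

theorem frame_extend_or_contain:
  assumes rigid: "rigid n X" and frame: "frame r \<rho>" and a: "onepar a"
  obtains (extend) \<rho>' where "frame (Suc r) \<rho>'"
  | (contain) "\<And>s. s \<noteq> 0 \<Longrightarrow> \<exists>t\<in>nz r. \<forall>x\<in>X. a s x = \<rho> t x"
proof -
  define \<rho>1 where "\<rho>1 = (\<lambda>t x. \<rho> t (a (t r) x))"
  have \<rho>: "toric r \<rho>" using frame by (simp add: frame_def)
  have \<rho>1: "toric (Suc r) \<rho>1" unfolding \<rho>1_def by (rule combine_toric[OF rigid \<rho> a])
  have "\<exists>k. unit i + (\<lambda>j. k * unit r j) \<in> wdiff (Suc r) \<rho>1" if i: "i < r" for i
  proof -
    obtain p q where pq: "p \<in> weights r \<rho>" "q \<in> weights r \<rho>" "unit i = p - q"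
      using frame i by (auto simp: frame_def wdiff_def)
    obtain k l where kl: "p(r := k) \<in> weights (Suc r) \<rho>1" "q(r := l) \<in> weights (Suc r) \<rho>1"
      using combine_weights[OF rigid \<rho> a pq(1)] combine_weights[OF rigid \<rho> a pq(2)]
      unfolding \<rho>1_def by blast
    have "unit i + (\<lambda>j. (k - l) * unit r j) = p(r := k) - q(r := l)"
    proof
      fix j show "(unit i + (\<lambda>j. (k - l) * unit r j)) j = (p(r := k) - q(r := l)) j"
        using fun_cong[OF pq(3), of j] i by (auto simp: fun_apply unit_def)
    qed
    then show ?thesis using kl unfolding wdiff_def by blast
  qed
  then obtain e where e: "\<And>i. i < r \<Longrightarrow> unit i + (\<lambda>j. e i * unit r j) \<in> wdiff (Suc r) \<rho>1" by metis
  define l :: "(nat \<Rightarrow> int) \<Rightarrow> int" where "l = (\<lambda>w. w r - (\<Sum>i<r. e i * w i))"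
  have l_diff: "l (v - w) = l v - l w" for v w
    by (simp add: l_def right_diff_distrib sum_subtractf)
  define H where "H = l ` wdiff (Suc r) \<rho>1"
  have H_diff: "c - d \<in> H" if "c \<in> H" "d \<in> H" for c d
    using that wdiff_diff unfolding H_def by (auto simp: l_diff[symmetric])
  show ?thesis
  proof (cases "H \<subseteq> {0}")
    case True
    have l0: "w r = (\<Sum>i<r. e i * w i)" if "w \<in> weights (Suc r) \<rho>1" for w
      using wdiff_weights[OF \<rho>1 that] True by (auto simp: H_def l_def)
    show ?thesis
    proof (rule contain)
      fix s :: 'k assume s: "s \<noteq> 0"
      define t1 where "t1 = (\<lambda>j. s powi unit r j)"
      define t2 where "t2 = (\<lambda>j. s powi (if j < r then e j else 0))"
      have nz1: "t1 \<in> nz k" and nz2: "t2 \<in> nz k" for k using s by (auto simp: t1_def t2_def nz_def)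
      have "a s x = \<rho> t2 x" if x: "x \<in> X" for x
      proof -
        have "t1 r = s" "t2 r = 1" by (auto simp: t1_def t2_def unit_def)
        have "\<rho>1 t1 x = \<rho>1 t2 x"
        proof (rule toric_separates[OF \<rho>1 toric_X[OF \<rho>1 nz1 x] toric_X[OF \<rho>1 nz2 x]])
          fix w f assume w: "w \<in> supp (Suc r)" and f: "f \<in> mwt (Suc r) \<rho>1 w"
          show "f (\<rho>1 t1 x) = f (\<rho>1 t2 x)"
          proof (cases "f = 0")
            case False
            then have "w \<in> weights (Suc r) \<rho>1" using w f by (auto simp: weights_def)
            have "chi (Suc r) w t1 = s powi (\<Sum>i<Suc r. unit r i * w i)"
              unfolding t1_def by (rule chi_powi[OF s])
            also have "(\<Sum>i<Suc r. unit r i * w i) = w r" by (simp add: unit_def)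
            also have "w r = (\<Sum>i<Suc r. (if i < r then e i else 0) * w i)"
              using l0[OF \<open>w \<in> weights (Suc r) \<rho>1\<close>] by simp
            also have "s powi \<dots> = chi (Suc r) w t2"
              unfolding t2_def by (rule chi_powi[OF s, symmetric])
            finally show ?thesis using mwt_apply[OF f nz1 x] mwt_apply[OF f nz2 x] by simp
          qed (simp add: fun_apply)
        qed
        moreover have "\<rho>1 t1 x = a s x"
          using toric_cong[OF \<rho> nz1, of "\<lambda>_. 1"] toric_one[OF \<rho>] onepar_X[OF a s x] \<open>t1 r = s\<close>
          by (simp add: \<rho>1_def t1_def unit_def)
        moreover have "a 1 x = x"
          using toric_one[OF \<rho>1 x] toric_one[OF \<rho> onepar_X[OF a _ x], of 1] by (simp add: \<rho>1_def)
        ultimately show ?thesis using \<open>t2 r = 1\<close> by (simp add: \<rho>1_def)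
      qed
      then show "\<exists>t\<in>nz r. \<forall>x\<in>X. a s x = \<rho> t x" using nz2 by blast
    qed
  next
    case False
    then obtain h where "h \<in> H" "h \<noteq> 0" by blast
    then obtain d where "d > 0 \<and> d \<in> H \<and> (\<forall>c\<in>H. d dvd c)"
      using int_subgroup_generator[OF H_diff] by blast
    then have d: "d > 0" "d \<in> H" "\<And>c. c \<in> H \<Longrightarrow> d dvd c" by auto
    define root :: "'k \<Rightarrow> 'k" where "root = (\<lambda>u. SOME s. s ^ nat d = u)"
    have root: "root u ^ nat d = u" for u
      unfolding root_def using d(1) nth_root_exists[of "nat d" u] by (metis (mono_tags, lifting) someI_ex zero_less_nat_eq)
    have root_nz: "root u \<noteq> 0" if "u \<noteq> 0" for u
      using root[of u] that d(1) by (metis power_0_left zero_less_nat_eq less_irrefl)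
    define \<phi> where "\<phi> = (\<lambda>(t :: nat \<Rightarrow> 'k) i. if i < r then t i * root (t r) powi (- e i) else root (t r))"
    define \<Phi> where "\<Phi> = (\<lambda>w :: nat \<Rightarrow> int. w(r := l w div d))"
    have ld: "d dvd l w" if "w \<in> weights (Suc r) \<rho>1" for w
      using d(3) wdiff_weights[OF \<rho>1 that] by (auto simp: H_def)
    have chi: "chi (Suc r) w (\<phi> t) = chi (Suc r) (\<Phi> w) t"
      if w: "w \<in> weights (Suc r) \<rho>1" and t: "t \<in> nz (Suc r)" for w t
    proof -
      let ?s = "root (t r)"
      have s: "?s \<noteq> 0" using root_nz t by (auto simp: nz_def)
      have "chi (Suc r) w (\<phi> t) = (\<Prod>i<r. t i powi w i) * chi r w (\<lambda>i. ?s powi (- e i)) * ?s powi w r"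
        by (simp add: chi_def \<phi>_def power_int_mult_distrib prod.distrib)
      also have "chi r w (\<lambda>i. ?s powi (- e i)) = ?s powi (- (\<Sum>i<r. e i * w i))"
        by (subst chi_powi[OF s]) (simp add: sum_negf)
      also have "(\<Prod>i<r. t i powi w i) * ?s powi (- (\<Sum>i<r. e i * w i)) * ?s powi w r
          = (\<Prod>i<r. t i powi w i) * ?s powi (l w)"
        using s by (simp add: l_def mult.assoc power_int_add[symmetric])
      also have "l w = int (nat d) * (l w div d)" using ld[OF w] d(1) by simp
      also have "?s powi \<dots> = t r powi (l w div d)"
        by (simp only: power_int_power[symmetric] root)
      also have "(\<Prod>i<r. t i powi w i) * t r powi (l w div d) = chi (Suc r) (\<Phi> w) t"
        by (simp add: chi_def \<Phi>_def)
      finally show ?thesis .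
    qed
    have \<phi>_nz: "\<phi> t \<in> nz (Suc r)" if "t \<in> nz (Suc r)" for t
      using that root_nz by (auto simp: nz_def \<phi>_def)
    have \<Phi>_supp: "\<Phi> w \<in> supp (Suc r)" if "w \<in> weights (Suc r) \<rho>1" for w
      using weights_supp[OF that] by (auto simp: supp_def \<Phi>_def)
    have toric: "toric (Suc r) (\<lambda>t. \<rho>1 (\<phi> t))"
      by (rule reparametrize(1)[OF \<rho>1 \<phi>_nz \<Phi>_supp chi])
    have W: "\<Phi> w \<in> weights (Suc r) (\<lambda>t. \<rho>1 (\<phi> t))" if "w \<in> weights (Suc r) \<rho>1" for w
      by (rule reparametrize(2)[OF \<rho>1 \<phi>_nz \<Phi>_supp chi that])
    have transport: "v(r := l v div d) \<in> wdiff (Suc r) (\<lambda>t. \<rho>1 (\<phi> t))" if v: "v \<in> wdiff (Suc r) \<rho>1" for v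
    proof -
      obtain w1 w2 where w: "v = w1 - w2" "w1 \<in> weights (Suc r) \<rho>1" "w2 \<in> weights (Suc r) \<rho>1"
        using v by (auto simp: wdiff_def)
      have "l v div d = l w1 div d - l w2 div d"
        using ld[OF w(2)] ld[OF w(3)] unfolding w(1) l_diff by (simp add: div_diff)
      then have "v(r := l v div d) = \<Phi> w1 - \<Phi> w2" by (auto simp: w(1) \<Phi>_def)
      then show ?thesis using W[OF w(2)] W[OF w(3)] unfolding wdiff_def by blast
    qed
    have "unit i \<in> wdiff (Suc r) (\<lambda>t. \<rho>1 (\<phi> t))" if i: "i < Suc r" for i
    proof (cases "i = r")
      case False
      let ?v = "unit i + (\<lambda>j. e i * unit r j)"
      have "(\<Sum>j<r. e j * ?v j) = (\<Sum>j<r. if j = i then e i else 0)"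
        by (rule sum.cong) (auto simp: fun_apply unit_def)
      then have "l ?v = 0" using i False by (simp add: l_def fun_apply unit_def)
      then have "?v(r := l ?v div d) = unit i" using i False by (auto simp: fun_apply unit_def)
      then show ?thesis using transport[OF e[of i]] i False by simp
    next
      case True
      obtain w where w: "w \<in> wdiff (Suc r) \<rho>1" "l w = d" using d(2) by (auto simp: H_def)
      \<comment> \<open>subtracting the lifts of the unit vectors leaves \<open>(0, \<dots>, 0, d)\<close>, which becomes the last
        unit vector\<close>
      let ?u = "\<Sum>i<r. (\<lambda>j. w i * (unit i + (\<lambda>j. e i * unit r j)) j)"
      have u: "?u \<in> wdiff (Suc r) \<rho>1" by (intro wdiff_sum[OF \<rho>1] wdiff_scale[OF \<rho>1] e) simp
      have lt: "?u j = w j" if "j < r" for j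
      proof -
        have "?u j = (\<Sum>i<r. if i = j then w j else 0)"
          unfolding fun_apply by (rule sum.cong) (use that in \<open>auto simp: unit_def\<close>)
        then show ?thesis using that by simp
      qed
      have ur: "?u r = (\<Sum>i<r. e i * w i)"
        unfolding fun_apply by (rule sum.cong) (auto simp: unit_def)
      have supp: "?u j = 0 \<and> w j = 0" if "j > r" for j
      proof -
        have "w j = 0" using wdiff_outside[OF w(1)] that by simp
        moreover have "?u j = 0" unfolding fun_apply by (rule sum.neutral) (use that in \<open>auto simp: unit_def\<close>)
        ultimately show ?thesis by simp
      qed
      have "l ?u = 0" using lt ur by (simp add: l_def)
      then have l: "l (w - ?u) = d" by (simp add: l_diff w(2))
      have "(w - ?u)(r := l (w - ?u) div d) = unit r"
      proof
        fix j
        consider "j < r" | "j = r" | "j > r" by linarith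
        then show "((w - ?u)(r := l (w - ?u) div d)) j = unit r j"
          by cases (use lt supp d(1) l in \<open>auto simp: unit_def\<close>)
      qed
      then show ?thesis using transport[OF wdiff_diff[OF w(1) u]] True by simp
    qed
    then have "frame (Suc r) (\<lambda>t. \<rho>1 (\<phi> t))" using toric by (simp add: frame_def)
    then show ?thesis by (rule extend)
  qed
qed

end

section \<open>The rank is bounded\<close>

text \<open>The independence bound of linear algebra is used for functions, as a vector space over the field.\<close>

interpretation fun_space: vector_space "\<lambda>(c::'k::field) (f::'x \<Rightarrow> 'k) x. c * f x"
  by unfold_locales (auto simp: fun_apply distrib_left distrib_right)

lemma le_if_power_growth:
  fixes r n d :: nat
  assumes "\<And>N. (N + 1) ^ r \<le> (r * N * d + 1) ^ n" shows "r \<le> n"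
proof (rule ccontr)
  assume "\<not> r \<le> n"
  define N where "N = (r * d + 1) ^ n"
  have "(N + 1) ^ Suc n \<le> (N + 1) ^ r"
    by (rule power_increasing) (use \<open>\<not> r \<le> n\<close> in auto)
  also have "\<dots> \<le> (r * N * d + 1) ^ n" by (rule assms)
  also have "\<dots> \<le> ((r * d + 1) * (N + 1)) ^ n" by (rule power_mono) (auto simp: algebra_simps)
  also have "\<dots> = N * (N + 1) ^ n" by (simp only: N_def power_mult_distrib)
  finally have "(N + 1) * (N + 1) ^ n \<le> N * (N + 1) ^ n" by simp
  then show False by (simp only: mult_le_cancel2) simp
qed

context affine_variety
begin

definition monomials :: "nat \<Rightarrow> ('k vec \<Rightarrow> 'k) set" where
  "monomials d = (\<lambda>e. cut (\<lambda>x. \<Prod>i<n. x $ i ^ e i)) ` ({..<n} \<rightarrow>\<^sub>E {..d})"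

text \<open>Regular functions that are given by polynomials of degree at most \<open>d\<close> in each variable.\<close>

definition bounded_degree :: "nat \<Rightarrow> ('k vec \<Rightarrow> 'k) set" where
  "bounded_degree d = fun_space.span (monomials d)"

lemma finite_monomials: "finite (monomials d)"
  unfolding monomials_def by (intro finite_imageI finite_PiE) auto

lemma card_monomials: "card (monomials d) \<le> (d + 1) ^ n"
proof -
  have "card (monomials d) \<le> card ({..<n} \<rightarrow>\<^sub>E {..d})"
    unfolding monomials_def by (intro card_image_le finite_PiE) auto
  then show ?thesis by (simp add: card_PiE)
qed

lemma monomial_mem:
  assumes "\<And>i. i < n \<Longrightarrow> e i \<le> d"
  shows "cut (\<lambda>x. \<Prod>i<n. x $ i ^ e i) \<in> monomials d"
proof -
  have "cut (\<lambda>x. \<Prod>i<n. x $ i ^ e i) = cut (\<lambda>x. \<Prod>i<n. x $ i ^ restrict e {..<n} i)"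
    by (rule arg_cong[where f = cut]) auto
  moreover have "restrict e {..<n} \<in> {..<n} \<rightarrow>\<^sub>E {..d}" using assms by auto
  ultimately show ?thesis unfolding monomials_def by blast
qed

lemma bounded_degree_mono: "d \<le> e \<Longrightarrow> bounded_degree d \<subseteq> bounded_degree e"
  unfolding bounded_degree_def monomials_def
  by (intro fun_space.span_mono image_mono PiE_mono) auto

lemma bounded_degree_add: "f \<in> bounded_degree d \<Longrightarrow> g \<in> bounded_degree d \<Longrightarrow> f + g \<in> bounded_degree d"
  unfolding bounded_degree_def by (rule fun_space.span_add)

lemma bounded_degree_const: "cut (\<lambda>_. c) \<in> bounded_degree d"
proof -
  have "cut (\<lambda>x. \<Prod>i<n. x $ i ^ 0) \<in> monomials d" by (rule monomial_mem) simp
  from fun_space.span_scale[OF fun_space.span_base[OF this], of c]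
  show ?thesis unfolding bounded_degree_def by (simp add: cut_def if_distrib cong: if_cong)
qed

lemma bounded_degree_crd: assumes i: "i < n" shows "crd i \<in> bounded_degree 1"
proof -
  have "(\<Prod>j<n. x $ j ^ (if j = i then 1 else 0)) = x $ i" for x :: "'k vec"
  proof -
    have "(\<Prod>j<n. x $ j ^ (if j = i then 1 else 0)) = (\<Prod>j<n. if j = i then x $ i else 1)"
      by (rule prod.cong) auto
    then show ?thesis using i by simp
  qed
  moreover have "cut (\<lambda>x. \<Prod>j<n. x $ j ^ (if j = i then 1 else 0)) \<in> monomials 1"
    by (rule monomial_mem) simp
  ultimately show ?thesis unfolding bounded_degree_def crd_def by (auto intro: fun_space.span_base)
qed

lemma bounded_degree_mult:
  assumes f: "f \<in> bounded_degree a" and g: "g \<in> bounded_degree b"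
  shows "f * g \<in> bounded_degree (a + b)"
proof -
  have sub1: "fun_space.subspace {f. f * g \<in> bounded_degree d}" for g :: "'k vec \<Rightarrow> 'k" and d
  proof (rule fun_space.subspaceI)
    show "0 \<in> {f. f * g \<in> bounded_degree d}"
      by (simp add: bounded_degree_def fun_space.span_zero)
    show "x + y \<in> {f. f * g \<in> bounded_degree d}"
      if "x \<in> {f. f * g \<in> bounded_degree d}" "y \<in> {f. f * g \<in> bounded_degree d}" for x y
      using that by (simp add: distrib_right bounded_degree_add)
    show "(\<lambda>z. c * x z) \<in> {f. f * g \<in> bounded_degree d}" if "x \<in> {f. f * g \<in> bounded_degree d}" for c x
    proof -
      have "(\<lambda>z. c * x z) * g = (\<lambda>z. c * (x * g) z)" by (auto simp: fun_apply mult.assoc)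
      then show ?thesis using that by (simp add: bounded_degree_def fun_space.span_scale)
    qed
  qed
  have mon: "f * g \<in> bounded_degree (a + b)" if fg: "f \<in> monomials a" "g \<in> monomials b" for f g
  proof -
    obtain d e where de: "d \<in> {..<n} \<rightarrow>\<^sub>E {..a}" "e \<in> {..<n} \<rightarrow>\<^sub>E {..b}"
      "f = cut (\<lambda>x. \<Prod>i<n. x $ i ^ d i)" "g = cut (\<lambda>x. \<Prod>i<n. x $ i ^ e i)"
      using fg by (auto simp: monomials_def)
    have "f * g = cut (\<lambda>x. \<Prod>i<n. x $ i ^ (d i + e i))"
      unfolding de(3,4) by (auto simp: cut_def fun_apply power_add prod.distrib)
    moreover have "d i + e i \<le> a + b" if "i < n" for i
      using de(1,2) that by (intro add_mono) (auto simp: PiE_def Pi_def)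
    ultimately show ?thesis
      unfolding bounded_degree_def using fun_space.span_base[OF monomial_mem] by simp
  qed
  have "f * g \<in> bounded_degree (a + b)" if g: "g \<in> monomials b" for g
    by (rule fun_space.span_induct[OF f[unfolded bounded_degree_def] sub1]) (rule mon[OF _ g])
  then have "g * f \<in> bounded_degree (a + b)"
    by (intro fun_space.span_induct[OF g[unfolded bounded_degree_def] sub1]) (simp add: mult.commute)
  then show ?thesis by (simp add: mult.commute)
qed

lemma A_bounded_degree: assumes "f \<in> A" shows "\<exists>d. f \<in> bounded_degree d"
  using assms
proof (induction rule: A_induct)
  case (const c) then show ?case using bounded_degree_const by blast
next
  case (coord i) then show ?case using bounded_degree_crd by blast
next
  case (add f g)
  then obtain a b where "f \<in> bounded_degree a" "g \<in> bounded_degree b" by blast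
  then have "f \<in> bounded_degree (max a b)" "g \<in> bounded_degree (max a b)"
    using bounded_degree_mono[of a "max a b"] bounded_degree_mono[of b "max a b"] by auto
  then show ?case using bounded_degree_add by blast
next
  case (mult f g) then show ?case using bounded_degree_mult by blast
qed

text \<open>Powers and products inside \<open>A\<close>, whose unit is the constant \<open>1\<close> on \<open>X\<close>.\<close>

lemma nonzero_bounded_degree_power:
  assumes "f \<in> A" "f \<noteq> 0" "f \<in> bounded_degree d"
  shows "cut (\<lambda>x. f x ^ k) \<in> A \<and> cut (\<lambda>x. f x ^ k) \<noteq> 0 \<and> cut (\<lambda>x. f x ^ k) \<in> bounded_degree (k * d)"
proof (induction k)
  case 0
  have "cut (\<lambda>_. 1) \<noteq> 0" using X_nonempty by (auto simp: cut_def zero_fun_def fun_eq_iff)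
  then show ?case by (simp add: A_const bounded_degree_const)
next
  case (Suc k)
  have "cut (\<lambda>x. f x ^ Suc k) = f * cut (\<lambda>x. f x ^ k)"
    using A_outside[OF assms(1)] by (auto simp: cut_def fun_apply)
  then show ?case
    using Suc assms A_mult A_domain bounded_degree_mult[of f d "cut (\<lambda>x. f x ^ k)" "k * d"] by auto
qed

lemma nonzero_bounded_degree_prod:
  assumes "finite I" "\<And>i. i \<in> I \<Longrightarrow> g i \<in> A \<and> g i \<noteq> 0 \<and> g i \<in> bounded_degree (d i)"
  shows "cut (\<lambda>x. \<Prod>i\<in>I. g i x) \<in> A \<and> cut (\<lambda>x. \<Prod>i\<in>I. g i x) \<noteq> 0 \<and>
    cut (\<lambda>x. \<Prod>i\<in>I. g i x) \<in> bounded_degree (\<Sum>i\<in>I. d i)"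
  using assms
proof (induction I rule: finite_induct)
  case empty
  have "cut (\<lambda>_. 1) \<noteq> 0" using X_nonempty by (auto simp: cut_def zero_fun_def fun_eq_iff)
  then show ?case by (simp add: A_const bounded_degree_const)
next
  case (insert i I)
  have "cut (\<lambda>x. \<Prod>j\<in>insert i I. g j x) = g i * cut (\<lambda>x. \<Prod>j\<in>I. g j x)"
    using A_outside[of "g i"] insert by (auto simp: cut_def fun_apply)
  moreover have "g i \<in> A" "g i \<noteq> 0" "g i \<in> bounded_degree (d i)" using insert.prems by auto
  moreover have "cut (\<lambda>x. \<Prod>j\<in>I. g j x) \<in> A \<and> cut (\<lambda>x. \<Prod>j\<in>I. g j x) \<noteq> 0 \<and>
      cut (\<lambda>x. \<Prod>j\<in>I. g j x) \<in> bounded_degree (\<Sum>j\<in>I. d j)"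
    by (rule insert.IH) (use insert.prems in auto)
  ultimately show ?case
    unfolding sum.insert[OF insert.hyps] using A_mult A_domain bounded_degree_mult by metis
qed

text \<open>Choose weight functions \<open>g\<close> of weight \<open>Q\<close> and \<open>h i\<close> of weight \<open>Q + unit i\<close>. For exponents \<open>k i \<le> N\<close>
the product of the powers \<open>h i ^ k i\<close> is padded with a power of \<open>g\<close> to exactly \<open>r N\<close> factors. Its
weight is \<open>r N Q + k\<close>, so that these \<open>(N + 1)\<^sup>r\<close> functions have distinct weights and are independent.
If all factors have degree at most \<open>d\<close>, they lie in a space of dimension at most
\<open>(r N d + 1)\<^sup>n\<close>. Comparing growth in \<open>N\<close> gives \<open>r \<le> n\<close>.\<close>

theorem frame_rank_le:
  assumes frame: "frame r \<rho>" shows "r \<le> n"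
proof -
  have \<rho>: "toric r \<rho>" using frame by (simp add: frame_def)
  have "\<exists>p q. p \<in> weights r \<rho> \<and> q \<in> weights r \<rho> \<and> unit i = p - q" if "i < r" for i
    using frame that unfolding frame_def wdiff_def by blast
  then obtain p q where pq: "\<And>i. i < r \<Longrightarrow> p i \<in> weights r \<rho>" "\<And>i. i < r \<Longrightarrow> q i \<in> weights r \<rho>"
    "\<And>i. i < r \<Longrightarrow> unit i = p i - q i" by metis
  \<comment> \<open>\<open>Q\<close> contains all negative parts \<open>q i\<close> of the unit vectors, so that adding \<open>unit i\<close> to it gives a
    weight again\<close>
  define Q where "Q = (\<Sum>i<r. q i)"
  have Q: "Q \<in> weights r \<rho>" unfolding Q_def by (rule weights_sum[OF \<rho>]) (use pq in auto)
  have QP: "Q + unit i \<in> weights r \<rho>" if i: "i < r" for i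
  proof -
    have "Q = q i + (\<Sum>j\<in>{..<r} - {i}. q j)" unfolding Q_def using i by (subst sum.remove[of _ i]) auto
    then have "Q + unit i = p i + (\<Sum>j\<in>{..<r} - {i}. q j)" using pq(3)[OF i] by simp
    moreover have "(\<Sum>j\<in>{..<r} - {i}. q j) \<in> weights r \<rho>" by (rule weights_sum[OF \<rho>]) (use pq in auto)
    ultimately show ?thesis using weights_add pq(1)[OF i] by simp
  qed
  obtain g where g: "g \<in> mwt r \<rho> Q" "g \<noteq> 0" using Q by (auto simp: weights_def)
  have "\<exists>h. h \<in> mwt r \<rho> (Q + unit i) \<and> h \<noteq> 0" if "i < r" for i using QP[OF that] by (auto simp: weights_def)
  then obtain h where h: "\<And>i. i < r \<Longrightarrow> h i \<in> mwt r \<rho> (Q + unit i)" "\<And>i. i < r \<Longrightarrow> h i \<noteq> 0" by metis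
  obtain d0 where d0: "g \<in> bounded_degree d0" using A_bounded_degree[OF mwt_A[OF g(1)]] by blast
  have "\<exists>d. h i \<in> bounded_degree d" if "i < r" for i using A_bounded_degree[OF mwt_A[OF h(1)[OF that]]] .
  then obtain d' where d': "\<And>i. i < r \<Longrightarrow> h i \<in> bounded_degree (d' i)" by metis
  define d where "d = d0 + (\<Sum>i<r. d' i)"
  have "d' i \<le> d" if "i < r" for i
  proof -
    have "d' i \<le> (\<Sum>i<r. d' i)" by (rule member_le_sum) (use that in auto)
    then show ?thesis by (simp add: d_def)
  qed
  then have hd: "h i \<in> bounded_degree d" if "i < r" for i using d'[OF that] bounded_degree_mono that by blast
  have gd: "g \<in> bounded_degree d" using d0 bounded_degree_mono[of d0 d] by (auto simp: d_def)
  show ?thesis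
  proof (rule le_if_power_growth[of r d])
    fix N :: nat
    define I where "I = {..<r} \<rightarrow>\<^sub>E {..N}"
    define m where "m = (\<lambda>k. r * N - (\<Sum>i<r. k i))"
    define u where "u = (\<lambda>k i. if i < r then cut (\<lambda>x. h i x ^ k i) else cut (\<lambda>x. g x ^ m k))"
    define f where "f = (\<lambda>k. cut (\<lambda>x. \<Prod>i<Suc r. u k i x))"
    define X' where "X' = (\<lambda>(k :: nat \<Rightarrow> nat) (t :: nat \<Rightarrow> 'k). chi r Q t ^ (r * N) * (\<Prod>i<r. t i ^ k i))"
    have m: "(\<Sum>i<r. k i) + m k = r * N" if "k \<in> I" for k
    proof -
      have "(\<Sum>i<r. k i) \<le> (\<Sum>i<r. N)" by (rule sum_mono) (use that in \<open>auto simp: I_def PiE_def Pi_def\<close>)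
      then show ?thesis by (simp add: m_def)
    qed
    have f: "f k \<in> A \<and> f k \<noteq> 0 \<and> f k \<in> bounded_degree (r * N * d)" if "k \<in> I" for k
    proof -
      have "f k \<in> A \<and> f k \<noteq> 0 \<and>
          f k \<in> bounded_degree (\<Sum>i<Suc r. if i < r then k i * d else m k * d)"
        unfolding f_def
      proof (rule nonzero_bounded_degree_prod)
        fix i
        show "u k i \<in> A \<and> u k i \<noteq> 0 \<and> u k i \<in> bounded_degree (if i < r then k i * d else m k * d)"
          unfolding u_def
          using nonzero_bounded_degree_power[OF mwt_A[OF g(1)] g(2) gd]
            nonzero_bounded_degree_power[OF mwt_A[OF h(1)] h(2) hd] by auto
      qed simp
      moreover have "(\<Sum>i<Suc r. if i < r then k i * d else m k * d) = r * N * d"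
        using m[OF that] by (simp add: sum_distrib_right[symmetric] distrib_right[symmetric])
      ultimately show ?thesis by simp
    qed
    have chi_unit: "chi r (Q + unit i) t = chi r Q t * t i" if "t \<in> nz r" "i < r" for t :: "nat \<Rightarrow> 'k" and i
    proof -
      have "chi r (unit i) t = (\<Prod>j<r. if j = i then t i else 1)"
        unfolding chi_def unit_def by (rule prod.cong) auto
      then show ?thesis using that by (simp add: chi_add)
    qed
    have eigen: "f k (\<rho> t x) = X' k t * f k x" if k: "k \<in> I" and t: "t \<in> nz r" and x: "x \<in> X" for k t x
    proof -
      have "f k (\<rho> t x) = (\<Prod>i<r. (chi r Q t * t i * h i x) ^ k i) * (chi r Q t * g x) ^ m k"
        using toric_X[OF \<rho> t x] by (simp add: f_def u_def mwt_apply[OF h(1) t x] mwt_apply[OF g(1) t x] chi_unit[OF t])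
      also have "\<dots> = chi r Q t ^ ((\<Sum>i<r. k i) + m k) * (\<Prod>i<r. t i ^ k i) * ((\<Prod>i<r. h i x ^ k i) * g x ^ m k)"
        by (simp add: power_mult_distrib prod.distrib power_add power_sum mult_ac)
      also have "\<dots> = X' k t * f k x" using x by (simp add: m[OF k] X'_def f_def u_def)
      finally show ?thesis .
    qed
    have distinct: "\<exists>t\<in>nz r. X' k t \<noteq> X' l t" if kl: "k \<in> I" "l \<in> I" "k \<noteq> l" for k l
    proof -
      obtain i where i: "i < r" "k i \<noteq> l i"
        using kl PiE_ext[of k "{..<r}" "\<lambda>_. {..N}" l] unfolding I_def by blast
      let ?t = "\<lambda>j. if j = i then 2 else 1 :: 'k"
      have t: "?t \<in> nz r" by (auto simp: nz_def)
      have prod: "(\<Prod>j<r. ?t j ^ e j) = 2 ^ e i" for e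
      proof -
        have "(\<Prod>j<r. ?t j ^ e j) = (\<Prod>j<r. if j = i then 2 ^ e i else 1)" by (rule prod.cong) auto
        then show ?thesis using i by simp
      qed
      have "(2::'k) ^ k i \<noteq> 2 ^ l i" using two_powi_inject[where 'k = 'k, of "int (k i)" "int (l i)"] i by auto
      then have "X' k ?t \<noteq> X' l ?t" using chi_nonzero[OF t, of Q] by (simp add: X'_def prod)
      then show ?thesis using t by blast
    qed
    have indep: "c k = 0" if F: "F \<subseteq> I" and sum: "(\<Sum>k\<in>F. (\<lambda>x. c k * f k x)) = 0" and k: "k \<in> F" for F c k
    proof -
      have finI: "finite I" unfolding I_def by (rule finite_PiE) auto
      have "c k * f k x = 0" if x: "x \<in> X" for x
      proof (rule eigenfunctions_independent[where F = F and f = "\<lambda>k x. c k * f k x" and G = "nz r" and Y = X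
            and a = \<rho> and chi = X'])
        show "finite F" using F finI finite_subset by blast
        show "(\<Sum>k\<in>F. c k * f k y) = 0" if "y \<in> X" for y using fun_cong[OF sum, of y] by (simp add: fun_apply)
      qed (use F k x toric_X[OF \<rho>] eigen distinct in \<open>auto simp: subset_iff\<close>)
      moreover obtain x where "f k x \<noteq> 0" using f[of k] F k by (auto simp: zero_fun_def fun_eq_iff)
      moreover have "x \<in> X" using A_outside f[of k] F k \<open>f k x \<noteq> 0\<close> by blast
      ultimately show ?thesis by auto
    qed
    have inj: "inj_on f I"
    proof (rule inj_onI, rule ccontr)
      fix k l assume kl: "k \<in> I" "l \<in> I" "f k = f l" "k \<noteq> l"
      have "(\<Sum>j\<in>{k, l}. (\<lambda>x. (if j = k then 1 else -1) * f j x)) = 0"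
        using kl by (auto simp: fun_apply zero_fun_def plus_fun_def)
      from indep[OF _ this, of k] show False using kl by simp
    qed
    have "fun_space.independent (f ` I)"
      unfolding fun_space.independent_explicit_finite_subsets
    proof (intro allI impI ballI)
      fix S c v assume S: "S \<subseteq> f ` I" "finite S" and sum: "(\<Sum>v\<in>S. (\<lambda>x. c v * v x)) = 0" and v: "v \<in> S"
      obtain F where F: "F \<subseteq> I" "S = f ` F" using S(1) by (auto simp: subset_image_iff)
      have injF: "inj_on f F" using inj F(1) inj_on_subset by blast
      obtain k where k: "k \<in> F" "v = f k" using v F(2) by blast
      have "(\<Sum>k\<in>F. (\<lambda>x. c (f k) * f k x)) = 0"
        using sum unfolding F(2) sum.reindex[OF injF] by (simp add: comp_def)
      from indep[OF F(1) this k(1)] show "c v = 0" using k(2) by simp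
    qed
    moreover have "f ` I \<subseteq> fun_space.span (monomials (r * N * d))"
      using f unfolding bounded_degree_def by blast
    ultimately have "card (f ` I) \<le> card (monomials (r * N * d))"
      using fun_space.independent_span_bound[OF finite_monomials] by blast
    also have "\<dots> \<le> (r * N * d + 1) ^ n" by (rule card_monomials)
    also have "card (f ` I) = (N + 1) ^ r" unfolding card_image[OF inj] by (simp add: I_def card_PiE)
    finally show "(N + 1) ^ r \<le> (r * N * d + 1) ^ n" .
  qed
qed

end

section \<open>The automorphism group and the torus\<close>

lemma morphism_cong:
  "morphism n X m Y f \<Longrightarrow> (\<And>x. x \<in> X \<Longrightarrow> f x = g x) \<Longrightarrow> morphism n X m Y g"
  unfolding morphism_def by (auto intro: regular_fun_cong simp: Pi_def)

lemma morphism_compose: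
  assumes f: "morphism n X m Y f" and g: "morphism m Y l Z g" shows "morphism n X l Z (\<lambda>x. g (f x))"
proof -
  have Y: "f x \<in> Y" if "x \<in> X" for x using f that by (auto simp: morphism_def)
  have "regular_fun n X (\<lambda>x. g (f x) $ i)" if "i < l" for i
    by (rule regular_fun_comp[where Y = Y and m = m]) (use f g that Y in \<open>auto simp: morphism_def\<close>)
  then show ?thesis using g Y by (auto simp: morphism_def)
qed

lemma AutI:
  assumes "f \<in> extensional X" and f: "morphism n X n X f" and g: "morphism n X n X g"
    and gf: "\<And>x. x \<in> X \<Longrightarrow> g (f x) = x" and fg: "\<And>x. x \<in> X \<Longrightarrow> f (g x) = x"
  shows "f \<in> carrier (Aut n X)"
proof -
  have mem: "f x \<in> X" "g x \<in> X" if "x \<in> X" for x using f g that by (auto simp: morphism_def)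
  have bij: "bij_betw f X X" by (rule bij_betw_byWitness[where f' = g]) (use mem gf fg in auto)
  have "g x = inv_into X f x" if "x \<in> X" for x
    using inv_into_f_eq[of f X "g x" x] bij mem that fg by (auto simp: bij_betw_def)
  then have "morphism n X n X (inv_into X f)" by (rule morphism_cong[OF g])
  then show ?thesis using assms bij by (simp add: Aut_def Bij_def)
qed

lemma AutD:
  assumes "f \<in> carrier (Aut n X)"
  shows "f \<in> extensional X" "morphism n X n X f" "morphism n X n X (inv_into X f)" "f \<in> Bij X"
    "\<And>x. x \<in> X \<Longrightarrow> inv_into X f (f x) = x" "\<And>x. x \<in> X \<Longrightarrow> f (inv_into X f x) = x"
    "\<And>x. x \<in> X \<Longrightarrow> f x \<in> X" "\<And>x. x \<in> X \<Longrightarrow> inv_into X f x \<in> X"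
  using assms
  by (auto simp: Aut_def Bij_def morphism_def bij_betw_inv_into_left bij_betw_inv_into_right)

lemma Aut_mult: "f \<in> carrier (Aut n X) \<Longrightarrow> g \<in> carrier (Aut n X) \<Longrightarrow> f \<otimes>\<^bsub>Aut n X\<^esub> g = compose X f g"
  using AutD(4)[of f n X] AutD(4)[of g n X] by (simp add: Aut_def BijGroup_def)

lemma Aut_eq: "Aut n X = (BijGroup X)\<lparr>carrier := carrier (Aut n X)\<rparr>"
  by (simp add: Aut_def)

lemma inverse_in_Aut:
  assumes "f \<in> carrier (Aut n X)" shows "restrict (inv_into X f) X \<in> carrier (Aut n X)"
  by (rule AutI[where g = f]) (use AutD[OF assms] in \<open>auto intro: morphism_cong\<close>)

lemma subgroup_Aut: "subgroup (carrier (Aut n X)) (BijGroup X)"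
proof (rule group.subgroupI[OF group_BijGroup])
  show "carrier (Aut n X) \<subseteq> carrier (BijGroup X)" by (auto simp: Aut_def BijGroup_def)
  show "carrier (Aut n X) \<noteq> {}"
  proof -
    have id: "morphism n X n X (\<lambda>x. x)" by (auto simp: morphism_def regular_fun_coord)
    have "(\<lambda>x\<in>X. x) \<in> carrier (Aut n X)"
      by (rule AutI[OF _ morphism_cong[OF id] id]) auto
    then show ?thesis by blast
  qed
  show "inv\<^bsub>BijGroup X\<^esub> f \<in> carrier (Aut n X)" if "f \<in> carrier (Aut n X)" for f
    using inverse_in_Aut[OF that] inv_BijGroup[OF AutD(4)[OF that]] by simp
  show "f \<otimes>\<^bsub>BijGroup X\<^esub> g \<in> carrier (Aut n X)" if f: "f \<in> carrier (Aut n X)" and g: "g \<in> carrier (Aut n X)" for f g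
  proof -
    note F = AutD[OF f] and G = AutD[OF g]
    have "compose X f g \<in> carrier (Aut n X)"
    proof (rule AutI[where g = "\<lambda>x. inv_into X g (inv_into X f x)"])
      show "morphism n X n X (compose X f g)"
        by (rule morphism_cong[OF morphism_compose[OF G(2) F(2)]]) (simp add: compose_def)
      show "morphism n X n X (\<lambda>x. inv_into X g (inv_into X f x))"
        by (rule morphism_compose[OF F(3) G(3)])
    qed (use F G in \<open>auto simp: compose_def\<close>)
    then show ?thesis using F(4) G(4) by (simp add: BijGroup_def)
  qed
qed

lemma group_Aut: "group (Aut n X)"
  using subgroup.subgroup_is_group[OF subgroup_Aut group_BijGroup] Aut_eq by metis

lemma Aut_inv:
  assumes "f \<in> carrier (Aut n X)" shows "inv\<^bsub>Aut n X\<^esub> f = restrict (inv_into X f) X"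
proof -
  have "inv\<^bsub>Aut n X\<^esub> f = inv\<^bsub>BijGroup X\<^esub> f"
    using group.m_inv_consistent[OF group_BijGroup subgroup_Aut assms] Aut_eq by metis
  then show ?thesis using inv_BijGroup[OF AutD(4)[OF assms]] by simp
qed

lemma torus_mem: "v \<in> carrier (torus r) \<longleftrightarrow> v \<in> carrier_vec (r + r) \<and> (\<forall>i<r. v $ i * v $ (r + i) = 1)"
  by (simp add: torus_def)

lemma torus_carrier: "carrier (torus r) \<subseteq> carrier_vec (r + r)"
  by (auto simp: torus_mem)

lemma torus_nonzero: "v \<in> carrier (torus r) \<Longrightarrow> i < r \<Longrightarrow> v $ i \<noteq> (0::'k::field)"
  by (metis mult_zero_left torus_mem zero_neq_one)

lemma torus_inverse_coord:
  "v \<in> carrier (torus r) \<Longrightarrow> i < r \<Longrightarrow> v $ (r + i) = inverse (v $ i :: 'k::field)"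
  by (metis inverse_unique torus_mem)

lemma torus_eqI:
  assumes "v \<in> carrier (torus r)" "w \<in> carrier (torus r)" "\<And>i. i < r \<Longrightarrow> v $ i = (w $ i :: 'k::field)"
  shows "v = w"
proof (rule eq_vecI)
  have dim: "dim_vec v = r + r" "dim_vec w = r + r" using assms by (auto simp: torus_mem)
  then show "dim_vec v = dim_vec w" by simp
  fix i assume "i < dim_vec w"
  then consider "i < r" | j where "i = r + j" "j < r" using dim by (metis le_Suc_ex nat_add_left_cancel_less not_less)
  then show "v $ i = w $ i"
    by cases (use assms torus_inverse_coord[OF assms(1)] torus_inverse_coord[OF assms(2)] in auto)
qed

definition torus_vec :: "nat \<Rightarrow> (nat \<Rightarrow> 'k::field) \<Rightarrow> 'k vec" where
  "torus_vec r t = vec (r + r) (\<lambda>i. if i < r then t i else inverse (t (i - r)))"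

lemma torus_vec_mem: "t \<in> nz r \<Longrightarrow> torus_vec r t \<in> carrier (torus r)"
  by (auto simp: torus_mem torus_vec_def nz_def)

lemma torus_vec_apply: "i < r \<Longrightarrow> torus_vec r t $ i = t i"
  by (simp add: torus_vec_def)

lemma torus_coords_nz: "v \<in> carrier (torus r) \<Longrightarrow> (\<lambda>i. v $ i) \<in> nz r"
  by (auto simp: nz_def torus_nonzero)

lemma torus_mult_apply:
  "i < r + r \<Longrightarrow> (v \<otimes>\<^bsub>torus r\<^esub> w) $ i = v $ i * w $ i"
  by (simp add: torus_def)

lemma torus_mult_mem:
  assumes "v \<in> carrier (torus r)" "w \<in> carrier (torus r :: 'k::field vec monoid)" shows "v \<otimes>\<^bsub>torus r\<^esub> w \<in> carrier (torus r)"
proof -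
  have "v $ i * w $ i * (v $ (r + i) * w $ (r + i)) = 1" if "i < r" for i
  proof -
    have "v $ i * w $ i * (v $ (r + i) * w $ (r + i)) = (v $ i * v $ (r + i)) * (w $ i * w $ (r + i))"
      by (simp only: mult_ac)
    also have "\<dots> = 1 * 1"
      by (rule arg_cong2[where f = "(*)"]) (use assms that in \<open>auto simp: torus_mem\<close>)
    finally show ?thesis by simp
  qed
  then show ?thesis by (simp add: torus_def)
qed

lemma torus_one_apply: "i < r + r \<Longrightarrow> \<one>\<^bsub>torus r\<^esub> $ i = 1"
  by (simp add: torus_def)

lemma torus_one_mem: "\<one>\<^bsub>torus r\<^esub> \<in> carrier (torus r)"
  by (simp add: torus_def)

lemma torus_inverse:
  assumes v: "v \<in> carrier (torus r)"
  shows "torus_vec r (\<lambda>i. v $ (r + i)) \<in> carrier (torus r)"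
    "torus_vec r (\<lambda>i. v $ (r + i)) \<otimes>\<^bsub>torus r\<^esub> v = (\<one>\<^bsub>torus r\<^esub> :: 'k::field vec)"
proof -
  show m: "torus_vec r (\<lambda>i. v $ (r + i)) \<in> carrier (torus r)"
    by (rule torus_vec_mem) (use torus_inverse_coord[OF v] torus_nonzero[OF v] in \<open>auto simp: nz_def\<close>)
  show "torus_vec r (\<lambda>i. v $ (r + i)) \<otimes>\<^bsub>torus r\<^esub> v = \<one>\<^bsub>torus r\<^esub>"
    by (rule torus_eqI[OF torus_mult_mem[OF m v] torus_one_mem])
      (use torus_inverse_coord[OF v] torus_nonzero[OF v] in
        \<open>simp add: torus_mult_apply torus_one_apply torus_vec_apply\<close>)
qed

lemma group_torus: "group (torus r :: 'k::field vec monoid)"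
proof (rule groupI)
  fix u v w :: "'k vec" assume u: "u \<in> carrier (torus r)" and v: "v \<in> carrier (torus r)" and w: "w \<in> carrier (torus r)"
  show "u \<otimes>\<^bsub>torus r\<^esub> v \<otimes>\<^bsub>torus r\<^esub> w = u \<otimes>\<^bsub>torus r\<^esub> (v \<otimes>\<^bsub>torus r\<^esub> w)"
    by (rule torus_eqI) (use u v w in \<open>auto intro!: torus_mult_mem simp: torus_mult_apply\<close>)
next
  fix v :: "'k vec" assume v: "v \<in> carrier (torus r)"
  show "\<one>\<^bsub>torus r\<^esub> \<otimes>\<^bsub>torus r\<^esub> v = v"
    by (rule torus_eqI) (use v in \<open>auto intro!: torus_mult_mem torus_one_mem simp: torus_mult_apply torus_one_apply\<close>)
  show "\<exists>w\<in>carrier (torus r). w \<otimes>\<^bsub>torus r\<^esub> v = \<one>\<^bsub>torus r\<^esub>"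
    using torus_inverse[OF v] by blast
qed (auto intro: torus_mult_mem torus_one_mem)

lemma torus_inv:
  assumes v: "v \<in> carrier (torus r)"
  shows "inv\<^bsub>torus r\<^esub> v = torus_vec r (\<lambda>i. v $ (r + i) :: 'k::field)"
  by (rule group.inv_equality[OF group_torus torus_inverse(2)[OF v] v torus_inverse(1)[OF v]])

lemma zariski_closed_torus: "zariski_closed (r + r) (carrier (torus r :: 'k::field vec monoid))"
proof -
  define P where "P = {(\<lambda>v :: 'k vec. v $ i * v $ (r + i) + - 1) | i. i < r}"
  have "P \<subseteq> polynomial_funs (r + r)"
  proof
    fix p assume "p \<in> P"
    then obtain i where i: "i < r" and p: "p = (\<lambda>v. v $ i * v $ (r + i) + - 1)" unfolding P_def by blast
    show "p \<in> polynomial_funs (r + r)"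
      unfolding p by (intro polynomial_funs.add polynomial_funs.mult polynomial_funs.coord polynomial_funs.const)
        (use i in auto)
  qed
  moreover have "carrier (torus r) = {v \<in> carrier_vec (r + r). \<forall>p\<in>P. p v = (0::'k)}"
    unfolding torus_mem[unfolded set_eq_iff] P_def by (fastforce simp: torus_def)
  ultimately show ?thesis unfolding zariski_closed_def by blast
qed

lemma affine_algebraic_group_torus: "affine_algebraic_group (r + r) (torus r :: 'k::field vec monoid)"
  unfolding affine_algebraic_group_def
proof (intro conjI group_torus zariski_closed_torus)
  let ?T = "carrier (torus r :: 'k vec monoid)"
  let ?Y = "product_variety ?T ?T"
  have Y: "vec_first v (r + r) \<in> ?T \<and> vec_last v (r + r) \<in> ?T \<and> dim_vec v = (r + r) + (r + r)"
    if "v \<in> ?Y" for v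
    using that by (auto simp: product_variety_def torus_mem vec_first_last_append_vec)
  show "morphism ((r + r) + (r + r)) ?Y (r + r) ?T (\<lambda>v. vec_first v (r + r) \<otimes>\<^bsub>torus r\<^esub> vec_last v (r + r))"
    unfolding morphism_def
  proof (intro conjI allI impI)
    show "(\<lambda>v. vec_first v (r + r) \<otimes>\<^bsub>torus r\<^esub> vec_last v (r + r)) \<in> ?Y \<rightarrow> ?T"
      using Y torus_mult_mem by auto
    fix i assume i: "i < r + r"
    show "regular_fun ((r + r) + (r + r)) ?Y (\<lambda>v. (vec_first v (r + r) \<otimes>\<^bsub>torus r\<^esub> vec_last v (r + r)) $ i)"
    proof (rule regular_fun_cong)
      show "regular_fun ((r + r) + (r + r)) ?Y (\<lambda>v. v $ i * v $ ((r + r) + i))"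
        by (intro regular_fun_mult regular_fun_coord) (use i in auto)
      show "v $ i * v $ ((r + r) + i) = (vec_first v (r + r) \<otimes>\<^bsub>torus r\<^esub> vec_last v (r + r)) $ i" if "v \<in> ?Y" for v
        unfolding torus_mult_apply[OF i] using Y[OF that] i by (simp add: vec_first_def vec_last_def)
    qed
  qed
  show "morphism (r + r) ?T (r + r) ?T (\<lambda>g. inv\<^bsub>torus r\<^esub> g)"
    unfolding morphism_def
  proof (intro conjI allI impI)
    show "(\<lambda>g. inv\<^bsub>torus r\<^esub> g) \<in> ?T \<rightarrow> ?T" using group.inv_closed[OF group_torus] by auto
    fix i assume i: "i < r + r"
    show "regular_fun (r + r) ?T (\<lambda>g. (inv\<^bsub>torus r\<^esub> g) $ i)"
    proof (rule regular_fun_cong)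
      show "regular_fun (r + r) ?T (\<lambda>g. g $ (if i < r then r + i else i - r))"
        by (intro regular_fun_coord) (use i in auto)
      show "g $ (if i < r then r + i else i - r) = (inv\<^bsub>torus r\<^esub> g) $ i" if g: "g \<in> ?T" for g
      proof (cases "i < r")
        case True
        then show ?thesis unfolding torus_inv[OF g] using i by (simp add: torus_vec_def)
      next
        case False
        then have "r + (i - r) = i" "i - r < r" using i by auto
        then show ?thesis
          unfolding torus_inv[OF g] using i False torus_inverse_coord[OF g, of "i - r"] by (simp add: torus_vec_def)
      qed
    qed
  qed
qed

lemma torus_iso_refl: "algebraic_group_iso m (torus r) m (torus r) (\<lambda>x. x)" if "m = r + r"
proof -
  have id: "morphism m (carrier (torus r)) m (carrier (torus r)) (\<lambda>x. x)"
    by (auto simp: morphism_def regular_fun_coord)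
  have "morphism m (carrier (torus r)) m (carrier (torus r)) (inv_into (carrier (torus r)) (\<lambda>x. x))"
    by (rule morphism_cong[OF id]) (simp add: inv_into_f_eq)
  then show ?thesis using id by (auto simp: algebraic_group_iso_def iso_def hom_def bij_betw_def inj_on_def)
qed

section \<open>Frames are subtori\<close>

context affine_variety
begin

text \<open>Negative exponents are taken care of by the coordinates \<open>v $ (r + i)\<close>, the inverses of \<open>v $ i\<close>.\<close>

lemma chi_regular:
  "regular_fun (r + r) (carrier (torus r)) (\<lambda>v. chi r w (\<lambda>i. v $ i) :: 'k)"
proof (rule regular_fun_cong)
  show "regular_fun (r + r) (carrier (torus r))
      (\<lambda>v. \<Prod>i<r. if w i \<ge> 0 then v $ i ^ nat (w i) else v $ (r + i) ^ nat (- w i) :: 'k)"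
  proof (intro regular_fun_prod)
    fix i assume i: "i \<in> {..<r}"
    show "regular_fun (r + r) (carrier (torus r))
        (\<lambda>v. if w i \<ge> 0 then v $ i ^ nat (w i) else v $ (r + i) ^ nat (- w i) :: 'k)"
      using i by (cases "w i \<ge> 0") (auto intro!: regular_fun_power regular_fun_coord)
  qed
  fix v :: "'k vec" assume v: "v \<in> carrier (torus r)"
  show "(\<Prod>i<r. if w i \<ge> 0 then v $ i ^ nat (w i) else v $ (r + i) ^ nat (- w i)) = chi r w (\<lambda>i. v $ i)"
    unfolding chi_def
  proof (rule prod.cong[OF refl])
    fix i assume i: "i \<in> {..<r}"
    have "v $ i powi w i = inverse (v $ i) ^ nat (- w i)" if "w i < 0"
      using that power_int_minus[of "v $ i" "- w i"] by (simp add: power_int_nonneg_exp power_inverse)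
    then show "(if w i \<ge> 0 then v $ i ^ nat (w i) else v $ (r + i) ^ nat (- w i)) = v $ i powi w i"
      using torus_inverse_coord[OF v, of i] i by (auto simp: power_int_nonneg_exp)
  qed
qed

text \<open>Decompose \<open>f\<close> into weight functions: on each of them the action is multiplication by a character.\<close>

lemma toric_coordinate_regular:
  assumes \<rho>: "toric r \<rho>" and f: "f \<in> A"
  shows "regular_fun ((r + r) + n) (product_variety (carrier (torus r)) X)
    (\<lambda>v. f (\<rho> (\<lambda>i. vec_first v (r + r) $ i) (vec_last v n)))"
proof -
  let ?Y = "product_variety (carrier (torus r)) X"
  obtain F c where F: "finite F" "F \<subseteq> supp r" "\<And>w. w \<in> F \<Longrightarrow> c w \<in> mwt r \<rho> w" "f = (\<Sum>w\<in>F. c w)"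
    using toric_decompose[OF \<rho> f]
    by (elim exE conjE) (rule that, assumption, assumption, erule bspec, assumption+)
  have Y: "vec_first v (r + r) \<in> carrier (torus r) \<and> vec_last v n \<in> X" if "v \<in> ?Y" for v
    using product_variety_parts[OF that torus_carrier] .
  have "regular_fun ((r + r) + n) ?Y (\<lambda>v. \<Sum>w\<in>F. chi r w (\<lambda>i. vec_first v (r + r) $ i) * c w (vec_last v n))"
  proof (intro regular_fun_sum regular_fun_mult)
    fix w assume w: "w \<in> F"
    show "regular_fun ((r + r) + n) ?Y (\<lambda>v. c w (vec_last v n))"
      by (rule regular_fun_vec_last[OF mwt_A[OF F(3)[OF w]]]) (auto simp: torus_mem)
    show "regular_fun ((r + r) + n) ?Y (\<lambda>v. chi r w (\<lambda>i. vec_first v (r + r) $ i))"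
    proof (rule regular_fun_comp[OF chi_regular])
      fix i assume i: "i < r + r"
      show "regular_fun ((r + r) + n) ?Y (\<lambda>v. vec_first v (r + r) $ i)"
        by (rule regular_fun_cong[OF regular_fun_coord[of i]]) (use i in \<open>auto simp: vec_first_def\<close>)
    qed (use Y in blast)
  qed
  then show ?thesis
  proof (rule regular_fun_cong)
    fix v assume v: "v \<in> ?Y"
    show "(\<Sum>w\<in>F. chi r w (\<lambda>i. vec_first v (r + r) $ i) * c w (vec_last v n))
        = f (\<rho> (\<lambda>i. vec_first v (r + r) $ i) (vec_last v n))"
      unfolding F(4) fun_apply
      using mwt_apply[OF F(3) torus_coords_nz[OF conjunct1[OF Y[OF v]]] conjunct2[OF Y[OF v]]]
      by (intro sum.cong[OF refl]) simp
  qed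
qed

lemma toric_morphism:
  assumes \<rho>: "toric r \<rho>" and t: "t \<in> nz r" shows "morphism n X n X (\<rho> t)"
  unfolding morphism_def
proof (intro conjI allI impI)
  show "\<rho> t \<in> X \<rightarrow> X" using toric_X[OF \<rho> t] by auto
  fix j assume j: "j < n"
  obtain F c where F: "finite F" "F \<subseteq> supp r" "\<And>w. w \<in> F \<Longrightarrow> c w \<in> mwt r \<rho> w" "crd j = (\<Sum>w\<in>F. c w)"
    using toric_decompose[OF \<rho> crd_A[OF j]]
    by (elim exE conjE) (rule that, assumption, assumption, erule bspec, assumption+)
  have "regular_fun n X (\<lambda>x. \<Sum>w\<in>F. chi r w t * c w x)"
    by (intro regular_fun_sum regular_fun_mult regular_fun_const A_regular mwt_A[OF F(3)])
  then show "regular_fun n X (\<lambda>x. \<rho> t x $ j)"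
  proof (rule regular_fun_cong)
    fix x assume x: "x \<in> X"
    have "(\<Sum>w\<in>F. chi r w t * c w x) = crd j (\<rho> t x)"
      unfolding F(4) fun_apply by (rule sum.cong[OF refl]) (simp add: mwt_apply[OF F(3) t x])
    then show "(\<Sum>w\<in>F. chi r w t * c w x) = \<rho> t x $ j" using toric_X[OF \<rho> t x] by simp
  qed
qed

definition toric_group :: "nat \<Rightarrow> ((nat \<Rightarrow> 'k) \<Rightarrow> 'k vec \<Rightarrow> 'k vec) \<Rightarrow> ('k vec \<Rightarrow> 'k vec) set" where
  "toric_group r \<rho> = (\<lambda>t. restrict (\<rho> t) X) ` nz r"

lemma toric_Aut:
  assumes \<rho>: "toric r \<rho>" and t: "t \<in> nz r" shows "restrict (\<rho> t) X \<in> carrier (Aut n X)"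
proof (rule AutI)
  have t': "(\<lambda>i. inverse (t i)) \<in> nz r" using t by (auto simp: nz_def)
  have inv: "\<rho> (\<lambda>i. inverse (t i)) (\<rho> t x) = x \<and> \<rho> t (\<rho> (\<lambda>i. inverse (t i)) x) = x" if x: "x \<in> X" for x
  proof -
    have 1: "(\<lambda>_. 1) \<in> nz r" by (auto simp: nz_def)
    have "\<rho> (\<lambda>_. 1) x = \<rho> (\<lambda>i. inverse (t i) * t i) x" "\<rho> (\<lambda>_. 1) x = \<rho> (\<lambda>i. t i * inverse (t i)) x"
      by (rule toric_cong[OF \<rho> 1 _ x]; use t in \<open>auto simp: nz_def\<close>)+
    then show ?thesis using toric_mult[OF \<rho> t' t x] toric_mult[OF \<rho> t t' x] toric_one[OF \<rho> x] by simp
  qed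
  show "morphism n X n X (restrict (\<rho> t) X)" by (rule morphism_cong[OF toric_morphism[OF \<rho> t]]) simp
  show "morphism n X n X (\<rho> (\<lambda>i. inverse (t i)))" by (rule toric_morphism[OF \<rho> t'])
  show "\<rho> (\<lambda>i. inverse (t i)) (restrict (\<rho> t) X x) = x" if "x \<in> X" for x using inv[OF that] that by simp
  show "restrict (\<rho> t) X (\<rho> (\<lambda>i. inverse (t i)) x) = x" if "x \<in> X" for x
    using inv[OF that] toric_X[OF \<rho> t' that] by simp
qed simp

text \<open>The coordinate \<open>t i\<close> is the quotient of the characters of two weights with difference \<open>unit i\<close>.\<close>

lemma frame_faithful:
  assumes frame: "frame r \<rho>" and s: "s \<in> nz r" and t: "t \<in> nz r"
    and eq: "\<And>x. x \<in> X \<Longrightarrow> \<rho> s x = \<rho> t x" and i: "i < r"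
  shows "s i = t i"
proof -
  have "\<exists>p q. p \<in> weights r \<rho> \<and> q \<in> weights r \<rho> \<and> unit i = p - q"
    using frame i unfolding frame_def wdiff_def by blast
  then obtain p q where pq: "p \<in> weights r \<rho>" "q \<in> weights r \<rho>" "unit i = p - q" by blast
  have chi: "chi r w s = chi r w t" if w: "w \<in> weights r \<rho>" for w
  proof -
    obtain f where f: "f \<in> mwt r \<rho> w" "f \<noteq> 0" using w by (auto simp: weights_def)
    then obtain x where fx: "f x \<noteq> 0" by (auto simp: zero_fun_def fun_eq_iff)
    then have x: "x \<in> X" using A_outside[OF mwt_A[OF f(1)]] by blast
    have "chi r w s * f x = chi r w t * f x"
      unfolding mwt_apply[OF f(1) s x, symmetric] mwt_apply[OF f(1) t x, symmetric] eq[OF x] ..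
    then show ?thesis using fx mult_right_cancel by blast
  qed
  have "p = q + unit i" using pq(3) by (simp add: algebra_simps)
  moreover have "chi r (unit i) u = u i" for u :: "nat \<Rightarrow> 'k"
  proof -
    have "chi r (unit i) u = (\<Prod>j<r. if j = i then u i else 1)"
      unfolding chi_def unit_def by (rule prod.cong) auto
    then show ?thesis using i by simp
  qed
  ultimately have "chi r q s * s i = chi r q t * t i"
    using chi[OF pq(1)] s t by (simp add: chi_add)
  then show ?thesis using chi[OF pq(2)] chi_nonzero[OF t, of q] by simp
qed

lemma toric_group_hom:
  assumes \<rho>: "toric r \<rho>"
  shows "(\<lambda>v. restrict (\<rho> (\<lambda>i. v $ i)) X) \<in> hom (torus r) (Aut n X)"
proof (rule homI)
  fix v w :: "'k vec" assume v: "v \<in> carrier (torus r)" and w: "w \<in> carrier (torus r)"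
  note V = torus_coords_nz[OF v] and W = torus_coords_nz[OF w]
  show "restrict (\<rho> (\<lambda>i. (v \<otimes>\<^bsub>torus r\<^esub> w) $ i)) X =
      restrict (\<rho> (\<lambda>i. v $ i)) X \<otimes>\<^bsub>Aut n X\<^esub> restrict (\<rho> (\<lambda>i. w $ i)) X"
  proof -
    have "\<rho> (\<lambda>i. (v \<otimes>\<^bsub>torus r\<^esub> w) $ i) x = \<rho> (\<lambda>i. v $ i) (\<rho> (\<lambda>i. w $ i) x)" if x: "x \<in> X" for x
      using toric_cong[OF \<rho> torus_coords_nz[OF torus_mult_mem[OF v w]] torus_mult_apply x]
        toric_mult[OF \<rho> V W x] by simp
    then show ?thesis
      unfolding Aut_mult[OF toric_Aut[OF \<rho> V] toric_Aut[OF \<rho> W]]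
      using toric_X[OF \<rho> W] by (auto simp: compose_def)
  qed
qed (auto intro: toric_Aut[OF \<rho>] torus_coords_nz)

lemma toric_group_image:
  assumes \<rho>: "toric r \<rho>"
  shows "(\<lambda>v. restrict (\<rho> (\<lambda>i. v $ i)) X) ` carrier (torus r) = toric_group r \<rho>"
proof -
  have "restrict (\<rho> t) X \<in> (\<lambda>v. restrict (\<rho> (\<lambda>i. v $ i)) X) ` carrier (torus r)" if t: "t \<in> nz r" for t
  proof (rule image_eqI[OF _ torus_vec_mem[OF t]])
    show "restrict (\<rho> t) X = restrict (\<rho> (\<lambda>i. torus_vec r t $ i)) X"
      by (rule restrict_ext) (rule toric_cong[OF \<rho> t], simp_all add: torus_vec_apply)
  qed
  then show ?thesis using torus_coords_nz unfolding toric_group_def by auto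
qed

lemma toric_subgroup: assumes \<rho>: "toric r \<rho>" shows "subgroup (toric_group r \<rho>) (Aut n X)"
proof -
  interpret group_hom "torus r" "Aut n X" "\<lambda>v. restrict (\<rho> (\<lambda>i. v $ i)) X"
    by (intro group_hom.intro group_torus group_Aut group_hom_axioms.intro toric_group_hom[OF \<rho>])
  show ?thesis using img_is_subgroup toric_group_image[OF \<rho>] by simp
qed

lemma frame_subtorus:
  assumes frame: "frame r \<rho>" shows "subtorus n X (toric_group r \<rho>)"
proof -
  have \<rho>: "toric r \<rho>" using frame by (simp add: frame_def)
  let ?psi = "\<lambda>v. restrict (\<rho> (\<lambda>i. v $ i)) X"
  have hom: "?psi \<in> hom (torus r) (BijGroup X)"
    using toric_group_hom[OF \<rho>] AutD(4) unfolding hom_def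
    by (subst (asm) (1 2) Aut_eq) (auto simp: BijGroup_def)
  have inj: "inj_on ?psi (carrier (torus r))"
  proof (rule inj_onI)
    fix v w :: "'k vec" assume v: "v \<in> carrier (torus r)" and w: "w \<in> carrier (torus r)" and eq: "?psi v = ?psi w"
    have "\<rho> (\<lambda>i. v $ i) x = \<rho> (\<lambda>i. w $ i) x" if "x \<in> X" for x
      using fun_cong[OF eq, of x] that by simp
    then show "v = w"
      by (intro torus_eqI[OF v w] frame_faithful[OF frame torus_coords_nz[OF v] torus_coords_nz[OF w]])
  qed
  have iso: "?psi \<in> iso (torus r) ((Aut n X)\<lparr>carrier := toric_group r \<rho>\<rparr>)"
    unfolding iso_def using toric_group_hom[OF \<rho>] inj toric_group_image[OF \<rho>]
    by (auto simp: hom_def bij_betw_def)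
  have "regular_action (r + r) (torus r) n X ?psi"
    unfolding regular_action_def
  proof
    show "group_action (torus r) X ?psi"
      by (intro group_action.intro group_hom.intro group_torus group_BijGroup group_hom_axioms.intro hom)
    let ?Y = "product_variety (carrier (torus r)) X"
    have Y: "vec_first v (r + r) \<in> carrier (torus r) \<and> vec_last v n \<in> X" if "v \<in> ?Y" for v
      using product_variety_parts[OF that torus_carrier] .
    have YX: "\<rho> (\<lambda>i. vec_first v (r + r) $ i) (vec_last v n) \<in> X" if "v \<in> ?Y" for v
      using Y[OF that] toric_X[OF \<rho> torus_coords_nz] by blast
    show "morphism ((r + r) + n) ?Y n X (\<lambda>v. ?psi (vec_first v (r + r)) (vec_last v n))"
      unfolding morphism_def
    proof (intro conjI allI impI)
      show "(\<lambda>v. ?psi (vec_first v (r + r)) (vec_last v n)) \<in> ?Y \<rightarrow> X" using Y YX by auto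
      fix j assume j: "j < n"
      show "regular_fun ((r + r) + n) ?Y (\<lambda>v. ?psi (vec_first v (r + r)) (vec_last v n) $ j)"
        by (rule regular_fun_cong[OF toric_coordinate_regular[OF \<rho> crd_A[OF j]]]) (use Y YX in simp)
    qed
  qed
  then show ?thesis
    unfolding subtorus_def algebraic_structure_def
    using toric_subgroup[OF \<rho>] affine_algebraic_group_torus iso torus_iso_refl by blast
qed

end

section \<open>One-parameter subgroups of a regular torus action\<close>

context affine_variety
begin

text \<open>Functions of \<open>(t, x)\<close> that are Laurent polynomials in \<open>t\<close> with coefficients in \<open>A\<close>, that is, the
regular functions on \<open>K\<^sup>\<times> \<times> X\<close>.\<close>

definition laurent_funs :: "('k \<times> 'k vec \<Rightarrow> 'k) set" where
  "laurent_funs = {\<Phi>. \<exists>F c. finite F \<and> (\<forall>i. c i \<in> A) \<and>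
     (\<forall>t x. t \<noteq> 0 \<longrightarrow> x \<in> X \<longrightarrow> \<Phi> (t, x) = (\<Sum>i\<in>F. c i x * t powi i))}"

lemma laurent_funsI:
  assumes J: "finite J" and c: "\<And>j. j \<in> J \<Longrightarrow> c j \<in> A"
    and eq: "\<And>t x. t \<noteq> 0 \<Longrightarrow> x \<in> X \<Longrightarrow> \<Phi> (t, x) = (\<Sum>j\<in>J. c j x * t powi d j)"
  shows "\<Phi> \<in> laurent_funs"
proof -
  let ?c = "\<lambda>i. \<Sum>j | j \<in> J \<and> d j = i. c j"
  have "\<Phi> (t, x) = (\<Sum>i\<in>d ` J. ?c i x * t powi i)" if "t \<noteq> 0" "x \<in> X" for t x
  proof -
    have "\<Phi> (t, x) = (\<Sum>i\<in>d ` J. \<Sum>j | j \<in> J \<and> d j = i. c j x * t powi d j)"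
      unfolding eq[OF that] by (rule sum.image_gen[OF J])
    also have "\<dots> = (\<Sum>i\<in>d ` J. ?c i x * t powi i)"
      unfolding fun_apply sum_distrib_right by (intro sum.cong) auto
    finally show ?thesis .
  qed
  moreover have "?c i \<in> A" for i by (rule A_sum) (use c in auto)
  ultimately show ?thesis
    unfolding laurent_funs_def using J by (intro CollectI exI[of _ "d ` J"] exI[of _ ?c]) auto
qed

lemma laurent_funsE:
  assumes "\<Phi> \<in> laurent_funs"
  shows "\<exists>F c. finite F \<and> (\<forall>i. c i \<in> A) \<and>
     (\<forall>t x. t \<noteq> 0 \<longrightarrow> x \<in> X \<longrightarrow> \<Phi> (t, x) = (\<Sum>i\<in>F. c i x * t powi i))"
  using assms by (simp add: laurent_funs_def)

lemma laurent_funs_cong: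
  assumes "\<Phi> \<in> laurent_funs" "\<And>t x. t \<noteq> 0 \<Longrightarrow> x \<in> X \<Longrightarrow> \<Phi> (t, x) = \<Psi> (t, x)"
  shows "\<Psi> \<in> laurent_funs"
  using assms by (auto simp: laurent_funs_def)

lemma laurent_funs_add:
  assumes "\<Phi> \<in> laurent_funs" "\<Psi> \<in> laurent_funs" shows "(\<lambda>z. \<Phi> z + \<Psi> z) \<in> laurent_funs"
proof -
  obtain F c where F: "finite F" "\<forall>i. c i \<in> A"
    "\<forall>t x. t \<noteq> 0 \<longrightarrow> x \<in> X \<longrightarrow> \<Phi> (t, x) = (\<Sum>i\<in>F. c i x * t powi i)"
    using laurent_funsE[OF assms(1)] by blast
  obtain G d where G: "finite G" "\<forall>i. d i \<in> A"
    "\<forall>t x. t \<noteq> 0 \<longrightarrow> x \<in> X \<longrightarrow> \<Psi> (t, x) = (\<Sum>i\<in>G. d i x * t powi i)"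
    using laurent_funsE[OF assms(2)] by blast
  show ?thesis
  proof (rule laurent_funsI[where J = "F <+> G" and c = "case_sum c d" and d = "case_sum id id"])
    show "finite (F <+> G)" using F(1) G(1) by simp
    show "case_sum c d j \<in> A" for j using F(2) G(2) by (cases j) auto
    show "\<Phi> (t, x) + \<Psi> (t, x) = (\<Sum>j\<in>F <+> G. case_sum c d j x * t powi case_sum id id j)"
      if "t \<noteq> 0" "x \<in> X" for t x
      using that F G by (simp add: sum.Plus)
  qed
qed

lemma laurent_funs_mult:
  assumes "\<Phi> \<in> laurent_funs" "\<Psi> \<in> laurent_funs" shows "(\<lambda>z. \<Phi> z * \<Psi> z) \<in> laurent_funs"
proof -
  obtain F c where F: "finite F" "\<forall>i. c i \<in> A"
    "\<forall>t x. t \<noteq> 0 \<longrightarrow> x \<in> X \<longrightarrow> \<Phi> (t, x) = (\<Sum>i\<in>F. c i x * t powi i)"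
    using laurent_funsE[OF assms(1)] by blast
  obtain G d where G: "finite G" "\<forall>i. d i \<in> A"
    "\<forall>t x. t \<noteq> 0 \<longrightarrow> x \<in> X \<longrightarrow> \<Psi> (t, x) = (\<Sum>i\<in>G. d i x * t powi i)"
    using laurent_funsE[OF assms(2)] by blast
  show ?thesis
  proof (rule laurent_funsI[where J = "F \<times> G" and c = "\<lambda>(i, j). c i * d j" and d = "\<lambda>(i, j). i + j"])
    show "finite (F \<times> G)" using F(1) G(1) by simp
    show "(case j of (i, j) \<Rightarrow> c i * d j) \<in> A" for j using F(2) G(2) by (cases j) (auto intro: A_mult)
    show "\<Phi> (t, x) * \<Psi> (t, x) = (\<Sum>j\<in>F \<times> G. (case j of (i, j) \<Rightarrow> c i * d j) x * t powi (case j of (i, j) \<Rightarrow> i + j))"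
      if t: "t \<noteq> 0" and x: "x \<in> X" for t x
    proof -
      have "\<Phi> (t, x) * \<Psi> (t, x) = (\<Sum>i\<in>F. c i x * t powi i) * (\<Sum>j\<in>G. d j x * t powi j)"
        using F(3) G(3) t x by simp
      then show ?thesis
        unfolding sum_product sum.cartesian_product
        by (simp add: case_prod_beta fun_apply power_int_add t mult_ac)
    qed
  qed
qed

lemma laurent_funs_monomial: "f \<in> A \<Longrightarrow> (\<lambda>(t, x). f x * t powi i) \<in> laurent_funs"
  by (rule laurent_funsI[where J = "{()}" and c = "\<lambda>_. f" and d = "\<lambda>_. i"]) auto

lemma laurent_funs_const: "(\<lambda>_. c) \<in> laurent_funs"
  by (rule laurent_funs_cong[OF laurent_funs_monomial[OF A_const, of c 0]]) auto

lemma laurent_funs_powi: "(\<lambda>(t, x). t powi i) \<in> laurent_funs"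
  by (rule laurent_funs_cong[OF laurent_funs_monomial[OF A_const, of 1 i]]) auto

lemma laurent_funs_subst:
  assumes "p \<in> polynomial_funs N" "\<And>i. i < N \<Longrightarrow> (\<lambda>z. g z $ i) \<in> laurent_funs"
  shows "(\<lambda>z. p (g z)) \<in> laurent_funs"
  by (rule polynomial_funs_subst[OF assms(1)])
    (use assms(2) laurent_funs_const laurent_funs_add laurent_funs_mult in auto)

text \<open>The coefficients of the expansion \<open>f (a t x) = (\<Sum>i\<in>F. c i x * t powi i)\<close> are weight functions:
compare coefficients in \<open>f (a t (a s x)) = f (a (t * s) x)\<close>. They add up to \<open>f\<close>, as \<open>t = 1\<close> shows.\<close>

lemma regular_action_onepar:
  assumes X: "\<And>t x. t \<noteq> 0 \<Longrightarrow> x \<in> X \<Longrightarrow> a t x \<in> X"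
    and one: "\<And>x. x \<in> X \<Longrightarrow> a 1 x = x"
    and mult: "\<And>s t x. s \<noteq> 0 \<Longrightarrow> t \<noteq> 0 \<Longrightarrow> x \<in> X \<Longrightarrow> a (s * t) x = a s (a t x)"
    and reg: "\<And>j. j < n \<Longrightarrow> (\<lambda>(t, x). a t x $ j) \<in> laurent_funs"
  shows "onepar a"
proof (rule oneparI_family[OF X])
  fix f assume f: "f \<in> A"
  obtain p where p: "p \<in> polynomial_funs n" "\<And>x. x \<in> X \<Longrightarrow> f x = p x"
    using A_regular[OF f] by (auto simp: regular_fun_def)
  have "(\<lambda>z. p ((\<lambda>(t, x). a t x) z)) \<in> laurent_funs"
    by (rule laurent_funs_subst[OF p(1)]) (use reg in \<open>simp add: case_prod_unfold\<close>)
  from laurent_funsE[OF this] obtain F c where F: "finite F" "\<forall>i. c i \<in> A"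
    "\<forall>t x. t \<noteq> 0 \<longrightarrow> x \<in> X \<longrightarrow> p (a t x) = (\<Sum>i\<in>F. c i x * t powi i)" by auto
  have eq: "f (a t x) = (\<Sum>i\<in>F. c i x * t powi i)" if "t \<noteq> 0" "x \<in> X" for t x
    using F(3) p(2)[OF X[OF that]] that by simp
  have "c i \<in> wt a i" if i: "i \<in> F" for i
  proof (rule wtI)
    show "c i \<in> A" using F(2) by blast
    fix s :: 'k and x assume s: "s \<noteq> 0" and x: "x \<in> X"
    have "c i (a s x) - s powi i * c i x = 0"
    proof (rule laurent_sum_independent[OF F(1) _ i])
      fix t :: 'k assume t: "t \<noteq> 0"
      have "(\<Sum>i\<in>F. c i (a s x) * t powi i) = f (a (t * s) x)"
        using eq[OF t X[OF s x]] mult[OF t s x] by simp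
      also have "\<dots> = (\<Sum>i\<in>F. c i x * (t * s) powi i)" by (rule eq) (use s t x in auto)
      finally have "(\<Sum>i\<in>F. c i (a s x) * t powi i) - (\<Sum>i\<in>F. c i x * (t * s) powi i) = 0" by simp
      then show "(\<Sum>i\<in>F. (c i (a s x) - s powi i * c i x) * t powi i) = 0"
        unfolding sum_subtractf[symmetric] by (simp add: algebra_simps power_int_mult_distrib)
    qed
    then show "c i (a s x) = s powi i * c i x" by simp
  qed
  moreover have "f = (\<Sum>i\<in>F. c i)"
  proof (rule A_eqI[OF f])
    show "(\<Sum>i\<in>F. c i) \<in> A" by (rule A_sum) (use F(2) in auto)
    show "f x = (\<Sum>i\<in>F. c i) x" if x: "x \<in> X" for x
      using eq[of 1 x] one[OF x] x by (simp add: fun_apply)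
  qed
  ultimately show "\<exists>J (c :: int \<Rightarrow> _) d. finite J \<and> (\<forall>j\<in>J. c j \<in> wt a (d j)) \<and> f = (\<Sum>j\<in>J. c j)"
    using F(1) by (intro exI[of _ F] exI[of _ c] exI[of _ "\<lambda>i. i"]) auto
qed

text \<open>Transport of the action along \<open>(K\<^sup>\<times>)\<^sup>r \<rightarrow> torus r \<rightarrow> G \<rightarrow> S\<close>. The weight decomposition is
established for the coordinate one-parameter subgroups, which generate the torus.\<close>

lemma subtorus_params:
  assumes S: "subtorus n X S"
  shows "\<exists>r \<sigma>. param_action r \<sigma> \<and> (\<forall>i<r. onepar (\<lambda>t. \<sigma> (\<lambda>j. t powi unit i j))) \<and>
    (\<forall>f\<in>S. \<exists>t\<in>nz r. \<forall>x\<in>X. f x = \<sigma> t x)"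
proof -
  obtain m G \<psi> r h where alg: "algebraic_structure n X S m G \<psi>"
    and iso: "algebraic_group_iso m G (r + r) (torus r) h"
    using S unfolding subtorus_def by blast
  define k where "k = inv_into (carrier G) h"
  have G: "group G" and Gc: "carrier G \<subseteq> carrier_vec m"
    using alg by (auto simp: algebraic_structure_def affine_algebraic_group_def zariski_closed_def)
  have h: "h \<in> iso G (torus r)" and kmor: "morphism (r + r) (carrier (torus r)) m (carrier G) k"
    using iso by (auto simp: algebraic_group_iso_def k_def)
  have k: "k \<in> iso (torus r) G" unfolding k_def by (rule group.iso_set_sym[OF G h])
  have kmem: "k v \<in> carrier G" if "v \<in> carrier (torus r)" for v
    using k that by (auto simp: iso_def hom_def)
  interpret group_action G X \<psi>
    using alg by (simp add: algebraic_structure_def regular_action_def)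
  interpret hom: group_hom G "BijGroup X" \<psi> by (rule group_hom)
  have \<psi>X: "\<psi> g x \<in> X" if "g \<in> carrier G" "x \<in> X" for g x
    using element_image[OF that] by simp
  have kmult: "\<psi> (k (v \<otimes>\<^bsub>torus r\<^esub> w)) x = \<psi> (k v) (\<psi> (k w) x)"
    if "v \<in> carrier (torus r)" "w \<in> carrier (torus r)" "x \<in> X" for v w x
    using k that composition_rule[OF that(3) kmem[OF that(1)] kmem[OF that(2)]] by (auto simp: iso_def hom_def)
  have kone: "\<psi> (k \<one>\<^bsub>torus r\<^esub>) x = x" if "x \<in> X" for x
  proof -
    have "k \<one>\<^bsub>torus r\<^esub> = \<one>\<^bsub>G\<^esub>"
      using k group_torus G by (auto simp: iso_def intro: hom_one)
    then show ?thesis using id_eq_one that by (metis restrict_apply')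
  qed
  define \<sigma> where "\<sigma> = (\<lambda>t. \<psi> (k (torus_vec r t)))"
  have mult: "\<sigma> (\<lambda>i. s i * t i) x = \<sigma> s (\<sigma> t x)" if "s \<in> nz r" "t \<in> nz r" "x \<in> X" for s t x
  proof -
    have st: "(\<lambda>i. s i * t i) \<in> nz r" using that by (auto simp: nz_def)
    have "torus_vec r (\<lambda>i. s i * t i) = torus_vec r s \<otimes>\<^bsub>torus r\<^esub> torus_vec r t"
      by (rule torus_eqI[OF torus_vec_mem[OF st]
            torus_mult_mem[OF torus_vec_mem[OF that(1)] torus_vec_mem[OF that(2)]]])
        (simp add: torus_mult_apply torus_vec_apply)
    then show ?thesis using kmult that torus_vec_mem unfolding \<sigma>_def by metis
  qed
  have one: "\<sigma> (\<lambda>_. 1) x = x" if "x \<in> X" for x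
  proof -
    have "(\<lambda>_. 1 :: 'k) \<in> nz r" by (auto simp: nz_def)
    from torus_eqI[OF torus_vec_mem[OF this] torus_one_mem]
    have "torus_vec r (\<lambda>_. 1 :: 'k) = \<one>\<^bsub>torus r\<^esub>"
      by (simp add: torus_one_apply torus_vec_apply)
    then show ?thesis using kone[OF that] by (simp add: \<sigma>_def)
  qed
  have cong: "\<sigma> s x = \<sigma> t x" if "s \<in> nz r" "\<forall>i<r. s i = t i" for s t x
  proof -
    have "torus_vec r s = torus_vec r t" unfolding torus_vec_def using that(2) by (intro eq_vecI) auto
    then show ?thesis by (simp add: \<sigma>_def)
  qed
  have memX: "\<sigma> t x \<in> X" if "t \<in> nz r" "x \<in> X" for t x
    unfolding \<sigma>_def by (rule \<psi>X[OF kmem[OF torus_vec_mem[OF that(1)]] that(2)])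
  have "param_action r \<sigma>" unfolding param_action_def using memX one mult cong by blast
  moreover have "onepar (\<lambda>t. \<sigma> (\<lambda>j. t powi unit i j))" if i: "i < r" for i
  proof (rule regular_action_onepar)
    have nz: "(\<lambda>j. t powi unit i j) \<in> nz r" if "t \<noteq> 0" for t :: 'k using that by (auto simp: nz_def)
    show "\<sigma> (\<lambda>j. t powi unit i j) x \<in> X" if "t \<noteq> 0" "x \<in> X" for t x by (rule memX[OF nz[OF that(1)] that(2)])
    show "\<sigma> (\<lambda>j. 1 powi unit i j) x = x" if "x \<in> X" for x using one[OF that] by simp
    show "\<sigma> (\<lambda>j. (s * t) powi unit i j) x = \<sigma> (\<lambda>j. s powi unit i j) (\<sigma> (\<lambda>j. t powi unit i j) x)"
      if "s \<noteq> 0" "t \<noteq> 0" "x \<in> X" for s t x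
      using mult[OF nz[OF that(1)] nz[OF that(2)] that(3)] by (simp add: power_int_mult_distrib)
    let ?v = "\<lambda>t. torus_vec r (\<lambda>j. t powi unit i j)"
    fix j assume j: "j < n"
    have "morphism (m + n) (product_variety (carrier G) X) n X (\<lambda>v. \<psi> (vec_first v m) (vec_last v n))"
      using alg by (simp add: algebraic_structure_def regular_action_def)
    then obtain p where p: "p \<in> polynomial_funs (m + n)"
      "\<forall>v\<in>product_variety (carrier G) X. \<psi> (vec_first v m) (vec_last v n) $ j = p v"
      using j by (auto simp: morphism_def regular_fun_def)
    have pj: "\<psi> g x $ j = p (g @\<^sub>v x)" if "g \<in> carrier G" "x \<in> X" for g x
    proof -
      have "g @\<^sub>v x \<in> product_variety (carrier G) X" using that by (auto simp: product_variety_def)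
      then show ?thesis using p(2) vec_first_last_append_vec[of g m x n] that Gc X_carrier by fastforce
    qed
    have coord: "(\<lambda>(t, x). (k (?v t) @\<^sub>v x) $ l) \<in> laurent_funs" if l: "l < m + n" for l
    proof (cases "l < m")
      case True
      obtain q where q: "q \<in> polynomial_funs (r + r)" "\<forall>v\<in>carrier (torus r). k v $ l = q v"
        using kmor True by (auto simp: morphism_def regular_fun_def)
      have "(\<lambda>z. q ((\<lambda>(t, x). ?v t) z)) \<in> laurent_funs"
      proof (rule laurent_funs_subst[OF q(1)])
        fix l' assume l': "l' < r + r"
        show "(\<lambda>z. (case z of (t, x) \<Rightarrow> ?v t) $ l') \<in> laurent_funs"
          by (rule laurent_funs_cong[OF laurent_funs_powi[of "if l' < r then unit i l' else - unit i (l' - r)"]])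
            (use l' in \<open>auto simp: torus_vec_def power_int_minus\<close>)
      qed
      then show ?thesis
      proof (rule laurent_funs_cong)
        fix t :: 'k and x assume t: "t \<noteq> 0" and x: "x \<in> X"
        have v: "?v t \<in> carrier (torus r)" by (rule torus_vec_mem[OF nz[OF t]])
        then have "dim_vec (k (?v t)) = m" by (rule carrier_vecD[OF subsetD[OF Gc kmem]])
        then show "q ((\<lambda>(t, x). ?v t) (t, x)) = (\<lambda>(t, x). (k (?v t) @\<^sub>v x) $ l) (t, x)"
          using q(2) v True by simp
      qed
    next
      case False
      then have "l - m < n" using l by simp
      show ?thesis
      proof (rule laurent_funs_cong[OF laurent_funs_monomial[OF crd_A[OF \<open>l - m < n\<close>], of 0]])
        fix t :: 'k and x assume t: "t \<noteq> 0" and x: "x \<in> X"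
        have "?v t \<in> carrier (torus r)" by (rule torus_vec_mem[OF nz[OF t]])
        then have "dim_vec (k (?v t)) = m" by (rule carrier_vecD[OF subsetD[OF Gc kmem]])
        moreover have "dim_vec x = n" using X_carrier[OF x] by simp
        ultimately show "(\<lambda>(t, x). crd (l - m) x * t powi 0) (t, x) = (\<lambda>(t, x). (k (?v t) @\<^sub>v x) $ l) (t, x)"
          using x l False by simp
      qed
    qed
    have "(\<lambda>z. p ((\<lambda>(t, x). k (?v t) @\<^sub>v x) z)) \<in> laurent_funs"
      by (rule laurent_funs_subst[OF p(1)]) (use coord in \<open>simp add: case_prod_unfold\<close>)
    then show "(\<lambda>(t, x). \<sigma> (\<lambda>j. t powi unit i j) x $ j) \<in> laurent_funs"
    proof (rule laurent_funs_cong)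
      fix t :: 'k and x assume t: "t \<noteq> 0" and x: "x \<in> X"
      show "p ((\<lambda>(t, x). k (?v t) @\<^sub>v x) (t, x)) = (\<lambda>(t, x). \<sigma> (\<lambda>j. t powi unit i j) x $ j) (t, x)"
        using pj[OF kmem[OF torus_vec_mem[OF nz[OF t]]] x] by (simp add: \<sigma>_def)
    qed
  qed
  moreover have "\<exists>t\<in>nz r. \<forall>x\<in>X. f x = \<sigma> t x" if f: "f \<in> S" for f
  proof -
    have "bij_betw \<psi> (carrier G) S" using alg by (simp add: algebraic_structure_def iso_def)
    then obtain g where g: "g \<in> carrier G" "f = \<psi> g" using f by (auto simp: bij_betw_def)
    have "bij_betw k (carrier (torus r)) (carrier G)" using k by (simp add: iso_def)
    then obtain v where v: "v \<in> carrier (torus r)" "g = k v" using g(1) by (auto simp: bij_betw_def)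
    have nz: "(\<lambda>i. v $ i) \<in> nz r" by (rule torus_coords_nz[OF v(1)])
    have "torus_vec r (\<lambda>i. v $ i) = v"
      by (rule torus_eqI[OF torus_vec_mem[OF nz] v(1)]) (simp add: torus_vec_apply)
    then show ?thesis using nz g(2) v(2) by (intro bexI[of _ "\<lambda>i. v $ i"]) (auto simp: \<sigma>_def)
  qed
  ultimately show ?thesis by blast
qed

section \<open>The maximal torus\<close>

text \<open>The weight functions of the conjugate action are those of \<open>\<rho>\<close> composed with the inverse of \<open>f\<close>.\<close>

lemma conjugate_toric:
  assumes \<rho>: "toric r \<rho>" and f: "f \<in> carrier (Aut n X)"
  shows "toric r (\<lambda>t x. f (\<rho> t (inv_into X f x)))"
proof (rule toricI_family)
  note F = AutD[OF f]
  let ?g = "inv_into X f"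
  have pull: "cut (\<lambda>x. u (b x)) \<in> A" if "u \<in> A" "morphism n X n X b" for u b
    by (intro cut_A regular_fun_comp[OF A_regular[OF that(1)]]) (use that(2) in \<open>auto simp: morphism_def\<close>)
  show "f (\<rho> t (?g x)) \<in> X" if "t \<in> nz r" "x \<in> X" for t x
    using F(7,8) toric_X[OF \<rho> that(1)] that by blast
  fix u assume u: "u \<in> A"
  obtain W c where W: "finite W" "W \<subseteq> supp r" "\<And>w. w \<in> W \<Longrightarrow> c w \<in> mwt r \<rho> w"
    "cut (\<lambda>x. u (f x)) = (\<Sum>w\<in>W. c w)"
    using toric_decompose[OF \<rho> pull[OF u F(2)]]
    by (elim exE conjE) (rule that, assumption, assumption, erule bspec, assumption+)
  let ?c = "\<lambda>w. cut (\<lambda>x. c w (?g x))"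
  have "?c w \<in> mwt r (\<lambda>t x. f (\<rho> t (?g x))) w" if w: "w \<in> W" for w
  proof (rule mwtI[OF pull[OF mwt_A[OF W(3)[OF w]] F(3)]])
    fix t :: "nat \<Rightarrow> 'k" and x assume t: "t \<in> nz r" and x: "x \<in> X"
    show "?c w (f (\<rho> t (?g x))) = chi r w t * ?c w x"
      using x F(5,7,8) toric_X[OF \<rho> t] mwt_apply[OF W(3)[OF w] t F(8)[OF x]] by simp
  qed
  moreover have "u = (\<Sum>w\<in>W. ?c w)"
  proof (rule A_eqI[OF u])
    show "(\<Sum>w\<in>W. ?c w) \<in> A" by (intro A_sum pull mwt_A[OF W(3)] F(3))
    fix x assume x: "x \<in> X"
    have "u x = cut (\<lambda>x. u (f x)) (?g x)" using x F(6,8) by simp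
    then show "u x = (\<Sum>w\<in>W. ?c w) x" unfolding W(4) using x by (simp add: fun_apply)
  qed
  ultimately show "\<exists>J (c :: (nat \<Rightarrow> int) \<Rightarrow> _) d. finite J \<and>
      (\<forall>j\<in>J. d j \<in> supp r \<and> c j \<in> mwt r (\<lambda>t x. f (\<rho> t (?g x))) (d j)) \<and> u = (\<Sum>j\<in>J. c j)"
    using W(1,2) by (intro exI[of _ W] exI[of _ ?c] exI[of _ "\<lambda>w. w"]) auto
qed

lemma frame_0: "frame 0 (\<lambda>_ x. x)"
proof -
  have "toric 0 (\<lambda>_ x. x)"
  proof (rule toricI_family)
    fix f assume "f \<in> A"
    then show "\<exists>J (c :: unit \<Rightarrow> _) d. finite J \<and> (\<forall>j\<in>J. d j \<in> supp 0 \<and> c j \<in> mwt 0 (\<lambda>_ x. x) (d j)) \<and>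
        f = (\<Sum>j\<in>J. c j)"
      by (intro exI[of _ "{()}"] exI[of _ "\<lambda>_. f"] exI[of _ "\<lambda>_. 0"])
        (auto simp: supp_def fun_apply chi_def intro: mwtI)
  qed
  then show ?thesis by (simp add: frame_def)
qed

text \<open>A frame of maximal rank cannot be extended, so it contains every one-parameter subgroup.\<close>

lemma maximal_frame:
  assumes rigid: "rigid n X"
  shows "\<exists>r \<rho>. frame r \<rho> \<and> (\<forall>a s. onepar a \<longrightarrow> s \<noteq> 0 \<longrightarrow> (\<exists>t\<in>nz r. \<forall>x\<in>X. a s x = \<rho> t x))"
proof -
  define P where "P = (\<lambda>r. \<exists>\<rho>. frame r \<rho>)"
  have P0: "P 0" using frame_0 by (auto simp: P_def)
  have bound: "\<And>r. P r \<Longrightarrow> r \<le> n" using frame_rank_le by (auto simp: P_def)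
  define r where "r = (GREATEST r. P r)"
  have "P r" unfolding r_def by (rule GreatestI_nat[of P, OF P0 bound])
  then obtain \<rho> where \<rho>: "frame r \<rho>" by (auto simp: P_def)
  have maximal: "\<not> P (Suc r)"
    using Greatest_le_nat[of P "Suc r" n] bound unfolding r_def[symmetric] by auto
  have "\<exists>t\<in>nz r. \<forall>x\<in>X. a s x = \<rho> t x" if a: "onepar a" and s: "s \<noteq> 0" for a s
    by (rule frame_extend_or_contain[OF rigid \<rho> a]) (use maximal s in \<open>auto simp: P_def\<close>)
  then show ?thesis using \<rho> by blast
qed

lemma param_action_contained:
  assumes \<rho>: "toric r \<rho>" and max: "\<And>a s. onepar a \<Longrightarrow> s \<noteq> 0 \<Longrightarrow> \<exists>t\<in>nz r. \<forall>x\<in>X. a s x = \<rho> t x"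
    and \<sigma>: "param_action r' \<sigma>" and onepar: "\<And>i. i < r' \<Longrightarrow> onepar (\<lambda>t. \<sigma> (\<lambda>j. t powi unit i j))"
    and t: "t \<in> nz r'"
  shows "\<exists>u\<in>nz r. \<forall>x\<in>X. \<sigma> t x = \<rho> u x"
proof (rule param_action_induct[OF \<sigma> t, where P = "\<lambda>g. \<exists>u\<in>nz r. \<forall>x\<in>X. g x = \<rho> u x"])
  have "(\<lambda>_. 1) \<in> nz r" by (auto simp: nz_def)
  then show "\<exists>u\<in>nz r. \<forall>x\<in>X. x = \<rho> u x" using toric_one[OF \<rho>] by metis
next
  fix i g assume i: "i < r'" and "\<exists>u\<in>nz r. \<forall>x\<in>X. g x = \<rho> u x"
  then obtain u where u: "u \<in> nz r" "\<And>x. x \<in> X \<Longrightarrow> g x = \<rho> u x" by blast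
  have "t i \<noteq> 0" using t i by (auto simp: nz_def)
  then obtain v where v: "v \<in> nz r" "\<And>x. x \<in> X \<Longrightarrow> \<sigma> (\<lambda>j. t i powi unit i j) x = \<rho> v x"
    using max[OF onepar[OF i]] by blast
  have "(\<lambda>i. v i * u i) \<in> nz r" using u v by (auto simp: nz_def)
  moreover have "\<sigma> (\<lambda>j. t i powi unit i j) (g x) = \<rho> (\<lambda>i. v i * u i) x" if x: "x \<in> X" for x
    using toric_mult[OF \<rho> v(1) u(1) x] v(2)[OF toric_X[OF \<rho> u(1) x]] u(2)[OF x] by simp
  ultimately show "\<exists>u\<in>nz r. \<forall>x\<in>X. \<sigma> (\<lambda>j. t i powi unit i j) (g x) = \<rho> u x" by blast
next
  fix g h assume "\<And>x. x \<in> X \<Longrightarrow> g x = h x" "\<exists>u\<in>nz r. \<forall>x\<in>X. g x = \<rho> u x"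
  then show "\<exists>u\<in>nz r. \<forall>x\<in>X. h x = \<rho> u x" by auto
qed

text \<open>For normality, the conjugate of the maximal torus by \<open>f\<close> is again a torus action with weight
decomposition, to which the containment applies.\<close>

lemma exists_maximal_torus:
  assumes rigid: "rigid n X"
  shows "\<exists>T. subtorus n X T \<and> (\<forall>S. subtorus n X S \<longrightarrow> S \<subseteq> T) \<and> T \<lhd> Aut n X"
proof -
  obtain r \<rho> where frame: "frame r \<rho>"
    and "\<forall>a s. onepar a \<longrightarrow> s \<noteq> 0 \<longrightarrow> (\<exists>t\<in>nz r. \<forall>x\<in>X. a s x = \<rho> t x)"
    using maximal_frame[OF rigid] by blast
  then have max: "\<And>a s. onepar a \<Longrightarrow> s \<noteq> 0 \<Longrightarrow> \<exists>t\<in>nz r. \<forall>x\<in>X. a s x = \<rho> t x" by blast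
  have \<rho>: "toric r \<rho>" using frame by (simp add: frame_def)
  let ?T = "toric_group r \<rho>"
  have memT: "f \<in> ?T" if f: "f \<in> carrier (Aut n X)" and u: "u \<in> nz r" and eq: "\<And>x. x \<in> X \<Longrightarrow> f x = \<rho> u x" for f u
  proof -
    have "f = restrict (\<rho> u) X"
      by (rule extensionalityI[OF AutD(1)[OF f]]) (use eq in auto)
    then show ?thesis using u by (auto simp: toric_group_def)
  qed
  have contains: "S \<subseteq> ?T" if S: "subtorus n X S" for S
  proof
    fix f assume f: "f \<in> S"
    have fA: "f \<in> carrier (Aut n X)" using S f by (auto simp: subtorus_def dest: subgroup.mem_carrier)
    obtain r' \<sigma> where \<sigma>: "param_action r' \<sigma>" "\<forall>i<r'. onepar (\<lambda>t. \<sigma> (\<lambda>j. t powi unit i j))"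
      "\<forall>f\<in>S. \<exists>t\<in>nz r'. \<forall>x\<in>X. f x = \<sigma> t x"
      using subtorus_params[OF S] by blast
    obtain t where t: "t \<in> nz r'" "\<forall>x\<in>X. f x = \<sigma> t x" using \<sigma>(3) f by blast
    have "\<exists>u\<in>nz r. \<forall>x\<in>X. \<sigma> t x = \<rho> u x"
    proof (rule param_action_contained[OF \<rho> _ \<sigma>(1) _ t(1)])
      show "\<exists>t\<in>nz r. \<forall>x\<in>X. a s x = \<rho> t x" if "onepar a" "s \<noteq> 0" for a s by (rule max[OF that])
    qed (use \<sigma>(2) in auto)
    then obtain u where "u \<in> nz r" "\<forall>x\<in>X. \<sigma> t x = \<rho> u x" by blast
    then show "f \<in> ?T" using memT[OF fA] t(2) by simp
  qed
  have "?T \<lhd> Aut n X"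
    unfolding group.normal_inv_iff[OF group_Aut]
  proof (intro conjI ballI toric_subgroup[OF \<rho>])
    fix f h assume f: "f \<in> carrier (Aut n X)" and h: "h \<in> ?T"
    obtain t where t: "t \<in> nz r" "h = restrict (\<rho> t) X" using h by (auto simp: toric_group_def)
    have hA: "h \<in> carrier (Aut n X)" using toric_Aut[OF \<rho> t(1)] t(2) by simp
    let ?\<sigma> = "\<lambda>t x. f (\<rho> t (inv_into X f x))"
    have \<sigma>: "toric r ?\<sigma>" by (rule conjugate_toric[OF \<rho> f])
    have "\<exists>u\<in>nz r. \<forall>x\<in>X. ?\<sigma> t x = \<rho> u x"
    proof (rule param_action_contained[OF \<rho> _ toric_param_action[OF \<sigma>] _ t(1)])
      show "\<exists>t\<in>nz r. \<forall>x\<in>X. a s x = \<rho> t x" if "onepar a" "s \<noteq> 0" for a s by (rule max[OF that])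
    qed (rule toric_onepar[OF \<sigma>])
    then obtain u where u: "u \<in> nz r" "\<forall>x\<in>X. ?\<sigma> t x = \<rho> u x" by blast
    interpret Aut: group "Aut n X" by (rule group_Aut)
    have fh: "f \<otimes>\<^bsub>Aut n X\<^esub> h \<in> carrier (Aut n X)" using f hA by simp
    have "(f \<otimes>\<^bsub>Aut n X\<^esub> h \<otimes>\<^bsub>Aut n X\<^esub> inv\<^bsub>Aut n X\<^esub> f) x = \<rho> u x" if x: "x \<in> X" for x
      unfolding Aut_mult[OF fh Aut.inv_closed[OF f]] unfolding Aut_mult[OF f hA] Aut_inv[OF f]
      using u(2) x AutD(8)[OF f x] by (simp add: compose_def t(2))
    then show "f \<otimes>\<^bsub>Aut n X\<^esub> h \<otimes>\<^bsub>Aut n X\<^esub> inv\<^bsub>Aut n X\<^esub> f \<in> ?T"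
      using memT[OF _ u(1)] fh f by simp
  qed
  then show ?thesis using frame_subtorus[OF frame] contains by blast
qed

end

theorem theorem1:
  fixes n :: nat and X :: "'k::{alg_closed_field, field_char_0} vec set"
  assumes "irreducible_affine_variety n X"
    and "rigid n X"
  shows "\<exists>T. subtorus n X T \<and> (\<forall>S. subtorus n X S \<longrightarrow> S \<subseteq> T) \<and> T \<lhd> Aut n X"
proof -
  interpret affine_variety n X by unfold_locales (rule assms(1))
  show ?thesis by (rule exists_maximal_torus[OF assms(2)])
qed

end
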